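(* Let $R$ be a (von Neumann) regular ring which is either $\aleph_0$-left-continuous or $\aleph_0$-right-continuous, let $I$ be a two-sided ideal of $R$, and put $S=R/I$. Then: (a) The monoid $V(S)$ satisfies $$(\forall a,b,c)\bigl(a+c=b+c\Rightarrow(\exists d)(d=2d\leq c\text{ and }a+d=b+d)\bigr).$$ (b) For all principal right ideals $J$ and $K$ of $S$, $J\cong K$ if and only if there are decompositions $J=J_0\oplus J_1$ and $K=K_0\oplus K_1$ in $\mathcal{L}(S_S)$ such that $J_0\sim K_0$ and $J_1\sim K_1$. (c) The natural homomorphism $\pi_S\colon\operatorname{Dim}\mathcal{L}(S_S)\to V(S)$, determined by $\pi_S(\Delta(X))=[X]$ for all $X\in\mathcal{L}(S_S)$, is an isomorphism; thus, $V(S)\cong\operatorname{Dim}\mathcal{L}(S_S)$. (d) If $S$ is directly finite, then it is unit-regular.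
   Context: Rings are associative and unital, not necessarily commutative. For a regular ring $S$, $\mathcal{L}(S_S)$ is the complemented modular lattice of all principal right ideals of $S$. $V(S)$ is the commutative monoid of isomorphism classes $[A]$ of finitely generated projective right $S$-modules, with $[A]+[B]=[A\oplus B]$; $\leq$ on it is the algebraic preordering ($x\leq y$ iff $x+z=y$ for some $z$). $J\cong K$ denotes isomorphism of right $S$-modules. A lattice $L$ is $\aleph_0$-meet-continuous if for every $a\in L$ and every increasing sequence $\langle b_n\mid n\in\omega\rangle$ of elements of $L$, the supremum $\bigvee_nb_n$ exists and $a\wedge\bigvee_nb_n=\bigvee_n(a\wedge b_n)$. A regular ring $R$ is $\aleph_0$-right-continuous if the lattice $\mathcal{L}(R_R)$ of its principal right ideals is $\aleph_0$-meet-continuous, and $\aleph_0$-left-continuous if the lattice of its principal left ideals is $\aleph_0$-meet-continuous (equivalently, $\mathcal{L}(R_R)$ satisfies the dual condition). In $\mathcal{L}(S_S)$, $\oplus$ is the direct sum: $X=Y\oplus Z$ means $Y\cap Z=0$ and $Y+Z=X$; $Y\sim Z$ (perspectivity) means there is $T\in\mathcal{L}(S_S)$ with $Y\cap T=Z\cap T$ and $Y+T=Z+T$. For a lattice $L$, the dimension monoid $\operatorname{Dim}L$ is the commutative monoid defined by generators $\Delta(a,b)$ (for $a\leq b$ in $L$) and the relations: (D0) $\Delta(a,a)=0$; (D1) $\Delta(a,c)=\Delta(a,b)+\Delta(b,c)$ for $a\leq b\leq c$; (D2) $\Delta(a,a\vee b)=\Delta(a\wedge b,b)$ for all $a,b\in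 L$. If $L$ has a least element $0$, write $\Delta(x)=\Delta(0,x)$. A ring $S$ is directly finite if $xy=1$ implies $yx=1$ for all $x,y\in S$; it is unit-regular if for every $x\in S$ there is a unit $u\in S$ with $xux=x$. *)

theory Defs
  imports "HOL-Library.Multiset" "HOL-Library.FuncSet" "HOL-Algebra.QuotRing" "HOL-Algebra.Lattice"
begin

section \<open>Rings\<close>

definition regular_ring :: "('a, 'b) ring_scheme \<Rightarrow> bool" where
  "regular_ring R \<longleftrightarrow> ring R \<and>
     (\<forall>x\<in>carrier R. \<exists>y\<in>carrier R. x \<otimes>\<^bsub>R\<^esub> y \<otimes>\<^bsub>R\<^esub> x = x)"

definition unit_regular_ring :: "('a, 'b) ring_scheme \<Rightarrow> bool" where
  "unit_regular_ring R \<longleftrightarrow> ring R \<and>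
     (\<forall>x\<in>carrier R. \<exists>u\<in>Units R. x \<otimes>\<^bsub>R\<^esub> u \<otimes>\<^bsub>R\<^esub> x = x)"

definition directly_finite :: "('a, 'b) ring_scheme \<Rightarrow> bool" where
  "directly_finite R \<longleftrightarrow>
     (\<forall>x\<in>carrier R. \<forall>y\<in>carrier R. x \<otimes>\<^bsub>R\<^esub> y = \<one>\<^bsub>R\<^esub> \<longrightarrow> y \<otimes>\<^bsub>R\<^esub> x = \<one>\<^bsub>R\<^esub>)"


section \<open>Lattices of principal one-sided ideals\<close>

definition right_ideal_lattice :: "('a, 'b) ring_scheme \<Rightarrow> 'a set gorder" where
  "right_ideal_lattice R =
     \<lparr>carrier = {{x \<otimes>\<^bsub>R\<^esub> r | r. r \<in> carrier R} | x. x \<in> carrier R}, eq = (=), le = (\<subseteq>)\<rparr>"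

definition left_ideal_lattice :: "('a, 'b) ring_scheme \<Rightarrow> 'a set gorder" where
  "left_ideal_lattice R =
     \<lparr>carrier = {{r \<otimes>\<^bsub>R\<^esub> x | r. r \<in> carrier R} | x. x \<in> carrier R}, eq = (=), le = (\<subseteq>)\<rparr>"

definition aleph0_meet_continuous :: "('l, 'b) gorder_scheme \<Rightarrow> bool" where
  "aleph0_meet_continuous L \<longleftrightarrow> lattice L \<and>
     (\<forall>a\<in>carrier L. \<forall>b :: nat \<Rightarrow> 'l.
        (\<forall>n. b n \<in> carrier L) \<and> (\<forall>n. b n \<sqsubseteq>\<^bsub>L\<^esub> b (Suc n)) \<longrightarrow>
        (\<exists>s. least L s (Upper L (range b)) \<and>
             least L (a \<sqinter>\<^bsub>L\<^esub> s) (Upper L (range (\<lambda>n. a \<sqinter>\<^bsub>L\<^esub> b n)))))"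

definition aleph0_right_continuous :: "('a, 'b) ring_scheme \<Rightarrow> bool" where
  "aleph0_right_continuous R \<longleftrightarrow>
     regular_ring R \<and> aleph0_meet_continuous (right_ideal_lattice R)"

definition aleph0_left_continuous :: "('a, 'b) ring_scheme \<Rightarrow> bool" where
  "aleph0_left_continuous R \<longleftrightarrow>
     regular_ring R \<and> aleph0_meet_continuous (left_ideal_lattice R)"

definition ideal_dsum ::
    "('a, 'b) ring_scheme \<Rightarrow> 'a set \<Rightarrow> 'a set \<Rightarrow> 'a set \<Rightarrow> bool" where
  "ideal_dsum R X Y Z \<longleftrightarrow> Y \<inter> Z = {\<zero>\<^bsub>R\<^esub>} \<and> Y <+>\<^bsub>R\<^esub> Z = X"

definition ideal_perspective :: "('a, 'b) ring_scheme \<Rightarrow> 'a set \<Rightarrow> 'a set \<Rightarrow> bool" where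
  "ideal_perspective R Y Z \<longleftrightarrow>
     (\<exists>T\<in>carrier (right_ideal_lattice R). Y \<inter> T = Z \<inter> T \<and> Y <+>\<^bsub>R\<^esub> T = Z <+>\<^bsub>R\<^esub> T)"


section \<open>Right modules over a not necessarily commutative ring\<close>

text \<open>As for the record \<open>module\<close> of the library, the fields \<open>mult\<close> and \<open>one\<close> inherited from
  \<open>ring\<close> are irrelevant; only the additive structure is used.\<close>

record ('a, 'm) rmodule = "'m ring" +
  ract :: "['m, 'a] \<Rightarrow> 'm"

locale right_module = R?: ring R + M?: abelian_group M
    for R :: "('a, 'b) ring_scheme" (structure) and M :: "('a, 'm) rmodule" (structure) +
  assumes ract_closed:
      "\<lbrakk>x \<in> carrier M; r \<in> carrier R\<rbrakk> \<Longrightarrow> ract M x r \<in> carrier M"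
    and ract_add_left:
      "\<lbrakk>x \<in> carrier M; y \<in> carrier M; r \<in> carrier R\<rbrakk> \<Longrightarrow>
       ract M (x \<oplus>\<^bsub>M\<^esub> y) r = ract M x r \<oplus>\<^bsub>M\<^esub> ract M y r"
    and ract_add_right:
      "\<lbrakk>x \<in> carrier M; r \<in> carrier R; s \<in> carrier R\<rbrakk> \<Longrightarrow>
       ract M x (r \<oplus>\<^bsub>R\<^esub> s) = ract M x r \<oplus>\<^bsub>M\<^esub> ract M x s"
    and ract_assoc:
      "\<lbrakk>x \<in> carrier M; r \<in> carrier R; s \<in> carrier R\<rbrakk> \<Longrightarrow>
       ract M x (r \<otimes>\<^bsub>R\<^esub> s) = ract M (ract M x r) s"
    and ract_one:
      "x \<in> carrier M \<Longrightarrow> ract M x \<one>\<^bsub>R\<^esub> = x"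

definition rmod_hom ::
    "('a, 'b) ring_scheme \<Rightarrow> ('a, 'm) rmodule \<Rightarrow> ('a, 'n) rmodule \<Rightarrow> ('m \<Rightarrow> 'n) set" where
  "rmod_hom R M N = {f \<in> carrier M \<rightarrow> carrier N.
     (\<forall>x\<in>carrier M. \<forall>y\<in>carrier M. f (x \<oplus>\<^bsub>M\<^esub> y) = f x \<oplus>\<^bsub>N\<^esub> f y) \<and>
     (\<forall>x\<in>carrier M. \<forall>r\<in>carrier R. f (ract M x r) = ract N (f x) r)}"

definition rmod_isomorphic ::
    "('a, 'b) ring_scheme \<Rightarrow> ('a, 'm) rmodule \<Rightarrow> ('a, 'n) rmodule \<Rightarrow> bool" where
  "rmod_isomorphic R M N \<longleftrightarrow> (\<exists>f\<in>rmod_hom R M N. bij_betw f (carrier M) (carrier N))"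

definition rmod_dsum ::
    "('a, 'm) rmodule \<Rightarrow> ('a, 'n) rmodule \<Rightarrow> ('a, 'm \<times> 'n) rmodule" where
  "rmod_dsum M N =
     \<lparr>carrier = carrier M \<times> carrier N,
      mult = (\<lambda>_ _. undefined), one = undefined,
      zero = (\<zero>\<^bsub>M\<^esub>, \<zero>\<^bsub>N\<^esub>),
      add = (\<lambda>(x, y) (x', y'). (x \<oplus>\<^bsub>M\<^esub> x', y \<oplus>\<^bsub>N\<^esub> y')),
      ract = (\<lambda>(x, y) r. (ract M x r, ract N y r))\<rparr>"

definition rmod_free :: "('a, 'b) ring_scheme \<Rightarrow> nat \<Rightarrow> ('a, nat \<Rightarrow> 'a) rmodule" where
  "rmod_free R n =
     \<lparr>carrier = {..<n} \<rightarrow>\<^sub>E carrier R,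
      mult = (\<lambda>_ _. undefined), one = undefined,
      zero = (\<lambda>i\<in>{..<n}. \<zero>\<^bsub>R\<^esub>),
      add = (\<lambda>f g. \<lambda>i\<in>{..<n}. f i \<oplus>\<^bsub>R\<^esub> g i),
      ract = (\<lambda>f r. \<lambda>i\<in>{..<n}. f i \<otimes>\<^bsub>R\<^esub> r)\<rparr>"

definition right_ideal_module :: "('a, 'b) ring_scheme \<Rightarrow> 'a set \<Rightarrow> ('a, 'a) rmodule" where
  "right_ideal_module R J =
     \<lparr>carrier = J, mult = (\<lambda>_ _. undefined), one = undefined,
      zero = \<zero>\<^bsub>R\<^esub>, add = add R, ract = mult R\<rparr>"

text \<open>Finitely generated projective means: a direct summand of some \<open>R\<^sup>n\<close>. A complement of
  \<open>M\<close> in \<open>R\<^sup>n\<close> is a submodule of \<open>R\<^sup>n\<close>, so nothing is lost by requiring its elements to have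
  type \<open>nat \<Rightarrow> 'a\<close>.\<close>

definition fg_projective :: "('a, 'b) ring_scheme \<Rightarrow> ('a, 'm) rmodule \<Rightarrow> bool" where
  "fg_projective R M \<longleftrightarrow> right_module R M \<and>
     (\<exists>n. \<exists>N :: ('a, nat \<Rightarrow> 'a) rmodule.
        right_module R N \<and> rmod_isomorphic R (rmod_dsum M N) (rmod_free R n))"


section \<open>The monoid V(R)\<close>

text \<open>Every finitely generated projective module is isomorphic to a submodule of some \<open>R\<^sup>n\<close>. The
  isomorphism class of a module \<open>M\<close>, with elements of any type, is therefore represented by the
  set of all finitely generated projective modules isomorphic to \<open>M\<close> with elements of type
  \<open>nat \<Rightarrow> 'a\<close>; this set is nonempty whenever \<open>M\<close> is finitely generated projective.\<close>

definition iso_class ::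
    "('a, 'b) ring_scheme \<Rightarrow> ('a, 'm) rmodule \<Rightarrow> ('a, nat \<Rightarrow> 'a) rmodule set" where
  "iso_class R M = {N. fg_projective R N \<and> rmod_isomorphic R M N}"

text \<open>The additive commutative monoids \<open>V(R)\<close> and \<open>Dim L\<close> are records of the type \<open>monoid\<close> of
  HOL-Algebra, hence written multiplicatively: \<open>\<otimes>\<close> is the addition and \<open>\<one>\<close> is the zero.
  Sums of classes are formed elementwise and closed under the equivalence in question.\<close>

definition V_monoid :: "('a, 'b) ring_scheme \<Rightarrow> ('a, nat \<Rightarrow> 'a) rmodule set monoid" where
  "V_monoid R =
     \<lparr>carrier = {iso_class R M | M :: ('a, nat \<Rightarrow> 'a) rmodule. fg_projective R M},
      mult = (\<lambda>X Y. \<Union>A\<in>X. \<Union>B\<in>Y. iso_class R (rmod_dsum A B)),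
      one = iso_class R (rmod_free R 0)\<rparr>"


section \<open>The dimension monoid of a lattice\<close>

text \<open>Elements of the free commutative monoid on the symbols \<open>\<Delta>(a,b)\<close>, for \<open>a \<le> b\<close> in \<open>L\<close>, are
  multisets of pairs; \<open>dim_cong L\<close> is the monoid congruence generated by (D0), (D1), (D2).\<close>

definition dim_free :: "('l, 'b) gorder_scheme \<Rightarrow> ('l \<times> 'l) multiset set" where
  "dim_free L =
     {A. set_mset A \<subseteq> {(a, b). a \<in> carrier L \<and> b \<in> carrier L \<and> a \<sqsubseteq>\<^bsub>L\<^esub> b}}"

inductive dim_cong ::
    "('l, 'b) gorder_scheme \<Rightarrow> ('l \<times> 'l) multiset \<Rightarrow> ('l \<times> 'l) multiset \<Rightarrow> bool"
  for L (structure) where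
  D0: "a \<in> carrier L \<Longrightarrow> dim_cong L {#(a, a)#} {#}"
| D1: "\<lbrakk>a \<in> carrier L; b \<in> carrier L; c \<in> carrier L; a \<sqsubseteq> b; b \<sqsubseteq> c\<rbrakk> \<Longrightarrow>
       dim_cong L {#(a, c)#} {#(a, b), (b, c)#}"
| D2: "\<lbrakk>a \<in> carrier L; b \<in> carrier L\<rbrakk> \<Longrightarrow>
       dim_cong L {#(a, a \<squnion> b)#} {#(a \<sqinter> b, b)#}"
| refl: "A \<in> dim_free L \<Longrightarrow> dim_cong L A A"
| sym: "dim_cong L A B \<Longrightarrow> dim_cong L B A"
| trans: "\<lbrakk>dim_cong L A B; dim_cong L B C\<rbrakk> \<Longrightarrow> dim_cong L A C"
| add: "\<lbrakk>dim_cong L A B; dim_cong L C D\<rbrakk> \<Longrightarrow> dim_cong L (A + C) (B + D)"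

definition dim_class ::
    "('l, 'b) gorder_scheme \<Rightarrow> ('l \<times> 'l) multiset \<Rightarrow> ('l \<times> 'l) multiset set" where
  "dim_class L A = {B. dim_cong L A B}"

definition Dim :: "('l, 'b) gorder_scheme \<Rightarrow> ('l \<times> 'l) multiset set monoid" where
  "Dim L =
     \<lparr>carrier = {dim_class L A | A. A \<in> dim_free L},
      mult = (\<lambda>X Y. \<Union>A\<in>X. \<Union>B\<in>Y. dim_class L (A + B)),
      one = dim_class L {#}\<rparr>"

definition Delta :: "('l, 'b) gorder_scheme \<Rightarrow> 'l \<Rightarrow> 'l \<Rightarrow> ('l \<times> 'l) multiset set" where
  "Delta L a b = dim_class L {#(a, b)#}"

definition Delta0 :: "('l, 'b) gorder_scheme \<Rightarrow> 'l \<Rightarrow> ('l \<times> 'l) multiset set" where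
  "Delta0 L x = Delta L \<bottom>\<^bsub>L\<^esub> x"

text \<open>The elements of \<open>hom\<close> need not preserve the neutral element, so this is added. Being
  \<open>extensional\<close> only fixes the values outside the carrier, so that uniqueness can be stated.\<close>

definition natural_dim_hom ::
    "('a, 'b) ring_scheme \<Rightarrow>
     (('a set \<times> 'a set) multiset set \<Rightarrow> ('a, nat \<Rightarrow> 'a) rmodule set) \<Rightarrow> bool" where
  "natural_dim_hom R \<pi> \<longleftrightarrow>
     \<pi> \<in> hom (Dim (right_ideal_lattice R)) (V_monoid R) \<and>
     \<pi> \<in> extensional (carrier (Dim (right_ideal_lattice R))) \<and>
     \<pi> \<one>\<^bsub>Dim (right_ideal_lattice R)\<^esub> = \<one>\<^bsub>V_monoid R\<^esub> \<and>
     (\<forall>X\<in>carrier (right_ideal_lattice R).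
        \<pi> (Delta0 (right_ideal_lattice R) X) = iso_class R (right_ideal_module R X))"

end

theory Submission
  imports Defs
begin

text \<open>
  Write \<open>e \<sim> f\<close> for equivalence of idempotents (\<open>e = x y\<close>, \<open>f = y x\<close>). The exchange property of
  principal right ideals of a regular ring shows that \<open>V(R)\<close> is a refinement monoid generated by
  the classes \<open>[e]\<close> of the modules \<open>e R\<close>. By refinement, (a) only has to be shown for
  \<open>a + c = b + c \<le> [1]\<close>; in this form it is a statement on idempotents of \<open>R\<close>, which is left-right
  symmetric and inherited by quotients, because idempotents lift.

  Let \<open>R\<close> be right continuous. After one refinement there are orthogonal idempotents of classes
  \<open>y\<close>, \<open>z\<close>, \<open>s\<close> with \<open>y + s = z + s\<close>. Repeated refinement gives \<open>y = x\<^sub>0 + \<dots> + x\<^sub>n + y\<^sub>n\<close>,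
  \<open>z = x\<^sub>0 + \<dots> + x\<^sub>n + z\<^sub>n\<close>, and \<open>s\<close> contains \<open>y\<^sub>1 + z\<^sub>2 + y\<^sub>3 + z\<^sub>4 + \<dots>\<close>. Let \<open>\<eta>\<close> and \<open>\<zeta>\<close> be the
  classes of complements in \<open>y\<close> and \<open>z\<close> of the suprema of the two copies of the \<open>x\<^sub>n\<close>; they lie
  below all \<open>y\<^sub>n\<close> and \<open>z\<^sub>n\<close>, so that \<open>s\<close> contains the supremum of infinitely many copies of \<open>\<eta>\<close> and of \<open>\<zeta>\<close>. Its
  class \<open>d\<close> satisfies \<open>2 d = d\<close>, \<open>\<eta> + d = d = \<zeta> + d\<close>, and \<open>y + d = z + d\<close> follows. Suprema of
  termwise equivalent sequences are only compared when the sequences are orthogonal to each other;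
  the supremum of the graphs of the equivalences is then a common complement.

  For (b), put \<open>M = J \<inter> K\<close>, \<open>J = M \<oplus> J'\<close>, \<open>K = M \<oplus> K'\<close>. By (a), \<open>[J'] + d = [K'] + d\<close> with
  \<open>d = 2 d \<le> [M]\<close>; write \<open>M = D\<^sub>1 \<oplus> D\<^sub>2 \<oplus> M'\<close> with \<open>[D\<^sub>1] = [D\<^sub>2] = d\<close> and take \<open>J\<^sub>0 = J' \<oplus> D\<^sub>1\<close>,
  \<open>K\<^sub>0 = K' \<oplus> D\<^sub>2\<close>, \<open>J\<^sub>1 = D\<^sub>2 \<oplus> M'\<close>, \<open>K\<^sub>1 = D\<^sub>1 \<oplus> M'\<close>. Since perspective ideals have the same dimension,
  (b) shows that \<open>\<Delta>(X)\<close> depends only on \<open>[X]\<close>, and (c) follows from the exchange property.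
\<close>

section \<open>Idempotents and principal right ideals\<close>

text \<open>Continuity need not pass to R/I, so everything infinite happens in R, and only a finite
  configuration of idempotents is carried to the quotient. Equivalences do not lift exactly: t ~ t'
  in R/I lifts to an equivalence of smaller idempotents with the same images, and the differences,
  which vanish in R/I, are moved into a and b. For this reason the transferred property speaks of
  idempotents with a + t = b + t' and not of classes.

  The proof has no countable sum of classes in V(R), only suprema of actual sequences, and
  equivalences are not glued along them; a common complement is the substitute, and it requires
  disjoint sequences. Hence y, z and s must be independent before the iteration starts. Even 2 d = d
  takes care, because a sequence overlaps its own halves: one half is compared with the two quarters
  of the other.

  At each stage only one of y_n and z_n is removed from s, since the two copies inside s may
  overlap. Alternating between them still leaves infinitely many orthogonal copies of both
  residues.\<close>

definition ring_idem :: "('a, 'b) ring_scheme \<Rightarrow> 'a \<Rightarrow> bool" where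
  "ring_idem R e \<longleftrightarrow> e \<in> carrier R \<and> e \<otimes>\<^bsub>R\<^esub> e = e"

definition ring_orth :: "('a, 'b) ring_scheme \<Rightarrow> 'a \<Rightarrow> 'a \<Rightarrow> bool" where
  "ring_orth R e f \<longleftrightarrow> e \<otimes>\<^bsub>R\<^esub> f = \<zero>\<^bsub>R\<^esub> \<and> f \<otimes>\<^bsub>R\<^esub> e = \<zero>\<^bsub>R\<^esub>"

definition idem_equiv :: "('a, 'b) ring_scheme \<Rightarrow> 'a \<Rightarrow> 'a \<Rightarrow> bool" where
  "idem_equiv R e f \<longleftrightarrow>
     (\<exists>x\<in>carrier R. \<exists>y\<in>carrier R. x \<otimes>\<^bsub>R\<^esub> y = e \<and> y \<otimes>\<^bsub>R\<^esub> x = f)"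

text \<open>The order is two-sided, f = e f e, and thus stronger than inclusion of right ideals: it
  is what makes e - f an idempotent orthogonal to f.\<close>

definition idem_le :: "('a, 'b) ring_scheme \<Rightarrow> 'a \<Rightarrow> 'a \<Rightarrow> bool" where
  "idem_le R f e \<longleftrightarrow> e \<otimes>\<^bsub>R\<^esub> f = f \<and> f \<otimes>\<^bsub>R\<^esub> e = f"

definition pideal :: "('a, 'b) ring_scheme \<Rightarrow> 'a \<Rightarrow> 'a set" where
  "pideal R x = {x \<otimes>\<^bsub>R\<^esub> r | r. r \<in> carrier R}"

abbreviation pideals :: "('a, 'b) ring_scheme \<Rightarrow> 'a set set" where
  "pideals R \<equiv> carrier (right_ideal_lattice R)"

lemma pideals_def: "pideals R = pideal R ` carrier R"
  by (auto simp: right_ideal_lattice_def pideal_def)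

lemma le_right_ideal_lattice [simp]: "le (right_ideal_lattice R) = (\<subseteq>)"
  by (simp add: right_ideal_lattice_def)

lemma ring_idem_closed: "ring_idem R e \<Longrightarrow> e \<in> carrier R"
  by (simp add: ring_idem_def)

lemma ring_orth_sym: "ring_orth R e f \<Longrightarrow> ring_orth R f e"
  by (simp add: ring_orth_def)

section \<open>Arithmetic of idempotents in an arbitrary ring\<close>

context ring
begin

text \<open>Applies a known product a b = c inside a right-associated product, where a b no longer
  occurs as a subterm.\<close>

lemma assoc_eq:
  assumes "a \<otimes> b = c" "a \<in> carrier R" "b \<in> carrier R" "x \<in> carrier R"
  shows "a \<otimes> (b \<otimes> x) = c \<otimes> x"
  using assms by (metis m_assoc)



lemma minus_add_cancel:
  assumes "x \<in> carrier R" "y \<in> carrier R"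
  shows "x \<ominus> y \<oplus> y = x" "y \<oplus> (x \<ominus> y) = x"
  using assms by (simp_all add: minus_eq a_assoc l_neg r_neg a_comm a_lcomm)

lemma minus_self [simp]: "x \<in> carrier R \<Longrightarrow> x \<ominus> x = \<zero>"
  by (simp add: minus_eq r_neg)

lemma eq_of_minus_zero:
  assumes "x \<ominus> y = \<zero>" "x \<in> carrier R" "y \<in> carrier R"
  shows "x = y"
  using assms by (metis minus_add_cancel(1) l_zero)

lemma add_minus_cancel:
  assumes "x \<in> carrier R" "y \<in> carrier R"
  shows "x \<oplus> y \<ominus> y = x" "y \<oplus> x \<ominus> y = x"
  using assms by (simp_all add: minus_eq a_assoc l_neg r_neg a_comm a_lcomm)

lemma minus_distl:
  assumes "x \<in> carrier R" "y \<in> carrier R" "z \<in> carrier R"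
  shows "(x \<ominus> y) \<otimes> z = x \<otimes> z \<ominus> y \<otimes> z"
  using assms by (simp add: minus_eq l_distr l_minus)

lemma minus_distr:
  assumes "x \<in> carrier R" "y \<in> carrier R" "z \<in> carrier R"
  shows "z \<otimes> (x \<ominus> y) = z \<otimes> x \<ominus> z \<otimes> y"
  using assms by (simp add: minus_eq r_distr r_minus)

lemma minus_zero_right: "x \<in> carrier R \<Longrightarrow> x \<ominus> \<zero> = x"
  by (simp add: minus_eq)

lemmas ring_expand = l_distr r_distr minus_distl minus_distr

lemma idem_one [simp]: "ring_idem R \<one>"
  by (simp add: ring_idem_def)

lemma idem_zero [simp]: "ring_idem R \<zero>"
  by (simp add: ring_idem_def)

lemma idem_add_orth:
  assumes "ring_idem R e" "ring_idem R f" "ring_orth R e f"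
  shows "ring_idem R (e \<oplus> f)"
  using assms by (simp add: ring_idem_def ring_orth_def ring_expand)

lemma idem_minus:
  assumes "ring_idem R e" "ring_idem R f" "idem_le R f e"
  shows "ring_idem R (e \<ominus> f)" "ring_orth R f (e \<ominus> f)" "f \<oplus> (e \<ominus> f) = e"
    "idem_le R (e \<ominus> f) e"
  using assms
  by (simp_all add: ring_idem_def ring_orth_def idem_le_def ring_expand minus_zero_right
      minus_add_cancel)

lemma idem_add_le:
  assumes "ring_idem R e" "ring_idem R f" "ring_orth R e f"
  shows "idem_le R e (e \<oplus> f)" "idem_le R f (e \<oplus> f)"
  using assms by (simp_all add: ring_idem_def ring_orth_def idem_le_def ring_expand)

lemma idem_le_one: "e \<in> carrier R \<Longrightarrow> idem_le R e \<one>"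
  by (simp add: idem_le_def)

lemma idem_le_refl: "ring_idem R e \<Longrightarrow> idem_le R e e"
  by (simp add: idem_le_def ring_idem_def)

lemma idem_le_trans:
  assumes "idem_le R e f" "idem_le R f g" "e \<in> carrier R" "f \<in> carrier R" "g \<in> carrier R"
  shows "idem_le R e g"
  using assms unfolding idem_le_def by (metis m_assoc)

lemma orth_le_left:
  assumes "ring_orth R f g" "idem_le R e f" "e \<in> carrier R" "f \<in> carrier R" "g \<in> carrier R"
  shows "ring_orth R e g"
  using assms unfolding ring_orth_def idem_le_def by (metis m_assoc l_null r_null)

lemma orth_le:
  assumes "ring_orth R f g" "idem_le R e f" "idem_le R e' g"
    "e \<in> carrier R" "e' \<in> carrier R" "f \<in> carrier R" "g \<in> carrier R"
  shows "ring_orth R e e'"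
  using assms orth_le_left ring_orth_sym by metis

lemma orth_add:
  assumes "ring_orth R e g" "ring_orth R f g" "e \<in> carrier R" "f \<in> carrier R" "g \<in> carrier R"
  shows "ring_orth R (e \<oplus> f) g" "ring_orth R g (e \<oplus> f)"
  using assms by (simp_all add: ring_orth_def ring_expand)

text \<open>Take x f and y e. From e x = x y x = x f and f y = y x y = y e, an idempotent on one
  side can be carried to the other and absorbed there.\<close>

lemma idem_equiv_normalize:
  assumes "idem_equiv R e f" "ring_idem R e" "ring_idem R f"
  obtains x y where "x \<in> carrier R" "y \<in> carrier R" "x \<otimes> y = e" "y \<otimes> x = f"
    "e \<otimes> x = x" "x \<otimes> f = x" "f \<otimes> y = y" "y \<otimes> e = y"
proof -
  obtain x y where xy: "x \<in> carrier R" "y \<in> carrier R" "x \<otimes> y = e" "y \<otimes> x = f"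
    using assms by (auto simp: idem_equiv_def)
  have ee: "e \<in> carrier R" "f \<in> carrier R" "e \<otimes> e = e" "f \<otimes> f = f"
    using assms by (auto simp: ring_idem_def)
  have ex: "e \<otimes> x = x \<otimes> f" and fy: "f \<otimes> y = y \<otimes> e"
    using xy by (metis m_assoc)+
  show thesis
  proof
    show "x \<otimes> f \<in> carrier R" "y \<otimes> e \<in> carrier R" using xy ee by auto
    show "e \<otimes> (x \<otimes> f) = x \<otimes> f" using ex xy ee by (metis m_assoc)
    show "x \<otimes> f \<otimes> f = x \<otimes> f" using xy ee by (metis m_assoc)
    show "y \<otimes> e \<otimes> e = y \<otimes> e" using xy ee by (metis m_assoc)
    show "f \<otimes> (y \<otimes> e) = y \<otimes> e" using fy xy ee by (metis m_assoc)
    have "x \<otimes> f \<otimes> (y \<otimes> e) = x \<otimes> (f \<otimes> (f \<otimes> y))" using fy xy ee by (simp add: m_assoc)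
    also have "\<dots> = x \<otimes> (f \<otimes> y)" using assoc_eq[OF ee(4)] ee xy by simp
    also have "\<dots> = (x \<otimes> y) \<otimes> e" using fy xy(1,2) ee by (simp add: m_assoc)
    finally show "x \<otimes> f \<otimes> (y \<otimes> e) = e" using xy ee by simp
    have "y \<otimes> e \<otimes> (x \<otimes> f) = y \<otimes> (e \<otimes> (e \<otimes> x))" using ex xy ee by (simp add: m_assoc)
    also have "\<dots> = y \<otimes> (e \<otimes> x)" using assoc_eq[OF ee(3)] ee xy by simp
    also have "\<dots> = (y \<otimes> x) \<otimes> f" using ex xy(1,2) ee by (simp add: m_assoc)
    finally show "y \<otimes> e \<otimes> (x \<otimes> f) = f" using xy ee by simp
  qed
qed

lemma idem_equiv_sym: "idem_equiv R e f \<Longrightarrow> idem_equiv R f e"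
  unfolding idem_equiv_def by blast

section \<open>Principal right ideals in an arbitrary ring\<close>

lemma mem_pideal:
  assumes "ring_idem R e"
  shows "x \<in> pideal R e \<longleftrightarrow> x \<in> carrier R \<and> e \<otimes> x = x"
  using assms unfolding pideal_def ring_idem_def by (auto simp: m_assoc[symmetric]) metis

lemma pideal_self: "x \<in> carrier R \<Longrightarrow> x \<in> pideal R x"
  unfolding pideal_def by (auto intro!: exI[of _ \<one>])

lemma pideal_in: "x \<in> carrier R \<Longrightarrow> pideal R x \<in> pideals R"
  by (simp add: pideals_def)

lemma pideal_subset: "X \<in> pideals R \<Longrightarrow> X \<subseteq> carrier R"
  by (auto simp: pideals_def pideal_def)

lemma pideal_mult: "X \<in> pideals R \<Longrightarrow> x \<in> X \<Longrightarrow> r \<in> carrier R \<Longrightarrow> x \<otimes> r \<in> X"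
  by (auto simp: pideals_def pideal_def m_assoc)

lemma pideal_add: "X \<in> pideals R \<Longrightarrow> x \<in> X \<Longrightarrow> y \<in> X \<Longrightarrow> x \<oplus> y \<in> X"
  by (auto simp: pideals_def pideal_def simp flip: r_distr)

lemma pideal_zero: "X \<in> pideals R \<Longrightarrow> \<zero> \<in> X"
  unfolding pideals_def pideal_def by (clarsimp, intro exI[of _ \<zero>]) simp

lemma pideal_minus: "X \<in> pideals R \<Longrightarrow> x \<in> X \<Longrightarrow> \<ominus> x \<in> X"
  by (auto simp: pideals_def pideal_def simp flip: r_minus)

lemma pideal_diff: "X \<in> pideals R \<Longrightarrow> x \<in> X \<Longrightarrow> y \<in> X \<Longrightarrow> x \<ominus> y \<in> X"
  by (simp add: minus_eq pideal_add pideal_minus)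

lemma pideal_le: "X \<in> pideals R \<Longrightarrow> x \<in> X \<Longrightarrow> pideal R x \<subseteq> X"
  using pideal_mult by (auto simp: pideal_def)

lemma pideal_zero_eq: "pideal R \<zero> = {\<zero>}"
  by (auto simp: pideal_def intro!: exI[of _ \<zero>])

lemma zero_in_pideals: "{\<zero>} \<in> pideals R"
  using pideal_in[OF zero_closed] by (simp add: pideal_zero_eq)

lemma idem_le_pideal: "ring_idem R e \<Longrightarrow> ring_idem R f \<Longrightarrow> idem_le R f e \<Longrightarrow> pideal R f \<subseteq> pideal R e"
  by (metis idem_le_def mem_pideal pideal_in pideal_le ring_idem_closed)

lemma mem_set_add: "x \<in> A <+>\<^bsub>R\<^esub> B \<longleftrightarrow> (\<exists>a\<in>A. \<exists>b\<in>B. x = a \<oplus> b)"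
  by (auto simp: set_add_defs)

lemma pideal_sum_upper:
  assumes "X \<in> pideals R" "Y \<in> pideals R"
  shows "X \<subseteq> X <+>\<^bsub>R\<^esub> Y" "Y \<subseteq> X <+>\<^bsub>R\<^esub> Y"
proof -
  note c = pideal_subset[OF assms(1)] pideal_subset[OF assms(2)]
  show "X \<subseteq> X <+>\<^bsub>R\<^esub> Y"
  proof
    fix x assume "x \<in> X"
    then show "x \<in> X <+>\<^bsub>R\<^esub> Y" unfolding mem_set_add using pideal_zero[OF assms(2)] c
      by (intro bexI[of _ x] bexI[of _ \<zero>]) auto
  qed
  show "Y \<subseteq> X <+>\<^bsub>R\<^esub> Y"
  proof
    fix x assume "x \<in> Y"
    then show "x \<in> X <+>\<^bsub>R\<^esub> Y" unfolding mem_set_add using pideal_zero[OF assms(1)] c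
      by (intro bexI[of _ x] bexI[of _ \<zero>]) auto
  qed
qed

lemma pideal_sum_least:
  assumes "Z \<in> pideals R" "X \<subseteq> Z" "Y \<subseteq> Z" shows "X <+>\<^bsub>R\<^esub> Y \<subseteq> Z"
  using assms(2,3) by (auto simp: mem_set_add intro!: pideal_add[OF assms(1)])

lemma pideal_sum_orth:
  assumes "ring_idem R e" "ring_idem R f" "ring_orth R e f"
  shows "ideal_dsum R (pideal R (e \<oplus> f)) (pideal R e) (pideal R f)"
proof -
  note i = idem_add_orth[OF assms]
  have c: "e \<in> carrier R" "f \<in> carrier R" "e \<otimes> e = e" "f \<otimes> f = f" "e \<otimes> f = \<zero>" "f \<otimes> e = \<zero>"
    using assms by (auto simp: ring_idem_def ring_orth_def)
  have "x = \<zero>" if "x \<in> pideal R e" "x \<in> pideal R f" for x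
    using that assms c assoc_eq[OF c(5), of x] by (simp add: mem_pideal)
  moreover have "\<zero> \<in> pideal R e" "\<zero> \<in> pideal R f"
    using assms c by (simp_all add: mem_pideal)
  ultimately have 1: "pideal R e \<inter> pideal R f = {\<zero>}"
    by blast
  have 2: "a \<oplus> b \<in> pideal R (e \<oplus> f)" if "a \<in> pideal R e" "b \<in> pideal R f" for a b
  proof -
    have *: "a \<in> carrier R" "b \<in> carrier R" "e \<otimes> a = a" "f \<otimes> b = b"
      using that assms by (auto simp: mem_pideal)
    have "e \<otimes> b = \<zero>" "f \<otimes> a = \<zero>"
      using assoc_eq[OF c(5), of b] assoc_eq[OF c(6), of a] * c by simp_all
    then show ?thesis using * c i by (simp add: mem_pideal ring_expand)
  qed
  have 3: "\<exists>a\<in>pideal R e. \<exists>b\<in>pideal R f. x = a \<oplus> b" if "x \<in> pideal R (e \<oplus> f)" for x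
  proof -
    have "x \<in> carrier R" "x = e \<otimes> x \<oplus> f \<otimes> x"
      using that i c by (auto simp: mem_pideal ring_expand)
    then show ?thesis unfolding pideal_def by blast
  qed
  show ?thesis unfolding ideal_dsum_def using 1 2 3 by (auto simp: mem_set_add)
qed

text \<open>Decompose the generator itself as e = a + b along A and B. For x in A, the element x - a
  x = b x lies in A and in B, so b x = 0 and a x = x; likewise for B. Applied to a and b this yields
  orthogonal idempotents, applied to all x the generation of A and B.\<close>

lemma ideal_dsum_idems:
  assumes e: "ring_idem R e" and "A \<in> pideals R" "B \<in> pideals R" "ideal_dsum R (pideal R e) A B"
  obtains a b where "ring_idem R a" "ring_idem R b" "ring_orth R a b" "e = a \<oplus> b"
    "A = pideal R a" "B = pideal R b"
proof -
  have AB: "A \<inter> B = {\<zero>}" "A <+>\<^bsub>R\<^esub> B = pideal R e" using assms by (auto simp: ideal_dsum_def)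
  have ec: "e \<in> carrier R" "e \<otimes> e = e" using e by (auto simp: ring_idem_def)
  obtain a b where ab: "a \<in> A" "b \<in> B" "e = a \<oplus> b"
    using AB(2) pideal_self[OF ec(1)] by (metis mem_set_add)
  have c: "a \<in> carrier R" "b \<in> carrier R" using ab assms pideal_subset by blast+
  have sub: "A \<subseteq> pideal R e" "B \<subseteq> pideal R e"
    using pideal_sum_upper[OF assms(2,3)] AB(2) by auto
  have A: "a \<otimes> x = x \<and> b \<otimes> x = \<zero>" if "x \<in> A" for x
  proof -
    have x: "x \<in> carrier R" "e \<otimes> x = x" using that sub e by (auto simp: mem_pideal)
    then have *: "x = a \<otimes> x \<oplus> b \<otimes> x" using ab c by (simp add: ring_expand)
    then have "x \<ominus> a \<otimes> x = b \<otimes> x" using c x by (metis add_minus_cancel(2) m_closed)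
    moreover have "x \<ominus> a \<otimes> x \<in> A" "b \<otimes> x \<in> B"
      using that ab assms x pideal_diff pideal_mult by metis+
    ultimately have "b \<otimes> x = \<zero>" using AB(1) by auto
    then show ?thesis using * c x by simp
  qed
  have B: "b \<otimes> x = x \<and> a \<otimes> x = \<zero>" if "x \<in> B" for x
  proof -
    have x: "x \<in> carrier R" "e \<otimes> x = x" using that sub e by (auto simp: mem_pideal)
    then have *: "x = a \<otimes> x \<oplus> b \<otimes> x" using ab c by (simp add: ring_expand)
    then have "x \<ominus> b \<otimes> x = a \<otimes> x" using c x by (metis add_minus_cancel(1) m_closed)
    moreover have "x \<ominus> b \<otimes> x \<in> B" "a \<otimes> x \<in> A"
      using that ab assms x pideal_diff pideal_mult by metis+
    ultimately have "a \<otimes> x = \<zero>" using AB(1) by auto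
    then show ?thesis using * c x by simp
  qed
  have "ring_idem R a" "ring_idem R b" "ring_orth R a b"
    using A[OF ab(1)] B[OF ab(2)] c by (auto simp: ring_idem_def ring_orth_def)
  moreover have "A = pideal R a"
    using A pideal_le[OF assms(2) ab(1)] pideal_subset[OF assms(2)] \<open>ring_idem R a\<close>
    by (auto simp: mem_pideal)
  moreover have "B = pideal R b"
    using B pideal_le[OF assms(3) ab(2)] pideal_subset[OF assms(3)] \<open>ring_idem R b\<close>
    by (auto simp: mem_pideal)
  ultimately show thesis using that ab by blast
qed

end

section \<open>The lattice of principal right ideals of a regular ring\<close>

locale regular = ring +
  assumes regular: "x \<in> carrier R \<Longrightarrow> \<exists>y\<in>carrier R. x \<otimes> y \<otimes> x = x"

lemma regular_iff: "regular R \<longleftrightarrow> regular_ring R"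
  by (auto simp: regular_def regular_axioms_def regular_ring_def)

context regular
begin

text \<open>If x y x = x, then x y is an idempotent generating x R.\<close>

lemma pideals_idem:
  assumes "X \<in> pideals R" obtains e where "ring_idem R e" "X = pideal R e"
proof -
  obtain x where x: "x \<in> carrier R" "X = pideal R x" using assms by (auto simp: pideals_def)
  obtain y where y: "y \<in> carrier R" "x \<otimes> y \<otimes> x = x" using regular x by blast
  have i: "ring_idem R (x \<otimes> y)" using x y by (simp add: ring_idem_def flip: m_assoc)
  have "pideal R (x \<otimes> y) \<subseteq> X"
    using x y pideal_le pideal_in pideal_self pideal_mult by metis
  moreover have "X \<subseteq> pideal R (x \<otimes> y)"
    unfolding x(2) using i x y by (intro pideal_le) (auto simp: mem_pideal pideal_in)
  ultimately show thesis using that i by blast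
qed

text \<open>Inclusion of g R in e R gives e g = g but nothing about g e. Passing from g to g e keeps
  the ideal and secures the other side.\<close>

lemma idem_below:
  assumes "ring_idem R e" "X \<in> pideals R" "X \<subseteq> pideal R e"
  obtains f where "ring_idem R f" "idem_le R f e" "X = pideal R f"
proof -
  obtain g where g: "ring_idem R g" "X = pideal R g" using pideals_idem assms by blast
  have c: "e \<in> carrier R" "e \<otimes> e = e" "g \<in> carrier R" "g \<otimes> g = g"
    using assms g by (auto simp: ring_idem_def)
  have eg: "e \<otimes> g = g" using assms g c pideal_self mem_pideal by blast
  have "ring_idem R (g \<otimes> e)" using c eg
    by (simp add: ring_idem_def m_assoc assoc_eq[OF eg] assoc_eq[OF c(4)])
  moreover have "idem_le R (g \<otimes> e) e" using c eg
    by (simp add: idem_le_def m_assoc assoc_eq[OF eg])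
  moreover have "X = pideal R (g \<otimes> e)"
  proof
    have "(g \<otimes> e) \<otimes> g = g" using c eg by (simp add: m_assoc)
    then show "X \<subseteq> pideal R (g \<otimes> e)"
      unfolding g(2) using c calculation by (intro pideal_le) (auto simp: mem_pideal pideal_in)
    show "pideal R (g \<otimes> e) \<subseteq> X"
      using c g pideal_le pideal_in pideal_self pideal_mult by metis
  qed
  ultimately show thesis using that by blast
qed

lemma pideals_compl:
  assumes "X \<in> pideals R" "Y \<in> pideals R" "X \<subseteq> Y"
  obtains Z where "Z \<in> pideals R" "ideal_dsum R Y X Z"
proof -
  obtain e where e: "ring_idem R e" "Y = pideal R e" using pideals_idem assms by blast
  obtain f where f: "ring_idem R f" "idem_le R f e" "X = pideal R f"
    using idem_below assms e by metis
  note m = idem_minus[OF e(1) f(1,2)]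
  show thesis
    using that[of "pideal R (e \<ominus> f)"] pideal_sum_orth[OF f(1) m(1,2)] e f m
    by (simp add: pideal_in ring_idem_closed)
qed

text \<open>The sum e R + f R equals e R + k R with k = (1 - e) f, and e k = 0. An idempotent
  generator of k R that is orthogonal to e on both sides turns the sum into one generated by e +
  g.\<close>

lemma pideals_sum:
  assumes "X \<in> pideals R" "Y \<in> pideals R" shows "X <+>\<^bsub>R\<^esub> Y \<in> pideals R"
proof -
  obtain e where e: "ring_idem R e" "X = pideal R e" using pideals_idem assms by blast
  obtain f where f: "ring_idem R f" "Y = pideal R f" using pideals_idem assms by blast
  define k where "k = (\<one> \<ominus> e) \<otimes> f"
  have c: "e \<in> carrier R" "e \<otimes> e = e" "f \<in> carrier R" "f \<otimes> f = f" "k \<in> carrier R"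
    using e f by (auto simp: ring_idem_def k_def)
  obtain g0 where g0: "ring_idem R g0" "pideal R k = pideal R g0"
    using pideals_idem pideal_in c by metis
  have ek: "e \<otimes> k = \<zero>" using c
    by (simp add: k_def ring_expand flip: m_assoc)
  have g0c: "g0 \<in> carrier R" "g0 \<otimes> g0 = g0" using g0 by (auto simp: ring_idem_def)
  have "e \<otimes> g0 = \<zero>"
  proof -
    obtain r where "r \<in> carrier R" "g0 = k \<otimes> r"
      using g0 pideal_self[OF g0c(1)] by (auto simp: pideal_def)
    then show ?thesis using ek c by (simp flip: m_assoc)
  qed
  \<comment> \<open>e g0 = 0 holds because g0 lies in k R. Subtracting g0 e gives g e = 0 as well
    and does not change the ideal.\<close>
  define g where "g = g0 \<ominus> g0 \<otimes> e"
  have gc: "g \<in> carrier R" "g \<otimes> e = \<zero>" "e \<otimes> g = \<zero>" "g \<otimes> g0 = g0" "g0 \<otimes> g = g"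
    using c g0c \<open>e \<otimes> g0 = \<zero>\<close>
    by (simp_all add: g_def ring_expand m_assoc minus_zero_right assoc_eq[OF g0c(2)]
        assoc_eq[OF \<open>e \<otimes> g0 = \<zero>\<close>])
  have "g \<otimes> g = g" using gc(1) g0c c
  proof -
    have "g \<otimes> g = g \<otimes> g0 \<ominus> g \<otimes> (g0 \<otimes> e)"
      unfolding g_def[of] using gc(1) g0c c by (simp add: ring_expand g_def)
    also have "\<dots> = g" using gc(1,4) g0c c assoc_eq[OF gc(4), of e] by (simp add: g_def)
    finally show ?thesis .
  qed
  then have gi: "ring_idem R g" "ring_orth R e g" using gc by (auto simp: ring_idem_def
    ring_orth_def)
  have gk: "pideal R g = pideal R k"
    unfolding g0(2) using gi g0 gc g0c by (intro equalityI pideal_le) (auto simp: mem_pideal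
      pideal_in)
  have s: "pideal R (e \<oplus> g) = pideal R e <+>\<^bsub>R\<^esub> pideal R g"
    using pideal_sum_orth[OF e(1) gi] by (simp add: ideal_dsum_def)
  note i = idem_add_orth[OF e(1) gi]
  note P = pideal_in[OF ring_idem_closed[OF i]]
  have e_in: "e \<in> pideal R (e \<oplus> g)"
    using i gc c by (simp add: mem_pideal ring_expand)
  have g_in: "pideal R k \<subseteq> pideal R (e \<oplus> g)"
    unfolding gk[symmetric] using i gc c \<open>g \<otimes> g = g\<close> P by (intro pideal_le) (auto simp: mem_pideal
      ring_expand)
  have f_eq: "f = e \<otimes> f \<oplus> k" using c by (simp add: k_def ring_expand minus_add_cancel)
  have f_in: "f \<in> pideal R (e \<oplus> g)"
    using f_eq e_in g_in c P pideal_add pideal_mult pideal_self by (metis subsetD)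
  have "X <+>\<^bsub>R\<^esub> Y \<subseteq> pideal R (e \<oplus> g)"
    unfolding e f using pideal_le[OF P e_in] pideal_le[OF P f_in]
    by (auto simp: mem_set_add intro!: pideal_add[OF P])
  moreover have "pideal R (e \<oplus> g) \<subseteq> X <+>\<^bsub>R\<^esub> Y"
  proof
    fix x assume "x \<in> pideal R (e \<oplus> g)"
    then obtain r s where rs: "r \<in> carrier R" "s \<in> carrier R" "x = e \<otimes> r \<oplus> k \<otimes> s"
      unfolding s gk by (auto simp: mem_set_add pideal_def)
    \<comment> \<open>Since k = f - e f, the term e f s of k s is shifted to the summand in e
      R.\<close>
    have "x = e \<otimes> (r \<ominus> f \<otimes> s) \<oplus> f \<otimes> s"
      using rs c by (simp add: k_def ring_expand m_assoc minus_eq a_ac l_minus r_minus)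
    then show "x \<in> X <+>\<^bsub>R\<^esub> Y" unfolding e f mem_set_add pideal_def using rs(1,2) c
      by (intro bexI[of _ "e \<otimes> (r \<ominus> f \<otimes> s)"] bexI[of _ "f \<otimes> s"]) auto
  qed
  ultimately have "X <+>\<^bsub>R\<^esub> Y = pideal R (e \<oplus> g)" by blast
  then show ?thesis using P by simp
qed

text \<open>For x in e R one has k x = x - f x, so the intersection is the kernel of k on e R. If k
  s k = k, then g = e - e s k satisfies k g = 0 and fixes that kernel, hence generates it.\<close>

lemma pideals_Int:
  assumes "X \<in> pideals R" "Y \<in> pideals R" shows "X \<inter> Y \<in> pideals R"
proof -
  obtain e where e: "ring_idem R e" "X = pideal R e" using pideals_idem assms by blast
  obtain f where f: "ring_idem R f" "Y = pideal R f" using pideals_idem assms by blast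
  define k where "k = e \<ominus> f \<otimes> e"
  have c: "e \<in> carrier R" "e \<otimes> e = e" "f \<in> carrier R" "f \<otimes> f = f" "k \<in> carrier R"
    using e f by (auto simp: ring_idem_def k_def)
  obtain s where s: "s \<in> carrier R" "k \<otimes> s \<otimes> k = k" using regular c by blast
  have ke: "k \<otimes> e = k" using c by (simp add: k_def ring_expand m_assoc)
  have kx: "k \<otimes> x = x \<ominus> f \<otimes> x" if "x \<in> carrier R" "e \<otimes> x = x" for x
    using that c by (simp add: k_def ring_expand m_assoc)
  define g where "g = e \<ominus> e \<otimes> s \<otimes> k"
  have g: "g \<in> carrier R" "e \<otimes> g = g" using c s by (auto simp: g_def ring_expand simp flip: m_assoc)
  have "k \<otimes> (e \<otimes> s \<otimes> k) = k"
    using c s ke by (simp flip: m_assoc)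
  then have "k \<otimes> g = \<zero>" using c s ke by (simp add: g_def ring_expand)
  then have fg: "f \<otimes> g = g" using kx[OF g] eq_of_minus_zero g c by (metis m_closed)
  have "X \<inter> Y = pideal R g"
  proof
    show "pideal R g \<subseteq> X \<inter> Y"
      unfolding e f using e f g fg pideal_le pideal_in[OF ring_idem_closed] by (auto simp:
        mem_pideal intro!: pideal_le[THEN subsetD, rotated -1])
    show "X \<inter> Y \<subseteq> pideal R g"
    proof
      fix x assume "x \<in> X \<inter> Y"
      then have x: "x \<in> carrier R" "e \<otimes> x = x" "f \<otimes> x = x" using e f by (auto simp: mem_pideal)
      then have "k \<otimes> x = \<zero>" using kx by simp
      then have "g \<otimes> x = x"
        using x c s by (simp add: g_def ring_expand m_assoc minus_zero_right)
      then show "x \<in> pideal R g" unfolding pideal_def using x by force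
    qed
  qed
  then show ?thesis using g pideal_in by metis
qed

end

section \<open>Right modules and their isomorphisms\<close>

context right_module
begin

lemma ract_zero_left [simp]:
  assumes "r \<in> carrier R" shows "ract M \<zero>\<^bsub>M\<^esub> r = \<zero>\<^bsub>M\<^esub>"
proof -
  have "ract M \<zero>\<^bsub>M\<^esub> r \<oplus>\<^bsub>M\<^esub> ract M \<zero>\<^bsub>M\<^esub> r = ract M \<zero>\<^bsub>M\<^esub> r"
    using ract_add_left[of "\<zero>\<^bsub>M\<^esub>" "\<zero>\<^bsub>M\<^esub>" r] assms by simp
  then show ?thesis using M.add.r_cancel_one' assms ract_closed by fastforce
qed

lemma ract_zero_right [simp]:
  assumes "x \<in> carrier M" shows "ract M x \<zero>\<^bsub>R\<^esub> = \<zero>\<^bsub>M\<^esub>"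
proof -
  have "ract M x \<zero>\<^bsub>R\<^esub> \<oplus>\<^bsub>M\<^esub> ract M x \<zero>\<^bsub>R\<^esub> = ract M x \<zero>\<^bsub>R\<^esub>"
    using ract_add_right[of x "\<zero>\<^bsub>R\<^esub>" "\<zero>\<^bsub>R\<^esub>"] assms by simp
  then show ?thesis using M.add.r_cancel_one' assms ract_closed by fastforce
qed

lemma ract_minus_one:
  assumes "x \<in> carrier M" shows "ract M x (\<ominus>\<^bsub>R\<^esub> \<one>\<^bsub>R\<^esub>) = \<ominus>\<^bsub>M\<^esub> x"
proof (rule M.minus_equality[symmetric])
  show "ract M x (\<ominus>\<^bsub>R\<^esub> \<one>\<^bsub>R\<^esub>) \<oplus>\<^bsub>M\<^esub> x = \<zero>\<^bsub>M\<^esub>"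
    using ract_add_right[of x "\<ominus>\<^bsub>R\<^esub> \<one>\<^bsub>R\<^esub>" "\<one>\<^bsub>R\<^esub>"] assms by (simp add: R.l_neg ract_one)
qed (use assms ract_closed in auto)

lemma ract_minus_left:
  assumes "x \<in> carrier M" "r \<in> carrier R" shows "ract M (\<ominus>\<^bsub>M\<^esub> x) r = \<ominus>\<^bsub>M\<^esub> ract M x r"
proof (rule M.minus_equality[symmetric])
  show "ract M (\<ominus>\<^bsub>M\<^esub> x) r \<oplus>\<^bsub>M\<^esub> ract M x r = \<zero>\<^bsub>M\<^esub>"
    using ract_add_left[of "\<ominus>\<^bsub>M\<^esub> x" x r] assms by (simp add: M.l_neg)
qed (use assms ract_closed in auto)

lemma madd_minus_cancel:
  assumes "x \<in> carrier M" "y \<in> carrier M"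
  shows "x \<oplus>\<^bsub>M\<^esub> y \<ominus>\<^bsub>M\<^esub> y = x" "y \<oplus>\<^bsub>M\<^esub> (x \<ominus>\<^bsub>M\<^esub> y) = x"
    "x \<ominus>\<^bsub>M\<^esub> y \<oplus>\<^bsub>M\<^esub> y = x" "y \<oplus>\<^bsub>M\<^esub> x \<ominus>\<^bsub>M\<^esub> y = x"
  using assms by (simp_all add: M.minus_eq M.a_assoc M.l_neg M.r_neg M.a_comm M.a_lcomm)

text \<open>Closure under negatives needs no assumption: it comes from the action of -1.\<close>

lemma submodule:
  assumes "K \<subseteq> carrier M" "\<zero>\<^bsub>M\<^esub> \<in> K" "\<And>x y. x \<in> K \<Longrightarrow> y \<in> K \<Longrightarrow> x \<oplus>\<^bsub>M\<^esub> y \<in> K"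
    "\<And>x r. x \<in> K \<Longrightarrow> r \<in> carrier R \<Longrightarrow> ract M x r \<in> K"
  shows "right_module R (M\<lparr>carrier := K\<rparr>)"
proof (intro right_module.intro right_module_axioms.intro abelian_groupI)
  show "ring R" ..
  fix x assume "x \<in> carrier (M\<lparr>carrier := K\<rparr>)"
  then have "ract M x (\<ominus>\<^bsub>R\<^esub> \<one>\<^bsub>R\<^esub>) \<in> K" "ract M x (\<ominus>\<^bsub>R\<^esub> \<one>\<^bsub>R\<^esub>) \<oplus>\<^bsub>M\<^esub> x = \<zero>\<^bsub>M\<^esub>"
    using assms ract_minus_one M.l_neg by auto
  then show "\<exists>y\<in>carrier (M\<lparr>carrier := K\<rparr>). y \<oplus>\<^bsub>M\<lparr>carrier := K\<rparr>\<^esub> x = \<zero>\<^bsub>M\<lparr>carrier := K\<rparr>\<^esub>"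
    by auto
qed (use assms in \<open>auto simp: subset_iff ract_add_left ract_add_right ract_assoc ract_one
      M.a_ac\<close>)

end

section \<open>Homomorphisms, isomorphisms and direct sums\<close>

lemma rmod_homD:
  assumes "f \<in> rmod_hom R M N"
  shows "x \<in> carrier M \<Longrightarrow> f x \<in> carrier N"
    "x \<in> carrier M \<Longrightarrow> y \<in> carrier M \<Longrightarrow> f (x \<oplus>\<^bsub>M\<^esub> y) = f x \<oplus>\<^bsub>N\<^esub> f y"
    "x \<in> carrier M \<Longrightarrow> r \<in> carrier R \<Longrightarrow> f (ract M x r) = ract N (f x) r"
  using assms by (auto simp: rmod_hom_def)

lemma rmod_homI:
  assumes "\<And>x. x \<in> carrier M \<Longrightarrow> f x \<in> carrier N"
    "\<And>x y. x \<in> carrier M \<Longrightarrow> y \<in> carrier M \<Longrightarrow> f (x \<oplus>\<^bsub>M\<^esub> y) = f x \<oplus>\<^bsub>N\<^esub> f y"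
    "\<And>x r. x \<in> carrier M \<Longrightarrow> r \<in> carrier R \<Longrightarrow> f (ract M x r) = ract N (f x) r"
  shows "f \<in> rmod_hom R M N"
  using assms by (auto simp: rmod_hom_def)

lemma rmod_hom_zero:
  assumes "f \<in> rmod_hom R M N" "right_module R M" "right_module R N"
  shows "f \<zero>\<^bsub>M\<^esub> = \<zero>\<^bsub>N\<^esub>"
proof -
  interpret M: right_module R M by fact
  interpret N: right_module R N by fact
  have "f \<zero>\<^bsub>M\<^esub> \<oplus>\<^bsub>N\<^esub> f \<zero>\<^bsub>M\<^esub> = f \<zero>\<^bsub>M\<^esub>"
    using rmod_homD(2)[OF assms(1), of "\<zero>\<^bsub>M\<^esub>" "\<zero>\<^bsub>M\<^esub>"] by simp
  then show ?thesis using N.add.r_cancel_one' rmod_homD(1)[OF assms(1)] by fastforce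
qed

lemma rmod_hom_minus:
  assumes "f \<in> rmod_hom R M N" "right_module R M" "right_module R N"
    "x \<in> carrier M" "y \<in> carrier M"
  shows "f (x \<ominus>\<^bsub>M\<^esub> y) = f x \<ominus>\<^bsub>N\<^esub> f y"
proof -
  interpret M: right_module R M by fact
  interpret N: right_module R N by fact
  have "f (x \<ominus>\<^bsub>M\<^esub> y) \<oplus>\<^bsub>N\<^esub> f y = f x"
    using rmod_homD(2)[OF assms(1), of "x \<ominus>\<^bsub>M\<^esub> y" y] assms M.madd_minus_cancel by simp
  then show ?thesis
    using N.madd_minus_cancel(1) rmod_homD(1)[OF assms(1)] assms M.M.minus_closed by metis
qed

lemma rmod_isoI:
  assumes "f \<in> rmod_hom R M N" "bij_betw f (carrier M) (carrier N)"
  shows "rmod_isomorphic R M N"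
  using assms by (auto simp: rmod_isomorphic_def)

lemma rmod_isoE:
  assumes "rmod_isomorphic R M N" "right_module R M"
  obtains f g where "f \<in> rmod_hom R M N" "g \<in> rmod_hom R N M"
    "\<And>x. x \<in> carrier M \<Longrightarrow> g (f x) = x" "\<And>y. y \<in> carrier N \<Longrightarrow> f (g y) = y"
    "bij_betw f (carrier M) (carrier N)" "bij_betw g (carrier N) (carrier M)"
proof -
  interpret M: right_module R M by fact
  obtain f where f: "f \<in> rmod_hom R M N" "bij_betw f (carrier M) (carrier N)"
    using assms by (auto simp: rmod_isomorphic_def)
  define g where "g = inv_into (carrier M) f"
  have gf: "g (f x) = x" if "x \<in> carrier M" for x
    using that f by (simp add: g_def bij_betw_inv_into_left)
  have fg: "f (g y) = y" if "y \<in> carrier N" for y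
    using that f by (simp add: g_def bij_betw_inv_into_right)
  have gb: "bij_betw g (carrier N) (carrier M)"
    unfolding g_def using f bij_betw_inv_into by blast
  then have gc: "g y \<in> carrier M" if "y \<in> carrier N" for y using that bij_betwE by blast
  have "g \<in> rmod_hom R N M"
  proof (rule rmod_homI)
    fix x y assume "x \<in> carrier N" "y \<in> carrier N"
    then show "g (x \<oplus>\<^bsub>N\<^esub> y) = g x \<oplus>\<^bsub>M\<^esub> g y"
      using rmod_homD(2)[OF f(1), of "g x" "g y"] gc fg gf[of "g x \<oplus>\<^bsub>M\<^esub> g y"] by simp
  next
    fix x r assume "x \<in> carrier N" "r \<in> carrier R"
    then show "g (ract N x r) = ract M (g x) r"
      using rmod_homD(3)[OF f(1), of "g x" r] gc fg gf[of "ract M (g x) r"] M.ract_closed by simp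
  qed (use gc in auto)
  then show thesis using that f gf fg gb by blast
qed

lemma rmod_iso_refl: "rmod_isomorphic R M M"
  by (rule rmod_isoI[of id]) (auto simp: rmod_hom_def)

lemma rmod_iso_sym:
  assumes "rmod_isomorphic R M N" "right_module R M"
  shows "rmod_isomorphic R N M"
  using rmod_isoE[OF assms] rmod_isoI by metis

lemma rmod_iso_trans [trans]:
  assumes "rmod_isomorphic R L M" "rmod_isomorphic R M N"
  shows "rmod_isomorphic R L N"
proof -
  obtain f g where fg: "f \<in> rmod_hom R L M" "bij_betw f (carrier L) (carrier M)"
      "g \<in> rmod_hom R M N" "bij_betw g (carrier M) (carrier N)"
    using assms by (auto simp: rmod_isomorphic_def)
  then have "g \<circ> f \<in> rmod_hom R L N" by (auto simp: rmod_hom_def Pi_iff)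
  then show ?thesis using fg bij_betw_trans rmod_isoI by blast
qed

lemma rmod_dsum_simps [simp]:
  "carrier (rmod_dsum M N) = carrier M \<times> carrier N"
  "\<zero>\<^bsub>rmod_dsum M N\<^esub> = (\<zero>\<^bsub>M\<^esub>, \<zero>\<^bsub>N\<^esub>)"
  "(x, y) \<oplus>\<^bsub>rmod_dsum M N\<^esub> (x', y') = (x \<oplus>\<^bsub>M\<^esub> x', y \<oplus>\<^bsub>N\<^esub> y')"
  "ract (rmod_dsum M N) (x, y) r = (ract M x r, ract N y r)"
  by (simp_all add: rmod_dsum_def)

lemma right_module_dsum:
  assumes "right_module R M" "right_module R N"
  shows "right_module R (rmod_dsum M N)"
proof -
  interpret M: right_module R M by fact
  interpret N: right_module R N by fact
  show ?thesis
  proof (intro right_module.intro right_module_axioms.intro abelian_groupI)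
    show "ring R" ..
    fix x assume "x \<in> carrier (rmod_dsum M N)"
    then show "\<exists>y\<in>carrier (rmod_dsum M N). y \<oplus>\<^bsub>rmod_dsum M N\<^esub> x = \<zero>\<^bsub>rmod_dsum M N\<^esub>"
      by (intro bexI[of _ "(\<ominus>\<^bsub>M\<^esub> fst x, \<ominus>\<^bsub>N\<^esub> snd x)"]) (auto simp: M.M.l_neg N.M.l_neg)
  qed (auto simp: M.ract_closed M.ract_add_left M.ract_add_right M.ract_assoc M.ract_one
      M.M.a_ac M.M.l_zero
      N.ract_closed N.ract_add_left N.ract_add_right N.ract_assoc N.ract_one
      N.M.a_ac N.M.l_zero)
qed

lemma dsum_cong:
  assumes "rmod_isomorphic R M M'" "rmod_isomorphic R N N'"
  shows "rmod_isomorphic R (rmod_dsum M N) (rmod_dsum M' N')"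
proof -
  obtain f g where fg: "f \<in> rmod_hom R M M'" "bij_betw f (carrier M) (carrier M')"
      "g \<in> rmod_hom R N N'" "bij_betw g (carrier N) (carrier N')"
    using assms by (auto simp: rmod_isomorphic_def)
  then have "map_prod f g \<in> rmod_hom R (rmod_dsum M N) (rmod_dsum M' N')"
    by (auto simp: rmod_hom_def Pi_iff)
  moreover have "bij_betw (map_prod f g) (carrier M \<times> carrier N) (carrier M' \<times> carrier N')"
    using fg by (simp add: bij_betw_def map_prod_inj_on map_prod_surj_on)
  ultimately show ?thesis by (intro rmod_isoI) auto
qed

lemma dsum_comm: "rmod_isomorphic R (rmod_dsum M N) (rmod_dsum N M)"
  by (rule rmod_isoI[of prod.swap]) (auto simp: rmod_hom_def bij_betw_def inj_on_def image_iff)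

lemma dsum_assoc:
  "rmod_isomorphic R (rmod_dsum (rmod_dsum L M) N) (rmod_dsum L (rmod_dsum M N))"
  by (rule rmod_isoI[of "\<lambda>((x, y), z). (x, y, z)"])
    (auto simp: rmod_hom_def bij_betw_def inj_on_def image_iff)

lemma dsum_assoc':
  "rmod_isomorphic R (rmod_dsum L (rmod_dsum M N)) (rmod_dsum (rmod_dsum L M) N)"
  by (rule rmod_isoI[of "\<lambda>(x, y, z). ((x, y), z)"])
    (auto simp: rmod_hom_def bij_betw_def inj_on_def image_iff)

lemma dsum_trivial:
  assumes "right_module R M" "right_module R N" "carrier N = {\<zero>\<^bsub>N\<^esub>}"
  shows "rmod_isomorphic R M (rmod_dsum M N)"
proof -
  interpret M: right_module R M by fact
  interpret N: right_module R N by fact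
  show ?thesis
    by (rule rmod_isoI[of "\<lambda>x. (x, \<zero>\<^bsub>N\<^esub>)"])
      (auto simp: rmod_hom_def bij_betw_def inj_on_def image_iff assms)
qed

text \<open>Transports a module to the element type of N. This is how modules over arbitrary types
  get copies inside a free module.\<close>

lemma right_module_image:
  assumes "f \<in> rmod_hom R M N" "inj_on f (carrier M)" "right_module R M" "right_module R N"
  shows "right_module R (N\<lparr>carrier := f ` carrier M\<rparr>)"
    "rmod_isomorphic R M (N\<lparr>carrier := f ` carrier M\<rparr>)"
proof -
  interpret M: right_module R M by fact
  interpret N: right_module R N by fact
  note f = rmod_homD[OF assms(1)]
  have "\<zero>\<^bsub>N\<^esub> \<in> f ` carrier M" using rmod_hom_zero[OF assms(1,3,4)] M.M.zero_closed by (metis imageI)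
  then show "right_module R (N\<lparr>carrier := f ` carrier M\<rparr>)"
    by (intro N.submodule) (auto simp: f(1) M.ract_closed simp flip: f(2,3))
  show "rmod_isomorphic R M (N\<lparr>carrier := f ` carrier M\<rparr>)"
    by (rule rmod_isoI[of f]) (use assms f in \<open>auto simp: rmod_hom_def bij_betw_def\<close>)
qed

section \<open>Split homomorphisms and their kernels\<close>

definition rmod_ker :: "('a, 'm) rmodule \<Rightarrow> ('a, 'n) rmodule \<Rightarrow> ('m \<Rightarrow> 'n) \<Rightarrow> ('a, 'm) rmodule" where
  "rmod_ker M N p = M\<lparr>carrier := {x \<in> carrier M. p x = \<zero>\<^bsub>N\<^esub>}\<rparr>"

lemma right_module_ker:
  assumes "p \<in> rmod_hom R M N" "right_module R M" "right_module R N"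
  shows "right_module R (rmod_ker M N p)"
proof -
  interpret M: right_module R M by fact
  interpret N: right_module R N by fact
  show ?thesis unfolding rmod_ker_def
    by (rule M.submodule)
      (auto simp: rmod_homD[OF assms(1)] rmod_hom_zero[OF assms] M.ract_closed)
qed

text \<open>Every m is s (p m) + (m - s (p m)), and the second term is killed by p.\<close>

lemma split_iso:
  assumes "right_module R X" "right_module R M" and s: "s \<in> rmod_hom R X M"
    and p: "p \<in> rmod_hom R M X" and ps: "\<And>x. x \<in> carrier X \<Longrightarrow> p (s x) = x"
  shows "rmod_isomorphic R (rmod_dsum X (rmod_ker M X p)) M"
proof -
  interpret M: right_module R M by fact
  interpret X: right_module R X by fact
  note s' = rmod_homD[OF s] and p' = rmod_homD[OF p]
  have pm: "p (x \<ominus>\<^bsub>M\<^esub> y) = p x \<ominus>\<^bsub>X\<^esub> p y" if "x \<in> carrier M" "y \<in> carrier M" for x y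
    using rmod_hom_minus[OF p] that assms by blast
  show ?thesis
  proof (rule rmod_isoI)
    show "(\<lambda>(x, k). s x \<oplus>\<^bsub>M\<^esub> k) \<in> rmod_hom R (rmod_dsum X (rmod_ker M X p)) M"
      by (rule rmod_homI)
        (auto simp: rmod_ker_def s' p' M.ract_add_left M.ract_closed M.M.a_ac)
    show "bij_betw (\<lambda>(x, k). s x \<oplus>\<^bsub>M\<^esub> k) (carrier (rmod_dsum X (rmod_ker M X p))) (carrier M)"
      by (rule bij_betw_byWitness[where f' = "\<lambda>m. (p m, m \<ominus>\<^bsub>M\<^esub> s (p m))"])
        (auto simp: rmod_ker_def s' p' pm ps M.madd_minus_cancel X.M.minus_eq X.M.r_neg)
  qed
qed

text \<open>Both kernels are isomorphic to the cokernel of \<open>s\<close>.\<close>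

lemma ker_iso:
  assumes "right_module R X" "right_module R M" and s: "s \<in> rmod_hom R X M"
    and p: "p \<in> rmod_hom R M X" and ps: "\<And>x. x \<in> carrier X \<Longrightarrow> p (s x) = x"
    and q: "q \<in> rmod_hom R M X" and qs: "\<And>x. x \<in> carrier X \<Longrightarrow> q (s x) = x"
  shows "rmod_isomorphic R (rmod_ker M X p) (rmod_ker M X q)"
proof -
  interpret M: right_module R M by fact
  interpret X: right_module R X by fact
  note s' = rmod_homD[OF s] and p' = rmod_homD[OF p] and q' = rmod_homD[OF q]
  have pm: "p (x \<ominus>\<^bsub>M\<^esub> y) = p x \<ominus>\<^bsub>X\<^esub> p y" if "x \<in> carrier M" "y \<in> carrier M" for x y
    using rmod_hom_minus[OF p] that assms by blast
  have qm: "q (x \<ominus>\<^bsub>M\<^esub> y) = q x \<ominus>\<^bsub>X\<^esub> q y" if "x \<in> carrier M" "y \<in> carrier M" for x y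
    using rmod_hom_minus[OF q] that assms by blast
  have sm: "s (\<zero>\<^bsub>X\<^esub> \<ominus>\<^bsub>X\<^esub> y) = \<ominus>\<^bsub>M\<^esub> s y" if "y \<in> carrier X" for y
    using rmod_hom_minus[OF s] rmod_hom_zero[OF s] that assms s' by (simp add: M.M.minus_eq)
  have xx: "x \<ominus>\<^bsub>X\<^esub> x = \<zero>\<^bsub>X\<^esub>" if "x \<in> carrier X" for x
    using that by (simp add: X.M.minus_eq X.M.r_neg)
  have mm: "x \<ominus>\<^bsub>M\<^esub> y \<ominus>\<^bsub>M\<^esub> (\<ominus>\<^bsub>M\<^esub> y) = x" if "x \<in> carrier M" "y \<in> carrier M" for x y
    using that by (simp add: M.M.minus_eq M.M.a_assoc M.M.l_neg)
  have add: "x \<oplus>\<^bsub>M\<^esub> y \<ominus>\<^bsub>M\<^esub> (x' \<oplus>\<^bsub>M\<^esub> y') = (x \<ominus>\<^bsub>M\<^esub> x') \<oplus>\<^bsub>M\<^esub> (y \<ominus>\<^bsub>M\<^esub> y')"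
    if "x \<in> carrier M" "y \<in> carrier M" "x' \<in> carrier M" "y' \<in> carrier M" for x y x' y'
    using that by (simp add: M.M.minus_eq M.M.minus_add M.M.a_ac)
  have act: "ract M (x \<ominus>\<^bsub>M\<^esub> y) r = ract M x r \<ominus>\<^bsub>M\<^esub> ract M y r"
    if "x \<in> carrier M" "y \<in> carrier M" "r \<in> carrier R" for x y r
    using that by (simp add: M.M.minus_eq M.ract_add_left M.ract_minus_left)
  show ?thesis
  proof (rule rmod_isoI)
    show "(\<lambda>m. m \<ominus>\<^bsub>M\<^esub> s (q m)) \<in> rmod_hom R (rmod_ker M X p) (rmod_ker M X q)"
      by (rule rmod_homI)
        (auto simp: rmod_ker_def s' p' q' qm qs act add xx)
    show "bij_betw (\<lambda>m. m \<ominus>\<^bsub>M\<^esub> s (q m)) (carrier (rmod_ker M X p)) (carrier (rmod_ker M X q))"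
      by (rule bij_betw_byWitness[where f' = "\<lambda>m. m \<ominus>\<^bsub>M\<^esub> s (p m)"])
        (auto simp: rmod_ker_def s' p' q' pm qm ps qs sm mm xx)
  qed
qed

section \<open>Principal right ideals as modules\<close>

abbreviation idem_mod :: "('a, 'b) ring_scheme \<Rightarrow> 'a \<Rightarrow> ('a, 'a) rmodule" where
  "idem_mod R e \<equiv> right_ideal_module R (pideal R e)"

lemma right_ideal_module_simps [simp]:
  "carrier (right_ideal_module R J) = J" "\<zero>\<^bsub>right_ideal_module R J\<^esub> = \<zero>\<^bsub>R\<^esub>"
  "add (right_ideal_module R J) = add R" "ract (right_ideal_module R J) = mult R"
  by (simp_all add: right_ideal_module_def)

context ring
begin

lemma right_module_ideal:
  assumes "X \<in> pideals R" shows "right_module R (right_ideal_module R X)"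
proof (intro right_module.intro right_module_axioms.intro abelian_groupI)
  show "ring R" ..
  have *: "x \<in> carrier R" if "x \<in> X" for x using that pideal_subset assms by blast
  fix x assume "x \<in> carrier (right_ideal_module R X)"
  then show "\<exists>y\<in>carrier (right_ideal_module R X).
      y \<oplus>\<^bsub>right_ideal_module R X\<^esub> x = \<zero>\<^bsub>right_ideal_module R X\<^esub>"
    using assms by (intro bexI[of _ "\<ominus> x"]) (auto simp: * pideal_minus l_neg)
qed (use pideal_subset[OF assms] in \<open>auto simp: subset_iff pideal_add[OF assms] pideal_mult[OF
  assms]
    pideal_zero[OF assms] a_ac m_assoc ring_expand\<close>)

lemma right_module_idem: "e \<in> carrier R \<Longrightarrow> right_module R (idem_mod R e)"
  by (simp add: right_module_ideal pideal_in)

lemma dsum_ideals_iso: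
  assumes "X \<in> pideals R" "Y \<in> pideals R" "ideal_dsum R Z X Y"
  shows "rmod_isomorphic R (rmod_dsum (right_ideal_module R X) (right_ideal_module R Y))
     (right_ideal_module R Z)"
proof (rule rmod_isoI)
  have c: "x \<in> carrier R" if "x \<in> X \<or> x \<in> Y" for x using that assms pideal_subset by blast
  have Z: "Z = X <+>\<^bsub>R\<^esub> Y" "X \<inter> Y = {\<zero>}" using assms by (auto simp: ideal_dsum_def)
  let ?f = "\<lambda>(x, y). x \<oplus> y"
  show "?f \<in> rmod_hom R (rmod_dsum (right_ideal_module R X) (right_ideal_module R Y))
     (right_ideal_module R Z)"
    by (rule rmod_homI) (auto simp: Z(1) mem_set_add c a_ac ring_expand)
  have "x = x' \<and> y = y'" if "x \<in> X" "x' \<in> X" "y \<in> Y" "y' \<in> Y" "x \<oplus> y = x' \<oplus> y'" for x x' y y'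
  proof -
    have cc: "x \<in> carrier R" "x' \<in> carrier R" "y \<in> carrier R" "y' \<in> carrier R" using that c by auto
    have "x = (x \<oplus> y) \<ominus> y" using cc by (simp add: add_minus_cancel)
    also have "\<dots> = x' \<oplus> (y' \<ominus> y)" unfolding that(5) using cc by (simp add: minus_eq a_assoc)
    finally have "x \<ominus> x' = y' \<ominus> y" using cc add_minus_cancel(2) minus_closed by metis
    then have "x \<ominus> x' \<in> X \<inter> Y" using that assms by (metis IntI pideal_diff)
    then have "x = x'" using Z(2) eq_of_minus_zero cc by auto
    then show ?thesis using that cc by auto
  qed
  then have "inj_on ?f (X \<times> Y)" by (auto simp: inj_on_def)
  moreover have "?f ` (X \<times> Y) = Z"
  proof (intro equalityI subsetI)
    fix z assume "z \<in> ?f ` (X \<times> Y)"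
    then show "z \<in> Z" unfolding Z(1) mem_set_add by auto
  next
    fix z assume "z \<in> Z"
    then obtain x y where "x \<in> X" "y \<in> Y" "z = x \<oplus> y" unfolding Z(1) mem_set_add by blast
    then show "z \<in> ?f ` (X \<times> Y)" by (intro image_eqI[of _ _ "(x, y)"]) auto
  qed
  ultimately
  show "bij_betw ?f (carrier (rmod_dsum (right_ideal_module R X) (right_ideal_module R Y)))
     (carrier (right_ideal_module R Z))"
    by (simp add: bij_betw_def)
qed

text \<open>A homomorphism on e R is left multiplication by its value at e. The values of mutually
  inverse isomorphisms at e and f are elements witnessing the equivalence; conversely y and x of a
  normalized equivalence act as inverse isomorphisms.\<close>

lemma idem_mod_iso_iff:
  assumes "ring_idem R e" "ring_idem R f"
  shows "rmod_isomorphic R (idem_mod R e) (idem_mod R f) \<longleftrightarrow> idem_equiv R e f"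
proof
  have c: "e \<in> carrier R" "f \<in> carrier R" "e \<otimes> e = e" "f \<otimes> f = f"
    using assms by (auto simp: ring_idem_def)
  have me: "e \<in> pideal R e" "f \<in> pideal R f" using c pideal_self by auto
  assume "rmod_isomorphic R (idem_mod R e) (idem_mod R f)"
  then obtain \<phi> \<psi> where \<phi>: "\<phi> \<in> rmod_hom R (idem_mod R e) (idem_mod R f)"
    "\<And>x. x \<in> pideal R e \<Longrightarrow> \<psi> (\<phi> x) = x" "\<And>x. x \<in> pideal R f \<Longrightarrow> \<phi> (\<psi> x) = x"
    and \<psi>: "\<psi> \<in> rmod_hom R (idem_mod R f) (idem_mod R e)"
    using rmod_isoE[OF _ right_module_idem[OF c(1)]] by (metis right_ideal_module_simps(1))
  have x: "\<phi> e \<in> carrier R" "\<psi> f \<in> carrier R" "e \<otimes> \<psi> f = \<psi> f" "f \<otimes> \<phi> e = \<phi> e"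
    using rmod_homD(1)[OF \<phi>(1), of e] rmod_homD(1)[OF \<psi>, of f] me assms by (auto simp: mem_pideal)
  have "\<psi> f \<otimes> \<phi> e = \<psi> (f \<otimes> \<phi> e)" using rmod_homD(3)[OF \<psi>, of f "\<phi> e"] me x by simp
  then have 1: "\<psi> f \<otimes> \<phi> e = e" using x \<phi> me by simp
  have "\<phi> e \<otimes> \<psi> f = \<phi> (e \<otimes> \<psi> f)" using rmod_homD(3)[OF \<phi>(1), of e "\<psi> f"] me x by simp
  then have "\<phi> e \<otimes> \<psi> f = f" using x \<phi> me by simp
  then show "idem_equiv R e f" unfolding idem_equiv_def using 1 x by blast
next
  have c: "e \<in> carrier R" "f \<in> carrier R" "e \<otimes> e = e" "f \<otimes> f = f"
    using assms by (auto simp: ring_idem_def)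
  assume "idem_equiv R e f"
  then obtain x y where xy: "x \<in> carrier R" "y \<in> carrier R" "x \<otimes> y = e" "y \<otimes> x = f"
    "e \<otimes> x = x" "x \<otimes> f = x" "f \<otimes> y = y" "y \<otimes> e = y"
    using idem_equiv_normalize assms by blast
  show "rmod_isomorphic R (idem_mod R e) (idem_mod R f)"
  proof (rule rmod_isoI[of "\<lambda>r. y \<otimes> r"])
    show "(\<otimes>) y \<in> rmod_hom R (idem_mod R e) (idem_mod R f)"
      by (rule rmod_homI)
        (use assms xy(1,2) c assoc_eq[OF xy(7)] in \<open>auto simp: mem_pideal m_assoc ring_expand\<close>)
    show "bij_betw ((\<otimes>) y) (carrier (idem_mod R e)) (carrier (idem_mod R f))"
      by (rule bij_betw_byWitness[where f' = "(\<otimes>) x"])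
       (use assms xy(1,2) c assoc_eq[OF xy(7)] assoc_eq[OF xy(5)] assoc_eq[OF xy(3)] assoc_eq[OF
         xy(4)]
         in \<open>auto simp: mem_pideal\<close>)
  qed
qed

text \<open>The two components c0, d0 of e in C and D are sent back to e R separately; their images
  e1 and e2 add up to e and are the required idempotents.\<close>

lemma idem_split_iso:
  assumes e: "ring_idem R e" and C: "right_module R C" and D: "right_module R D"
    and iso: "rmod_isomorphic R (rmod_dsum C D) (idem_mod R e)"
  obtains e1 e2 where "ring_idem R e1" "ring_idem R e2" "ring_orth R e1 e2" "e1 \<oplus> e2 = e"
    "rmod_isomorphic R C (idem_mod R e1)" "rmod_isomorphic R D (idem_mod R e2)"
proof -
  interpret C: right_module R C by fact
  interpret D: right_module R D by fact
  note CD = right_module_dsum[OF C D]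
  have c: "e \<in> carrier R" "e \<otimes> e = e" using e by (auto simp: ring_idem_def)
  obtain t u where t: "t \<in> rmod_hom R (rmod_dsum C D) (idem_mod R e)"
    "bij_betw t (carrier (rmod_dsum C D)) (carrier (idem_mod R e))"
    and u: "u \<in> rmod_hom R (idem_mod R e) (rmod_dsum C D)"
    and ut: "\<And>x. x \<in> carrier (rmod_dsum C D) \<Longrightarrow> u (t x) = x"
    and tu: "\<And>x. x \<in> carrier (idem_mod R e) \<Longrightarrow> t (u x) = x"
    using rmod_isoE[OF iso CD] by metis
  note t' = rmod_homD[OF t(1)] and u' = rmod_homD[OF u]
  obtain c0 d0 where cd: "u e = (c0, d0)" by fastforce
  have ee: "e \<in> carrier (idem_mod R e)" using c pideal_self by simp
  have cd_c: "c0 \<in> carrier C" "d0 \<in> carrier D" using u'(1)[OF ee] cd by auto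
  have tinj: "x = y" if "t x = t y" "x \<in> carrier C \<times> carrier D" "y \<in> carrier C \<times> carrier D" for x y
    using ut that by (metis rmod_dsum_simps(1))
  define e1 where "e1 = t (c0, \<zero>\<^bsub>D\<^esub>)"
  define e2 where "e2 = t (\<zero>\<^bsub>C\<^esub>, d0)"
  have ec: "e1 \<in> carrier R" "e2 \<in> carrier R" "e \<otimes> e1 = e1" "e \<otimes> e2 = e2"
    using t'(1) cd_c e by (auto simp: e1_def e2_def mem_pideal)
  have sum: "e1 \<oplus> e2 = e"
    using t'(2)[of "(c0, \<zero>\<^bsub>D\<^esub>)" "(\<zero>\<^bsub>C\<^esub>, d0)"] cd_c tu[OF ee] cd by (simp add: e1_def e2_def)
  \<comment> \<open>Elements of e R are fixed by e, so the pair (x, y) is recovered by letting its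
    own image act on (c0, d0). Idempotency and orthogonality of e1, e2 are instances.\<close>
  have key: "x = ract C c0 (t (x, y)) \<and> y = ract D d0 (t (x, y))"
    if "x \<in> carrier C" "y \<in> carrier D" for x y
  proof -
    have txy: "t (x, y) \<in> carrier R" "e \<otimes> t (x, y) = t (x, y)"
      using t'(1)[of "(x, y)"] that e by (auto simp: mem_pideal)
    have "u (e \<otimes> t (x, y)) = (ract C c0 (t (x, y)), ract D d0 (t (x, y)))"
      using u'(3)[OF ee txy(1)] cd by simp
    then show ?thesis using txy ut that by simp
  qed
  have act: "e1 \<otimes> r = t (ract C c0 r, \<zero>\<^bsub>D\<^esub>)" "e2 \<otimes> r = t (\<zero>\<^bsub>C\<^esub>, ract D d0 r)"
    if "r \<in> carrier R" for r
    using t'(3)[of "(c0, \<zero>\<^bsub>D\<^esub>)" r] t'(3)[of "(\<zero>\<^bsub>C\<^esub>, d0)" r] cd_c that by (auto simp: e1_def e2_def)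
  have k1: "ract C c0 e1 = c0" "ract D d0 e1 = \<zero>\<^bsub>D\<^esub>" using key[of c0 "\<zero>\<^bsub>D\<^esub>"] cd_c by (auto simp: e1_def)
  have k2: "ract D d0 e2 = d0" "ract C c0 e2 = \<zero>\<^bsub>C\<^esub>" using key[of "\<zero>\<^bsub>C\<^esub>" d0] cd_c by (auto simp: e2_def)
  have t0: "t (\<zero>\<^bsub>C\<^esub>, \<zero>\<^bsub>D\<^esub>) = \<zero>"
    using rmod_hom_zero[OF t(1) CD right_module_idem[OF c(1)]] by simp
  have i: "ring_idem R e1" "ring_idem R e2" "ring_orth R e1 e2"
    using ec by (auto simp: ring_idem_def ring_orth_def act k1 k2 t0) (auto simp: e1_def e2_def)
  have "rmod_isomorphic R C (idem_mod R e1)"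
  proof (rule rmod_isoI[of "\<lambda>x. t (x, \<zero>\<^bsub>D\<^esub>)"])
    have m: "t (x, \<zero>\<^bsub>D\<^esub>) \<in> pideal R e1" if "x \<in> carrier C" for x
    proof -
      have "t (x, \<zero>\<^bsub>D\<^esub>) \<in> carrier R" using t'(1)[of "(x, \<zero>\<^bsub>D\<^esub>)"] that e by (auto simp: mem_pideal)
      then show ?thesis using i key[of x "\<zero>\<^bsub>D\<^esub>"] that by (simp add: mem_pideal act)
    qed
    then show "(\<lambda>x. t (x, \<zero>\<^bsub>D\<^esub>)) \<in> rmod_hom R C (idem_mod R e1)"
      using t'(2)[of "(_, \<zero>\<^bsub>D\<^esub>)" "(_, \<zero>\<^bsub>D\<^esub>)"] t'(3)[of "(_, \<zero>\<^bsub>D\<^esub>)"] by (intro rmod_homI) auto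
    have "inj_on (\<lambda>x. t (x, \<zero>\<^bsub>D\<^esub>)) (carrier C)" using tinj by (auto simp: inj_on_def)
    moreover have "x \<in> (\<lambda>x. t (x, \<zero>\<^bsub>D\<^esub>)) ` carrier C" if "x \<in> pideal R e1" for x
      using that act i cd_c C.ract_closed by (auto simp: pideal_def)
    ultimately show "bij_betw (\<lambda>x. t (x, \<zero>\<^bsub>D\<^esub>)) (carrier C) (carrier (idem_mod R e1))"
      using m by (auto simp: bij_betw_def)
  qed
  moreover have "rmod_isomorphic R D (idem_mod R e2)"
  proof (rule rmod_isoI[of "\<lambda>x. t (\<zero>\<^bsub>C\<^esub>, x)"])
    have m: "t (\<zero>\<^bsub>C\<^esub>, x) \<in> pideal R e2" if "x \<in> carrier D" for x
    proof -
      have "t (\<zero>\<^bsub>C\<^esub>, x) \<in> carrier R" using t'(1)[of "(\<zero>\<^bsub>C\<^esub>, x)"] that e by (auto simp: mem_pideal)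
      then show ?thesis using i key[of "\<zero>\<^bsub>C\<^esub>" x] that by (simp add: mem_pideal act)
    qed
    then show "(\<lambda>x. t (\<zero>\<^bsub>C\<^esub>, x)) \<in> rmod_hom R D (idem_mod R e2)"
      using t'(2)[of "(\<zero>\<^bsub>C\<^esub>, _)" "(\<zero>\<^bsub>C\<^esub>, _)"] t'(3)[of "(\<zero>\<^bsub>C\<^esub>, _)"] by (intro rmod_homI) auto
    have "inj_on (\<lambda>x. t (\<zero>\<^bsub>C\<^esub>, x)) (carrier D)" using tinj by (auto simp: inj_on_def)
    moreover have "x \<in> (\<lambda>x. t (\<zero>\<^bsub>C\<^esub>, x)) ` carrier D" if "x \<in> pideal R e2" for x
      using that act i cd_c D.ract_closed by (auto simp: pideal_def)
    ultimately show "bij_betw (\<lambda>x. t (\<zero>\<^bsub>C\<^esub>, x)) (carrier D) (carrier (idem_mod R e2))"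
      using m by (auto simp: bij_betw_def)
  qed
  ultimately show thesis using that i sum by blast
qed

end

section \<open>The exchange property and the monoid V(R)\<close>

lemma rmod_dsum_fst:
  "fst (a \<oplus>\<^bsub>rmod_dsum M N\<^esub> b) = fst a \<oplus>\<^bsub>M\<^esub> fst b"
  "fst (ract (rmod_dsum M N) a r) = ract M (fst a) r"
  by (cases a; cases b; simp)+

context regular
begin

text \<open>This is the exchange property of the corner ring e R e: from x + y = e it produces
  complementary idempotents, one in x R and one in y R.\<close>

lemma exchange_idems:
  assumes e: "ring_idem R e" and xy: "x \<in> carrier R" "y \<in> carrier R" "x \<oplus> y = e"
    "e \<otimes> x = x" "e \<otimes> y = y" "x \<otimes> e = x" "y \<otimes> e = y"
  obtains f h a b where "ring_idem R f" "ring_idem R h" "ring_orth R f h" "f \<oplus> h = e"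
    "a \<in> carrier R" "b \<in> carrier R" "x \<otimes> a = f" "y \<otimes> b = h"
proof -
  have c: "e \<in> carrier R" "e \<otimes> e = e" using e by (auto simp: ring_idem_def)
  obtain s where s: "s \<in> carrier R" "x \<otimes> s \<otimes> x = x" using regular xy by blast
  have s': "x \<otimes> (s \<otimes> x) = x" using s xy by (simp add: m_assoc)
  \<comment> \<open>g is an idempotent of e R e with g R = x R.\<close>
  define g where "g = x \<otimes> (s \<otimes> e)"
  have g: "g \<in> carrier R" "g \<otimes> e = g" "e \<otimes> g = g" "g \<otimes> x = x"
    using c s xy s' by (simp_all add: g_def m_assoc assoc_eq[OF xy(4)])
  have "g \<otimes> g = g \<otimes> (x \<otimes> (s \<otimes> e))" by (simp add: g_def)
  also have "\<dots> = g" using assoc_eq[OF g(4)] g(1) xy s c by (simp add: g_def)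
  finally have "g \<otimes> g = g" .
  then have gi: "ring_idem R g" "idem_le R g e" using g by (auto simp: ring_idem_def idem_le_def)
  define k where "k = e \<ominus> g"
  have k: "ring_idem R k" "idem_le R k e" unfolding k_def using idem_minus[OF e gi] by auto
  have kc: "k \<in> carrier R" "k \<otimes> k = k" "e \<otimes> k = k" "k \<otimes> e = k"
    using k by (auto simp: ring_idem_def idem_le_def)
  have kx: "k \<otimes> x = \<zero>" using g c xy by (simp add: k_def ring_expand)
  have "k \<otimes> (x \<oplus> y) = k \<otimes> y" using kx kc(1) xy(1,2) by (simp add: r_distr)
  then have ky: "k \<otimes> y = k" using kc xy(3) by simp
  \<comment> \<open>From k x = 0 and x + y = e it follows that k y = k. Hence y k is idempotent and
    k (e - y k) = 0, which places e - y k in g R = x R.\<close>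
  define h where "h = y \<otimes> k"
  have hc: "h \<in> carrier R" "e \<otimes> h = h" "h \<otimes> e = h" "k \<otimes> h = k"
    using c kc xy ky by (simp_all add: h_def m_assoc assoc_eq[OF xy(5)] assoc_eq[OF ky])
  have "h \<otimes> h = y \<otimes> (k \<otimes> h)" using hc(1) kc xy by (simp add: h_def m_assoc)
  then have "h \<otimes> h = h" using hc(4) by (simp add: h_def)
  then have h: "ring_idem R h" "idem_le R h e" using hc by (auto simp: ring_idem_def idem_le_def)
  note f = idem_minus[OF e h]
  have "k \<otimes> (e \<ominus> h) = \<zero>" using hc kc c by (simp add: ring_expand)
  then have "e \<otimes> (e \<ominus> h) = g \<otimes> (e \<ominus> h)"
    using hc kc c g eq_of_minus_zero[of "e \<otimes> (e \<ominus> h)" "g \<otimes> (e \<ominus> h)"]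
    by (simp add: k_def minus_distl)
  then have "e \<ominus> h = g \<otimes> (e \<ominus> h)" using hc(1,2) c by (simp add: minus_distr)
  then have "e \<ominus> h = x \<otimes> (s \<otimes> e \<otimes> (e \<ominus> h))"
    using hc(1) c s xy(1) by (simp add: g_def m_assoc)
  then show thesis
    using that[OF f(1) h(1) ring_orth_sym[OF f(2)], of "s \<otimes> e \<otimes> (e \<ominus> h)" k] f hc c s kc
    by (simp add: h_def[symmetric] a_comm)
qed

text \<open>The projection p from C + D onto e R is replaced by a diagonal map q with the same
  section. The kernel of p is N, the kernel of q is a direct sum of submodules of C and D, and the
  two kernels are isomorphic by \<open>ker_iso\<close>.\<close>

lemma exchange:
  fixes C :: "('a, 'c) rmodule" and D :: "('a, 'd) rmodule"
  assumes e: "ring_idem R e" and N: "right_module R N" and C: "right_module R C"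
    and D: "right_module R D"
    and iso: "rmod_isomorphic R (rmod_dsum (idem_mod R e) N) (rmod_dsum C D)"
  obtains f h and C' :: "('a, 'c) rmodule" and D' :: "('a, 'd) rmodule"
  where "ring_idem R f" "ring_idem R h" "ring_orth R f h" "f \<oplus> h = e" "right_module R C'"
    "right_module R D'" "rmod_isomorphic R C (rmod_dsum (idem_mod R f) C')"
    "rmod_isomorphic R D (rmod_dsum (idem_mod R h) D')" "rmod_isomorphic R N (rmod_dsum C' D')"
proof -
  interpret C: right_module R C by fact
  interpret D: right_module R D by fact
  interpret N: right_module R N by fact
  have c: "e \<in> carrier R" "e \<otimes> e = e" using e by (auto simp: ring_idem_def)
  note E = right_module_idem[OF c(1)]
  note EN = right_module_dsum[OF E N] and CD = right_module_dsum[OF C D]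
  obtain t u where t: "t \<in> rmod_hom R (rmod_dsum (idem_mod R e) N) (rmod_dsum C D)"
    and u: "u \<in> rmod_hom R (rmod_dsum C D) (rmod_dsum (idem_mod R e) N)"
    and ut: "\<And>x. x \<in> carrier (rmod_dsum (idem_mod R e) N) \<Longrightarrow> u (t x) = x"
    and tu: "\<And>x. x \<in> carrier (rmod_dsum C D) \<Longrightarrow> t (u x) = x"
    using rmod_isoE[OF iso EN] by metis
  note t' = rmod_homD[OF t] and u' = rmod_homD[OF u]
  define p where "p = fst \<circ> u"
  have p: "p \<in> rmod_hom R (rmod_dsum C D) (idem_mod R e)"
  proof (rule rmod_homI)
    fix x y assume "x \<in> carrier (rmod_dsum C D)" "y \<in> carrier (rmod_dsum C D)"
    then show "p (x \<oplus>\<^bsub>rmod_dsum C D\<^esub> y) = p x \<oplus>\<^bsub>idem_mod R e\<^esub> p y"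
      by (simp add: p_def u'(2) rmod_dsum_fst del: rmod_dsum_simps)
  next
    fix x r assume "x \<in> carrier (rmod_dsum C D)" "r \<in> carrier R"
    then show "p (ract (rmod_dsum C D) x r) = ract (idem_mod R e) (p x) r"
      by (simp add: p_def u'(3) rmod_dsum_fst del: rmod_dsum_simps)
  qed (use u'(1) in \<open>auto simp: p_def mem_Times_iff\<close>)
  note p' = rmod_homD[OF p]
  have pc: "p (x, y) \<in> carrier R \<and> e \<otimes> p (x, y) = p (x, y)"
    if "x \<in> carrier C" "y \<in> carrier D" for x y
    using p'(1)[of "(x, y)"] that e by (auto simp: mem_pideal)
  have padd: "p (x \<oplus>\<^bsub>C\<^esub> x', y \<oplus>\<^bsub>D\<^esub> y') = p (x, y) \<oplus> p (x', y')"
    if "x \<in> carrier C" "y \<in> carrier D" "x' \<in> carrier C" "y' \<in> carrier D" for x y x' y'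
    using p'(2)[of "(x, y)" "(x', y')"] that by simp
  have pact: "p (ract C x r, ract D y r) = p (x, y) \<otimes> r"
    if "x \<in> carrier C" "y \<in> carrier D" "r \<in> carrier R" for x y r
    using p'(3)[of "(x, y)" r] that by simp
  obtain gC gD where g: "t (e, \<zero>\<^bsub>N\<^esub>) = (gC, gD)" by fastforce
  have e0: "(e, \<zero>\<^bsub>N\<^esub>) \<in> carrier (rmod_dsum (idem_mod R e) N)" using c pideal_self by simp
  have gc: "gC \<in> carrier C" "gD \<in> carrier D" using t'(1)[OF e0] g by auto
  have ge: "ract C gC e = gC" "ract D gD e = gD" using t'(3)[OF e0 c(1)] g c by auto
  define pC where "pC = (\<lambda>x. p (x, \<zero>\<^bsub>D\<^esub>))"
  define pD where "pD = (\<lambda>x. p (\<zero>\<^bsub>C\<^esub>, x))"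
  have pCD: "p (x, y) = pC x \<oplus> pD y" if "x \<in> carrier C" "y \<in> carrier D" for x y
    using padd[of x "\<zero>\<^bsub>D\<^esub>" "\<zero>\<^bsub>C\<^esub>" y] that by (simp add: pC_def pD_def)
  have pC: "pC x \<in> carrier R" "e \<otimes> pC x = pC x" if "x \<in> carrier C" for x
    using pc that by (auto simp: pC_def)
  have pD: "pD x \<in> carrier R" "e \<otimes> pD x = pD x" if "x \<in> carrier D" for x
    using pc that by (auto simp: pD_def)
  have pCa: "pC (ract C x r) = pC x \<otimes> r" if "x \<in> carrier C" "r \<in> carrier R" for x r
    using pact[of x "\<zero>\<^bsub>D\<^esub>" r] that by (simp add: pC_def)
  have pDa: "pD (ract D x r) = pD x \<otimes> r" if "x \<in> carrier D" "r \<in> carrier R" for x r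
    using pact[of "\<zero>\<^bsub>C\<^esub>" x r] that by (simp add: pD_def)
  have pCp: "pC (x \<oplus>\<^bsub>C\<^esub> y) = pC x \<oplus> pC y" if "x \<in> carrier C" "y \<in> carrier C" for x y
    using padd[of x "\<zero>\<^bsub>D\<^esub>" y "\<zero>\<^bsub>D\<^esub>"] that by (simp add: pC_def)
  have pDp: "pD (x \<oplus>\<^bsub>D\<^esub> y) = pD x \<oplus> pD y" if "x \<in> carrier D" "y \<in> carrier D" for x y
    using padd[of "\<zero>\<^bsub>C\<^esub>" x "\<zero>\<^bsub>C\<^esub>" y] that by (simp add: pD_def)
  have "p (gC, gD) = e" using ut[OF e0] g by (simp add: p_def)
  \<comment> \<open>The pair (gC, gD) is the image of e, so the contributions of its two components
    to the projection add up to e.\<close>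
  then have sum: "pC gC \<oplus> pD gD = e" using pCD gc by simp
  obtain f h a b where fh: "ring_idem R f" "ring_idem R h" "ring_orth R f h" "f \<oplus> h = e"
    and ab: "a \<in> carrier R" "b \<in> carrier R" "pC gC \<otimes> a = f" "pD gD \<otimes> b = h"
    using exchange_idems[OF e _ _ sum] pC pD pCa pDa gc ge c by (metis (no_types, lifting))
  have fc: "f \<in> carrier R" "h \<in> carrier R" "f \<otimes> f = f" "h \<otimes> h = h" "f \<otimes> h = \<zero>" "h \<otimes> f = \<zero>"
    using fh by (auto simp: ring_idem_def ring_orth_def)
  have ef: "e \<otimes> f = f" "e \<otimes> h = h"
    using idem_add_le[OF fh(1-3)] fh(4) by (auto simp: idem_le_def)
  note F = right_module_idem[OF fc(1)] and H = right_module_idem[OF fc(2)]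
  \<comment> \<open>With x = \<open>pC gC\<close> and y = \<open>pD gD\<close>, the relations x a =
    f and y b = h make p (s r) = f r + h r = r. The map q, which first projects the C part by f and
    the D part by h, is split by s for the same reason.\<close>
  define s where "s r = (ract C gC (a \<otimes> r), ract D gD (b \<otimes> r))" for r
  define q where "q = (\<lambda>(x, y). f \<otimes> pC x \<oplus> h \<otimes> pD y)"
  have s: "s \<in> rmod_hom R (idem_mod R e) (rmod_dsum C D)"
    by (rule rmod_homI) (use e ab gc in \<open>auto simp: s_def mem_pideal ring_expand C.ract_closed
      D.ract_closed C.ract_add_right D.ract_add_right m_assoc
      simp flip: C.ract_assoc D.ract_assoc\<close>)
  have q: "q \<in> rmod_hom R (rmod_dsum C D) (idem_mod R e)"
    by (rule rmod_homI) (use e c fc in \<open>auto simp: q_def mem_pideal ring_expand pCa pDa pCp pDp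
      pC pD m_assoc a_ac assoc_eq[OF ef(1)] assoc_eq[OF ef(2)]\<close>)
  have xa: "pC gC \<otimes> (a \<otimes> r) = f \<otimes> r" "pD gD \<otimes> (b \<otimes> r) = h \<otimes> r" if "r \<in> carrier R" for r
    using ab that pC(1) pD(1) gc assoc_eq by blast+
  have fhr: "r \<in> carrier R" "f \<otimes> r \<oplus> h \<otimes> r = r" if "r \<in> carrier (idem_mod R e)" for r
    using that e fc(1,2) by (auto simp: mem_pideal fh(4) simp flip: l_distr)
  have ps: "p (s r) = r" if "r \<in> carrier (idem_mod R e)" for r
    using fhr[OF that] ab(1,2) gc
    by (simp add: s_def pCD C.ract_closed D.ract_closed pCa pDa xa)
  have qs: "q (s r) = r" if "r \<in> carrier (idem_mod R e)" for r
    using fhr[OF that] ab(1,2) gc fc(1,2)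
    by (simp add: s_def q_def C.ract_closed D.ract_closed pCa pDa xa
      assoc_eq[OF fc(3)] assoc_eq[OF fc(4)])
  have 1: "rmod_isomorphic R (rmod_ker (rmod_dsum C D) (idem_mod R e) p)
      (rmod_ker (rmod_dsum C D) (idem_mod R e) q)"
    using ker_iso[OF E CD s p ps q qs] by simp
  have 2: "rmod_isomorphic R N (rmod_ker (rmod_dsum C D) (idem_mod R e) p)"
  proof (rule rmod_isoI[of "\<lambda>n. t (\<zero>, n)"])
    have z: "\<zero> \<in> pideal R e" using c by (simp add: e mem_pideal)
    have tn: "t (\<zero>, n) \<in> carrier C \<times> carrier D \<and> p (t (\<zero>, n)) = \<zero>" if "n \<in> carrier N" for n
      using t'(1)[of "(\<zero>, n)"] ut[of "(\<zero>, n)"] z that by (auto simp: p_def)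
    show "(\<lambda>n. t (\<zero>, n)) \<in> rmod_hom R N (rmod_ker (rmod_dsum C D) (idem_mod R e) p)"
      using t'(2)[of "(\<zero>, _)" "(\<zero>, _)"] t'(3)[of "(\<zero>, _)"] z tn
      by (intro rmod_homI) (auto simp: rmod_ker_def)
    show "bij_betw (\<lambda>n. t (\<zero>, n)) (carrier N)
      (carrier (rmod_ker (rmod_dsum C D) (idem_mod R e) p))"
    proof (rule bij_betw_byWitness[where f' = "snd \<circ> u"])
      show "\<forall>n\<in>carrier N. (snd \<circ> u) (t (\<zero>, n)) = n" using ut z by simp
      show "\<forall>m\<in>carrier (rmod_ker (rmod_dsum C D) (idem_mod R e) p). t (\<zero>, (snd \<circ> u) m) = m"
      proof
        fix m assume "m \<in> carrier (rmod_ker (rmod_dsum C D) (idem_mod R e) p)"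
        then have "m \<in> carrier (rmod_dsum C D)" "fst (u m) = \<zero>"
          by (auto simp: rmod_ker_def p_def)
        then show "t (\<zero>, (snd \<circ> u) m) = m" using tu[of m] by (metis comp_apply prod.collapse)
      qed
      show "(\<lambda>n. t (\<zero>, n)) ` carrier N \<subseteq> carrier (rmod_ker (rmod_dsum C D) (idem_mod R e) p)"
        using tn by (auto simp: rmod_ker_def simp del: mem_Times_iff) (metis mem_Sigma_iff)+
      show "(snd \<circ> u) ` carrier (rmod_ker (rmod_dsum C D) (idem_mod R e) p) \<subseteq> carrier N"
        using u'(1) by (fastforce simp: rmod_ker_def)
    qed
  qed
  define C' where "C' = rmod_ker C (idem_mod R f) (\<lambda>x. f \<otimes> pC x)"
  define D' where "D' = rmod_ker D (idem_mod R h) (\<lambda>x. h \<otimes> pD x)"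
  \<comment> \<open>As f and h are orthogonal, q vanishes only if both of its components do. Its
    kernel is therefore a direct sum.\<close>
  have "f \<otimes> x = \<zero> \<and> h \<otimes> y = \<zero>"
    if "f \<otimes> x \<oplus> h \<otimes> y = \<zero>" "x \<in> carrier R" "y \<in> carrier R" for x y
  proof -
    have "f \<otimes> (f \<otimes> x \<oplus> h \<otimes> y) = f \<otimes> x" "h \<otimes> (f \<otimes> x \<oplus> h \<otimes> y) = h \<otimes> y"
      using that(2,3) fc by (simp_all add: ring_expand assoc_eq[OF fc(3)] assoc_eq[OF fc(4)]
        assoc_eq[OF fc(5)] assoc_eq[OF fc(6)])
    then show ?thesis using that fc by simp
  qed
  then have 3: "rmod_ker (rmod_dsum C D) (idem_mod R e) q = rmod_dsum C' D'"
    using pC pD by (auto simp: rmod_ker_def rmod_dsum_def C'_def D'_def q_def)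
  have f1: "(\<lambda>x. f \<otimes> pC x) \<in> rmod_hom R C (idem_mod R f)"
    by (rule rmod_homI) (use fh fc in \<open>auto simp: mem_pideal ring_expand pCa pCp pC m_assoc
      assoc_eq[OF fc(3)]\<close>)
  have h1: "(\<lambda>x. h \<otimes> pD x) \<in> rmod_hom R D (idem_mod R h)"
    by (rule rmod_homI) (use fh fc in \<open>auto simp: mem_pideal ring_expand pDa pDp pD m_assoc
      assoc_eq[OF fc(4)]\<close>)
  have sC: "(\<lambda>r. ract C gC (a \<otimes> r)) \<in> rmod_hom R (idem_mod R f) C"
    by (rule rmod_homI) (use fh ab gc in \<open>auto simp: mem_pideal ring_expand C.ract_closed
      C.ract_add_right m_assoc simp flip: C.ract_assoc\<close>)
  have sD: "(\<lambda>r. ract D gD (b \<otimes> r)) \<in> rmod_hom R (idem_mod R h) D"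
    by (rule rmod_homI) (use fh ab gc in \<open>auto simp: mem_pideal ring_expand D.ract_closed
      D.ract_add_right m_assoc simp flip: D.ract_assoc\<close>)
  have 4: "rmod_isomorphic R (rmod_dsum (idem_mod R f) C') C"
    unfolding C'_def by (rule split_iso[OF F C sC f1])
      (use fh fc ab gc in \<open>auto simp: mem_pideal pCa xa\<close>)
  have 5: "rmod_isomorphic R (rmod_dsum (idem_mod R h) D') D"
    unfolding D'_def by (rule split_iso[OF H D sD h1])
      (use fh fc ab gc in \<open>auto simp: mem_pideal pDa xa\<close>)
  have rm: "right_module R C'" "right_module R D'"
    unfolding C'_def D'_def using right_module_ker[OF f1 C F] right_module_ker[OF h1 D H] by auto
  show thesis
  proof (rule that[OF fh rm])
    show "rmod_isomorphic R C (rmod_dsum (idem_mod R f) C')"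
      using rmod_iso_sym[OF 4 right_module_dsum[OF F rm(1)]] .
    show "rmod_isomorphic R D (rmod_dsum (idem_mod R h) D')"
      using rmod_iso_sym[OF 5 right_module_dsum[OF H rm(2)]] .
    show "rmod_isomorphic R N (rmod_dsum C' D')"
      using rmod_iso_trans[OF 2 1] 3 by simp
  qed
qed

end

section \<open>Free modules\<close>

lemma rmod_free_simps [simp]:
  "carrier (rmod_free R n) = {..<n} \<rightarrow>\<^sub>E carrier R"
  "\<zero>\<^bsub>rmod_free R n\<^esub> = (\<lambda>i\<in>{..<n}. \<zero>\<^bsub>R\<^esub>)"
  "f \<oplus>\<^bsub>rmod_free R n\<^esub> g = (\<lambda>i\<in>{..<n}. f i \<oplus>\<^bsub>R\<^esub> g i)"
  "ract (rmod_free R n) f r = (\<lambda>i\<in>{..<n}. f i \<otimes>\<^bsub>R\<^esub> r)"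
  by (simp_all add: rmod_free_def)

context ring
begin

lemma rmod_free_eqI:
  assumes "f \<in> carrier (rmod_free R n)" "g \<in> carrier (rmod_free R n)" "\<And>i. i < n \<Longrightarrow> f i = g i"
  shows "f = g"
  using assms by (intro PiE_ext[of f "{..<n}" "\<lambda>_. carrier R" g]) auto

lemma right_module_free: "right_module R (rmod_free R n)"
proof -
  let ?F = "rmod_free R n"
  have c: "f i \<in> carrier R" if "f \<in> carrier ?F" "i < n" for f i using that by auto
  have I: "(\<lambda>i\<in>{..<n}. f i) \<in> carrier ?F" if "\<And>i. i < n \<Longrightarrow> f i \<in> carrier R" for f
    using that by simp
  have z: "\<zero>\<^bsub>?F\<^esub> \<in> carrier ?F" using I[of "\<lambda>_. \<zero>"] by simp
  have a: "f \<oplus>\<^bsub>?F\<^esub> g \<in> carrier ?F" if "f \<in> carrier ?F" "g \<in> carrier ?F" for f g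
    using I[of "\<lambda>i. f i \<oplus> g i"] c[OF that(1)] c[OF that(2)] by simp
  have m: "ract ?F f r \<in> carrier ?F" if "f \<in> carrier ?F" "r \<in> carrier R" for f r
    using I[of "\<lambda>i. f i \<otimes> r"] c[OF that(1)] that(2) by simp
  have ai: "(f \<oplus>\<^bsub>?F\<^esub> g) i = f i \<oplus> g i" if "i < n" for f g i using that by simp
  have mi: "ract ?F f r i = f i \<otimes> r" if "i < n" for f r i using that by simp
  have zi: "\<zero>\<^bsub>?F\<^esub> i = \<zero>" if "i < n" for i using that by simp
  note simps = ai mi zi c a m z
  note del = rmod_free_simps
  show ?thesis
  proof (intro right_module.intro right_module_axioms.intro abelian_groupI)
    show "ring R" ..
  next
    fix f assume f: "f \<in> carrier ?F"
    have g: "(\<lambda>i\<in>{..<n}. \<ominus> f i) \<in> carrier ?F" using I[of "\<lambda>i. \<ominus> f i"] c[OF f] by simp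
    moreover have "(\<lambda>i\<in>{..<n}. \<ominus> f i) \<oplus>\<^bsub>?F\<^esub> f = \<zero>\<^bsub>?F\<^esub>"
      using f g by (intro rmod_free_eqI[of _ n]) (simp_all add: simps l_neg del: del)
    ultimately show "\<exists>g\<in>carrier ?F. g \<oplus>\<^bsub>?F\<^esub> f = \<zero>\<^bsub>?F\<^esub>" by blast
  qed (intro rmod_free_eqI[of _ n] | simp add: simps a_ac ring_expand m_assoc del: del)+
qed

lemma pideal_one: "pideal R \<one> = carrier R"
  by (auto simp: mem_pideal)

lemma free_Suc:
  "rmod_isomorphic R (rmod_dsum (idem_mod R \<one>) (rmod_free R n)) (rmod_free R (Suc n))"
proof -
  let ?F = "rmod_free R n" and ?G = "rmod_free R (Suc n)"
  \<comment> \<open>The added coordinate gets index n, so that the old coordinates keep their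
    indices.\<close>
  define \<phi> where "\<phi> = (\<lambda>(r, f). \<lambda>i\<in>{..<Suc n}. if i = n then r else f i :: 'a)"
  define \<psi> where "\<psi> f = (f n, \<lambda>i\<in>{..<n}. f i :: 'a)" for f
  have \<phi>i: "\<phi> (r, f) i = (if i = n then r else f i)" if "i < Suc n" for r f i
    using that by (simp add: \<phi>_def)
  have c: "f i \<in> carrier R" if "f \<in> carrier (rmod_free R m)" "i < m" for f i m using that by auto
  have \<phi>: "\<phi> (r, f) \<in> carrier ?G" if "r \<in> carrier R" "f \<in> carrier ?F" for r f
    using that(1) c[OF that(2)] by (simp add: \<phi>_def)
  have \<psi>: "snd (\<psi> f) \<in> carrier ?F" "fst (\<psi> f) \<in> carrier R" if "f \<in> carrier ?G" for f
    using c[OF that] by (simp_all add: \<psi>_def)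
  interpret F: right_module R ?F by (rule right_module_free)
  interpret G: right_module R ?G by (rule right_module_free)
  have add: "(f \<oplus>\<^bsub>rmod_free R m\<^esub> g) i = f i \<oplus> g i"
    and act: "ract (rmod_free R m) f r i = f i \<otimes> r" if "i < m" for f g i r m
    using that by simp_all
  show ?thesis
  proof (rule rmod_isoI)
    show "\<phi> \<in> rmod_hom R (rmod_dsum (idem_mod R \<one>) ?F) ?G"
    proof (rule rmod_homI)
      fix x y assume "x \<in> carrier (rmod_dsum (idem_mod R \<one>) ?F)"
        "y \<in> carrier (rmod_dsum (idem_mod R \<one>) ?F)"
      then obtain r f s g where "x = (r, f)" "y = (s, g)" "r \<in> carrier R" "s \<in> carrier R"
        "f \<in> carrier ?F" "g \<in> carrier ?F" by (auto simp: pideal_one simp del: rmod_free_simps)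
      then show "\<phi> (x \<oplus>\<^bsub>rmod_dsum (idem_mod R \<one>) ?F\<^esub> y) = \<phi> x \<oplus>\<^bsub>?G\<^esub> \<phi> y"
        by (intro rmod_free_eqI[of _ "Suc n"])
          (auto simp: \<phi> \<phi>i add simp del: rmod_free_simps)
    next
      fix x r assume "x \<in> carrier (rmod_dsum (idem_mod R \<one>) ?F)" "r \<in> carrier R"
      moreover from this(1) obtain s f where "x = (s, f)" "s \<in> carrier R" "f \<in> carrier ?F"
        by (auto simp: pideal_one simp del: rmod_free_simps)
      ultimately show "\<phi> (ract (rmod_dsum (idem_mod R \<one>) ?F) x r) = ract ?G (\<phi> x) r"
        by (intro rmod_free_eqI[of _ "Suc n"])
          (auto simp: \<phi> \<phi>i act F.ract_closed G.ract_closed simp del: rmod_free_simps)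
    qed (auto simp: \<phi> pideal_one simp del: rmod_free_simps)
    show "bij_betw \<phi> (carrier (rmod_dsum (idem_mod R \<one>) ?F)) (carrier ?G)"
    proof (rule bij_betw_byWitness[where f' = \<psi>])
      show "\<forall>x\<in>carrier (rmod_dsum (idem_mod R \<one>) ?F). \<psi> (\<phi> x) = x"
      proof (clarsimp simp: pideal_one simp del: rmod_free_simps)
        fix r f assume *: "r \<in> carrier R" "f \<in> carrier ?F"
        have "snd (\<psi> (\<phi> (r, f))) = f"
          using * \<psi>(1)[OF \<phi>[OF *]] by (intro rmod_free_eqI[of _ n]) (simp_all add: \<psi>_def \<phi>i del:
            rmod_free_simps)
        then show "\<psi> (\<phi> (r, f)) = (r, f)" by (simp add: \<psi>_def \<phi>i)
      qed
      show "\<forall>f\<in>carrier ?G. \<phi> (\<psi> f) = f"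
      proof
        fix f assume f: "f \<in> carrier ?G"
        have "\<phi> (fst (\<psi> f), snd (\<psi> f)) = f"
          using f \<phi>[OF \<psi>(2)[OF f] \<psi>(1)[OF f]] by (intro rmod_free_eqI[of _ "Suc n"])
            (auto simp: \<phi>i \<psi>_def simp del: rmod_free_simps)
        then show "\<phi> (\<psi> f) = f" by simp
      qed
      have "\<psi> f \<in> carrier R \<times> carrier ?F" if "f \<in> carrier ?G" for f
        using \<psi>(1)[OF that] \<psi>(2)[OF that] unfolding mem_Times_iff by blast
      then show "\<psi> ` carrier ?G \<subseteq> carrier (rmod_dsum (idem_mod R \<one>) ?F)"
        by (simp add: pideal_one image_subset_iff del: rmod_free_simps)
    qed (use \<phi> in \<open>auto simp: pideal_one simp del: rmod_free_simps\<close>)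
  qed
qed

lemma free_add:
  "rmod_isomorphic R (rmod_dsum (rmod_free R n) (rmod_free R m)) (rmod_free R (n + m))"
proof (induction n)
  case 0
  have "rmod_isomorphic R (rmod_free R m) (rmod_dsum (rmod_free R m) (rmod_free R 0))"
    by (rule dsum_trivial) (auto simp: right_module_free)
  then have "rmod_isomorphic R (rmod_dsum (rmod_free R m) (rmod_free R 0)) (rmod_free R m)"
    using rmod_iso_sym right_module_free by blast
  then show ?case using dsum_comm rmod_iso_trans by (metis add_0)
next
  case (Suc n)
  let ?E = "idem_mod R \<one>" and ?F = "rmod_free R"
  have "rmod_isomorphic R (?F (Suc n)) (rmod_dsum ?E (?F n))"
    by (intro rmod_iso_sym[OF free_Suc] right_module_dsum right_module_idem right_module_free) simp
  then have "rmod_isomorphic R (rmod_dsum (?F (Suc n)) (?F m)) (rmod_dsum (rmod_dsum ?E (?F n))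
    (?F m))"
    by (rule dsum_cong[OF _ rmod_iso_refl])
  also have "rmod_isomorphic R \<dots> (rmod_dsum ?E (rmod_dsum (?F n) (?F m)))"
    by (rule dsum_assoc)
  also have "rmod_isomorphic R \<dots> (rmod_dsum ?E (?F (n + m)))"
    by (rule dsum_cong[OF rmod_iso_refl Suc])
  also have "rmod_isomorphic R \<dots> (?F (Suc (n + m)))" by (rule free_Suc)
  finally show ?case by simp
qed

section \<open>Finitely generated projective modules\<close>

lemma fg_projectiveI:
  assumes "right_module R M" "right_module R N"
    "rmod_isomorphic R (rmod_dsum M N) (rmod_free R n)"
  shows "fg_projective R M"
proof -
  interpret M: right_module R M by fact
  interpret N: right_module R N by fact
  obtain t where t: "t \<in> rmod_hom R (rmod_dsum M N) (rmod_free R n)"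
    "bij_betw t (carrier M \<times> carrier N) (carrier (rmod_free R n))"
    using assms(3) by (auto simp: rmod_isomorphic_def)
  let ?f = "\<lambda>x. t (\<zero>\<^bsub>M\<^esub>, x)"
  \<comment> \<open>The complement may have elements of any type; its image in the free module has
    the type which \<open>fg_projective\<close> asks for.\<close>
  let ?N = "(rmod_free R n)\<lparr>carrier := ?f ` carrier N\<rparr>"
  have "?f \<in> rmod_hom R N (rmod_free R n)"
    using rmod_homD[OF t(1)] rmod_homD(2)[OF t(1), of "(\<zero>\<^bsub>M\<^esub>, _)" "(\<zero>\<^bsub>M\<^esub>, _)"]
      rmod_homD(3)[OF t(1), of "(\<zero>\<^bsub>M\<^esub>, _)"]
    by (intro rmod_homI) (simp_all del: rmod_free_simps)
  moreover have "inj_on ?f (carrier N)"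
    using t(2) by (auto simp: bij_betw_def inj_on_def)
  ultimately have N: "right_module R ?N" "rmod_isomorphic R N ?N"
    using right_module_image[OF _ _ assms(2) right_module_free] by blast+
  have "rmod_isomorphic R (rmod_dsum M ?N) (rmod_dsum M N)"
    using N rmod_iso_sym[OF N(2)] assms(2) dsum_cong rmod_iso_refl by blast
  then show ?thesis unfolding fg_projective_def using N assms rmod_iso_trans by blast
qed

lemma fg_projectiveD: "fg_projective R M \<Longrightarrow> right_module R M"
  by (simp add: fg_projective_def)

lemma fg_projective_iso:
  assumes "fg_projective R M" "rmod_isomorphic R M M'" "right_module R M'"
  shows "fg_projective R M'"
proof -
  obtain n and N :: "('a, nat \<Rightarrow> 'a) rmodule" where N: "right_module R N"
    "rmod_isomorphic R (rmod_dsum M N) (rmod_free R n)"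
    using assms(1) by (auto simp: fg_projective_def)
  have "rmod_isomorphic R M' M" using rmod_iso_sym[OF assms(2)] fg_projectiveD assms by blast
  then have "rmod_isomorphic R (rmod_dsum M' N) (rmod_free R n)"
    using N dsum_cong rmod_iso_refl rmod_iso_trans by blast
  then show ?thesis using fg_projectiveI assms N by blast
qed

lemma fg_projective_summand:
  assumes "fg_projective R M" "rmod_isomorphic R M (rmod_dsum A B)"
    "right_module R A" "right_module R B"
  shows "fg_projective R A" "fg_projective R B"
proof -
  have AB: "fg_projective R (rmod_dsum A B)"
    using fg_projective_iso assms right_module_dsum by blast
  then obtain n and N :: "('a, nat \<Rightarrow> 'a) rmodule" where N: "right_module R N"
    "rmod_isomorphic R (rmod_dsum (rmod_dsum A B) N) (rmod_free R n)"
    by (auto simp: fg_projective_def)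
  have "rmod_isomorphic R (rmod_dsum A (rmod_dsum B N)) (rmod_free R n)"
    using N dsum_assoc' rmod_iso_trans by blast
  then show "fg_projective R A" using fg_projectiveI assms N right_module_dsum by blast
  have "rmod_isomorphic R (rmod_dsum B (rmod_dsum A N)) (rmod_dsum (rmod_dsum B A) N)"
    by (rule dsum_assoc')
  also have "rmod_isomorphic R \<dots> (rmod_dsum (rmod_dsum A B) N)"
    by (intro dsum_cong dsum_comm rmod_iso_refl)
  finally have "rmod_isomorphic R (rmod_dsum B (rmod_dsum A N)) (rmod_free R n)"
    using N rmod_iso_trans by blast
  then show "fg_projective R B" using fg_projectiveI assms N right_module_dsum by blast
qed

lemma dsum_interchange:
  "rmod_isomorphic R (rmod_dsum (rmod_dsum A B) (rmod_dsum C D))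
     (rmod_dsum (rmod_dsum A C) (rmod_dsum B D))"
  by (rule rmod_isoI[of "\<lambda>((a, b), (c, d)). ((a, c), (b, d))"])
    (auto simp: rmod_hom_def bij_betw_def inj_on_def image_iff)

lemma fg_projective_dsum:
  assumes "fg_projective R A" "fg_projective R B"
  shows "fg_projective R (rmod_dsum A B)"
proof -
  obtain n and N :: "('a, nat \<Rightarrow> 'a) rmodule" where N: "right_module R N"
    "rmod_isomorphic R (rmod_dsum A N) (rmod_free R n)"
    using assms(1) by (auto simp: fg_projective_def)
  obtain m and M :: "('a, nat \<Rightarrow> 'a) rmodule" where M: "right_module R M"
    "rmod_isomorphic R (rmod_dsum B M) (rmod_free R m)"
    using assms(2) by (auto simp: fg_projective_def)
  have "rmod_isomorphic R (rmod_dsum (rmod_dsum A B) (rmod_dsum N M))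
    (rmod_dsum (rmod_free R n) (rmod_free R m))"
    using dsum_cong[OF N(2) M(2)] dsum_interchange rmod_iso_trans by blast
  then have "rmod_isomorphic R (rmod_dsum (rmod_dsum A B) (rmod_dsum N M)) (rmod_free R (n + m))"
    using free_add rmod_iso_trans by blast
  then show ?thesis
    by (rule fg_projectiveI[rotated 2]) (intro right_module_dsum M N fg_projectiveD[OF assms(1)]
      fg_projectiveD[OF assms(2)])+
qed

lemma fg_projective_free: "fg_projective R (rmod_free R n)"
proof (rule fg_projectiveI[OF right_module_free right_module_free[of 0]])
  show "rmod_isomorphic R (rmod_dsum (rmod_free R n) (rmod_free R 0)) (rmod_free R n)"
    using free_add[of n 0] by simp
qed

text \<open>The image of M in a free module is a copy of M with the element type used by
  \<open>iso_class\<close>. Hence the class of a finitely generated projective module is never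
  empty.\<close>

lemma fg_projective_rep:
  assumes "fg_projective R M"
  obtains M' :: "('a, nat \<Rightarrow> 'a) rmodule" where "fg_projective R M'" "rmod_isomorphic R M M'"
proof -
  obtain n and N :: "('a, nat \<Rightarrow> 'a) rmodule" where N: "right_module R N"
    "rmod_isomorphic R (rmod_dsum M N) (rmod_free R n)"
    using assms(1) by (auto simp: fg_projective_def)
  interpret M: right_module R M using assms fg_projectiveD by blast
  interpret N: right_module R N by fact
  obtain t where t: "t \<in> rmod_hom R (rmod_dsum M N) (rmod_free R n)"
    "bij_betw t (carrier M \<times> carrier N) (carrier (rmod_free R n))"
    using N(2) by (auto simp: rmod_isomorphic_def)
  let ?f = "\<lambda>x. t (x, \<zero>\<^bsub>N\<^esub>)"
  have "?f \<in> rmod_hom R M (rmod_free R n)"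
    using rmod_homD[OF t(1)] rmod_homD(2)[OF t(1), of "(_, \<zero>\<^bsub>N\<^esub>)" "(_, \<zero>\<^bsub>N\<^esub>)"]
      rmod_homD(3)[OF t(1), of "(_, \<zero>\<^bsub>N\<^esub>)"]
    by (intro rmod_homI) (simp_all del: rmod_free_simps)
  moreover have "inj_on ?f (carrier M)"
    using t(2) N.M.zero_closed unfolding bij_betw_def inj_on_def by blast
  ultimately show thesis
    using right_module_image[OF _ _ M.right_module_axioms right_module_free] that
      fg_projective_iso[OF assms] by blast
qed

lemma idem_compl_iso:
  assumes "ring_idem R e"
  shows "rmod_isomorphic R (rmod_dsum (idem_mod R e) (idem_mod R (\<one> \<ominus> e))) (idem_mod R \<one>)"
proof -
  note c = ring_idem_closed[OF assms]
  note m = idem_minus[OF idem_one assms idem_le_one[OF c]]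
  show ?thesis
    using dsum_ideals_iso[OF _ _ pideal_sum_orth[OF assms m(1,2)]] m c by (simp add: pideal_in)
qed

lemma fg_projective_idem:
  assumes "ring_idem R e"
  shows "fg_projective R (idem_mod R e)"
proof -
  note c = ring_idem_closed[OF assms]
  have "rmod_isomorphic R (rmod_dsum (idem_mod R \<one>) (rmod_free R 0)) (rmod_free R (Suc 0))"
    by (rule free_Suc)
  then have "rmod_isomorphic R (rmod_free R (Suc 0)) (rmod_dsum (idem_mod R \<one>) (rmod_free R 0))"
    by (rule rmod_iso_sym) (intro right_module_dsum right_module_idem right_module_free one_closed)
  then have "fg_projective R (idem_mod R \<one>)"
    using fg_projective_summand[OF fg_projective_free _ right_module_idem right_module_free] by
      blast
  moreover have "rmod_isomorphic R (idem_mod R \<one>) (rmod_dsum (idem_mod R e) (idem_mod R (\<one> \<ominus> e)))"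
    by (intro rmod_iso_sym[OF idem_compl_iso[OF assms]] right_module_dsum right_module_idem)
      (auto simp: c)
  ultimately show ?thesis
    by (rule fg_projective_summand(1)) (intro right_module_idem c minus_closed one_closed)+
qed

section \<open>Isomorphism classes and addition in V(R)\<close>

lemma iso_class_eq:
  assumes "rmod_isomorphic R M N" "right_module R M"
  shows "iso_class R M = iso_class R N"
  unfolding iso_class_def
  using rmod_iso_trans[OF rmod_iso_sym[OF assms]] rmod_iso_trans[OF assms(1)] by auto

text \<open>Equal classes force an isomorphism only through a shared member, which exists because
  classes of finitely generated projective modules are nonempty.\<close>

lemma iso_class_eq_iff:
  assumes "fg_projective R M" "fg_projective R N"
  shows "iso_class R M = iso_class R N \<longleftrightarrow> rmod_isomorphic R M N"
proof
  assume eq: "iso_class R M = iso_class R N"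
  obtain M' where "M' \<in> iso_class R M"
    using fg_projective_rep[OF assms(1)] by (auto simp: iso_class_def)
  then have "rmod_isomorphic R M M'" "rmod_isomorphic R N M'"
    using eq unfolding iso_class_def by blast+
  then show "rmod_isomorphic R M N"
    using assms rmod_iso_sym rmod_iso_trans fg_projectiveD by blast
qed (use assms iso_class_eq fg_projectiveD in blast)

abbreviation V_classes (\<open>\<V>\<close>) where "\<V> \<equiv> carrier (V_monoid R)"

abbreviation V_add (infixl \<open>\<oplus>\<^sub>V\<close> 70) where "v \<oplus>\<^sub>V w \<equiv> v \<otimes>\<^bsub>V_monoid R\<^esub> w"

lemma iso_class_in:
  assumes "fg_projective R M" shows "iso_class R M \<in> \<V>"
proof -
  obtain M' :: "('a, nat \<Rightarrow> 'a) rmodule" where "fg_projective R M'" "rmod_isomorphic R M M'"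
    using fg_projective_rep[OF assms] .
  then show ?thesis
    using assms iso_class_eq fg_projectiveD unfolding V_monoid_def by fastforce
qed

lemma V_monoidE:
  assumes "v \<in> \<V>"
  obtains M :: "('a, nat \<Rightarrow> 'a) rmodule" where "fg_projective R M" "v = iso_class R M"
  using assms by (auto simp: V_monoid_def)

text \<open>All sums of representatives have the same class, so the union defining the product
  collapses to a single class; nonemptiness of both factors guarantees that the union is not
  empty.\<close>

lemma V_mult:
  assumes "fg_projective R M" "fg_projective R N"
  shows "iso_class R M \<oplus>\<^sub>V iso_class R N = iso_class R (rmod_dsum M N)"
proof -
  have "iso_class R (rmod_dsum A B) = iso_class R (rmod_dsum M N)"
    if "A \<in> iso_class R M" "B \<in> iso_class R N" for A B
  proof -
    have "rmod_isomorphic R (rmod_dsum M N) (rmod_dsum A B)"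
      using that unfolding iso_class_def by (intro dsum_cong) auto
    then show ?thesis
      by (rule iso_class_eq[symmetric]) (intro right_module_dsum fg_projectiveD assms)
  qed
  moreover obtain A where "A \<in> iso_class R M"
    using fg_projective_rep[OF assms(1)] by (auto simp: iso_class_def)
  moreover obtain B where "B \<in> iso_class R N"
    using fg_projective_rep[OF assms(2)] by (auto simp: iso_class_def)
  ultimately show ?thesis unfolding V_monoid_def by auto
qed

lemma V_one: "\<one>\<^bsub>V_monoid R\<^esub> = iso_class R (rmod_free R 0)"
  by (simp add: V_monoid_def)

lemma V_comm_monoid: "comm_monoid (V_monoid R)"
proof (rule comm_monoidI)
  fix x y assume "x \<in> \<V>" "y \<in> \<V>"
  then obtain M N :: "('a, nat \<Rightarrow> 'a) rmodule" where MN: "fg_projective R M" "x = iso_class R M"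
    "fg_projective R N" "y = iso_class R N" by (metis V_monoidE)
  show "x \<oplus>\<^sub>V y \<in> \<V>"
    using MN by (simp add: V_mult iso_class_in fg_projective_dsum)
  show "x \<oplus>\<^sub>V y = y \<oplus>\<^sub>V x"
    using MN by (simp add: V_mult iso_class_eq_iff fg_projective_dsum dsum_comm)
next
  show "\<one>\<^bsub>V_monoid R\<^esub> \<in> \<V>" by (simp add: V_one iso_class_in fg_projective_free)
next
  fix x assume "x \<in> \<V>"
  then obtain M :: "('a, nat \<Rightarrow> 'a) rmodule" where M: "fg_projective R M" "x = iso_class R M"
    by (metis V_monoidE)
  have "rmod_isomorphic R M (rmod_dsum M (rmod_free R 0))"
    using M fg_projectiveD by (intro dsum_trivial) (auto simp: right_module_free)
  then have "rmod_isomorphic R M (rmod_dsum (rmod_free R 0) M)"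
    using dsum_comm rmod_iso_trans by blast
  then show "\<one>\<^bsub>V_monoid R\<^esub> \<oplus>\<^sub>V x = x"
    using M by (metis V_one V_mult fg_projective_free iso_class_eq fg_projectiveD)
next
  fix x y z assume "x \<in> \<V>" "y \<in> \<V>" "z \<in> \<V>"
  then obtain M N L :: "('a, nat \<Rightarrow> 'a) rmodule" where M: "fg_projective R M" "x = iso_class R M"
    "fg_projective R N" "y = iso_class R N" "fg_projective R L" "z = iso_class R L"
    by (metis V_monoidE)
  then show "x \<oplus>\<^sub>V y \<oplus>\<^sub>V z = x \<oplus>\<^sub>V (y \<oplus>\<^sub>V z)"
    by (simp add: V_mult iso_class_eq_iff fg_projective_dsum dsum_assoc)
qed

end

section \<open>Refinement monoids\<close>

locale refinement_monoid = comm_monoid G for G (structure) +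
  assumes refinement: "\<lbrakk>a \<in> carrier G; b \<in> carrier G; c \<in> carrier G; d \<in> carrier G; a \<otimes> b = c \<otimes> d\<rbrakk> \<Longrightarrow>
    \<exists>p\<in>carrier G. \<exists>q\<in>carrier G. \<exists>r\<in>carrier G. \<exists>s\<in>carrier G.
      a = p \<otimes> q \<and> b = r \<otimes> s \<and> c = p \<otimes> r \<and> d = q \<otimes> s"
begin

lemma refineE:
  assumes "a \<in> carrier G" "b \<in> carrier G" "c \<in> carrier G" "d \<in> carrier G" "a \<otimes> b = c \<otimes> d"
  obtains p q r s where "p \<in> carrier G" "q \<in> carrier G" "r \<in> carrier G" "s \<in> carrier G"
    "a = p \<otimes> q" "b = r \<otimes> s" "c = p \<otimes> r" "d = q \<otimes> s"
  using refinement[OF assms] by blast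

text \<open>The conclusion of (a) for one triple, isolated so that it can be shown in a small
  situation and then propagated.\<close>

definition separates :: "'a \<Rightarrow> 'a \<Rightarrow> 'a \<Rightarrow> bool" where
  "separates a b c \<longleftrightarrow> (\<exists>d\<in>carrier G. d = d \<otimes> d \<and> (\<exists>z\<in>carrier G. d \<otimes> z = c) \<and> a \<otimes> d = b \<otimes> d)"

text \<open>Only c is fixed, while a and b range over the whole monoid. This uniformity is what
  makes the property stable under sums in c.\<close>

definition separative_at :: "'a \<Rightarrow> bool" where
  "separative_at c \<longleftrightarrow> (\<forall>a\<in>carrier G. \<forall>b\<in>carrier G. a \<otimes> c = b \<otimes> c \<longrightarrow> separates a b c)"

lemma separative_at_one: "separative_at \<one>"
  unfolding separative_at_def separates_def by (intro ballI impI bexI[of _ \<one>] conjI) simp_all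

text \<open>Cancel y against an idempotent d, with x kept on both sides; then cancel x against an
  idempotent e, with d kept on both sides. The sum d + e is idempotent and lies below x + y.\<close>

lemma separative_at_mult:
  assumes "separative_at x" "separative_at y" "x \<in> carrier G" "y \<in> carrier G"
  shows "separative_at (x \<otimes> y)"
  unfolding separative_at_def
proof (intro ballI impI)
  fix a b assume ab: "a \<in> carrier G" "b \<in> carrier G" and eq: "a \<otimes> (x \<otimes> y) = b \<otimes> (x \<otimes> y)"
  have "separates (a \<otimes> x) (b \<otimes> x) y"
    using assms(2) ab eq assms(3,4) by (simp add: separative_at_def m_assoc)
  then obtain d z where d: "d \<in> carrier G" "d = d \<otimes> d" "z \<in> carrier G" "d \<otimes> z = y"
    "a \<otimes> x \<otimes> d = b \<otimes> x \<otimes> d" unfolding separates_def by blast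
  then have "(a \<otimes> d) \<otimes> x = (b \<otimes> d) \<otimes> x" using ab assms(3) by (metis m_assoc m_comm)
  then have "separates (a \<otimes> d) (b \<otimes> d) x"
    using assms(1) ab d(1) by (simp add: separative_at_def)
  then obtain e w where e: "e \<in> carrier G" "e = e \<otimes> e" "w \<in> carrier G" "e \<otimes> w = x"
    "a \<otimes> d \<otimes> e = b \<otimes> d \<otimes> e" unfolding separates_def by blast
  have "(d \<otimes> e) \<otimes> (d \<otimes> e) = (d \<otimes> d) \<otimes> (e \<otimes> e)"
    using d(1) e(1) by (simp add: m_ac)
  then have "d \<otimes> e = (d \<otimes> e) \<otimes> (d \<otimes> e)" using d(2) e(2) by simp
  moreover have "(d \<otimes> e) \<otimes> (z \<otimes> w) = (e \<otimes> w) \<otimes> (d \<otimes> z)" using d(1,3) e(1,3) by (simp add: m_ac)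
  moreover have "a \<otimes> (d \<otimes> e) = b \<otimes> (d \<otimes> e)" using d(1) e(1,5) ab by (simp add: m_assoc)
  ultimately show "separates a b (x \<otimes> y)"
    unfolding separates_def using d(1,3,4) e(1,3,4) by (metis m_closed)
qed

lemma separates_weaken:
  assumes "separates y z t" "y \<in> carrier G" "z \<in> carrier G" "t \<in> carrier G"
    "x \<in> carrier G" "s \<in> carrier G"
  shows "separates (x \<otimes> y) (x \<otimes> z) (s \<otimes> t)"
proof -
  obtain d w where d: "d \<in> carrier G" "d = d \<otimes> d" "w \<in> carrier G" "d \<otimes> w = t"
    "y \<otimes> d = z \<otimes> d" using assms(1) unfolding separates_def by blast
  have "x \<otimes> y \<otimes> d = x \<otimes> z \<otimes> d" using d(1,5) assms by (simp add: m_assoc)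
  moreover have "d \<otimes> (s \<otimes> w) = s \<otimes> t"
    using m_lcomm[OF d(1) assms(6) d(3)] d(4) by simp
  ultimately show ?thesis unfolding separates_def using d(1-3) assms(6) by blast
qed

text \<open>Refining a + c = b + c gives a = x + y, b = x + z and c = z + t = y + t. After the
  common x is dropped, y and z lie below c, so arbitrary a and b never have to be
  considered.\<close>

lemma separative_atI:
  assumes c: "c \<in> carrier G" and *: "\<And>y z t. \<lbrakk>y \<in> carrier G; z \<in> carrier G; t \<in> carrier G; y \<otimes> t =
    c; z \<otimes> t = c\<rbrakk>
    \<Longrightarrow> separates y z t"
  shows "separative_at c"
  unfolding separative_at_def
proof (intro ballI impI)
  fix a b assume ab: "a \<in> carrier G" "b \<in> carrier G" and eq: "a \<otimes> c = b \<otimes> c"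
  obtain x y z t where r: "x \<in> carrier G" "y \<in> carrier G" "z \<in> carrier G" "t \<in> carrier G"
    "a = x \<otimes> y" "c = z \<otimes> t" "b = x \<otimes> z" "c = y \<otimes> t" using refineE[OF ab(1) c ab(2) c eq] .
  have "separates y z t" using * r by auto
  then have "separates (x \<otimes> y) (x \<otimes> z) (z \<otimes> t)" using separates_weaken r by blast
  then show "separates a b c" using r by simp
qed

end

section \<open>Classes of idempotents in V(R)\<close>

abbreviation icls :: "('a, 'b) ring_scheme \<Rightarrow> 'a \<Rightarrow> ('a, nat \<Rightarrow> 'a) rmodule set" where
  "icls R e \<equiv> iso_class R (idem_mod R e)"

context ring
begin

lemma icls_in: "ring_idem R e \<Longrightarrow> icls R e \<in> \<V>"
  by (simp add: iso_class_in fg_projective_idem)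

lemma icls_eq_iff:
  "ring_idem R e \<Longrightarrow> ring_idem R f \<Longrightarrow> icls R e = icls R f \<longleftrightarrow> idem_equiv R e f"
  by (subst iso_class_eq_iff) (simp_all only: fg_projective_idem idem_mod_iso_iff)

lemma icls_add:
  assumes "ring_idem R e" "ring_idem R f" "ring_orth R e f"
  shows "icls R (e \<oplus> f) = icls R e \<oplus>\<^sub>V icls R f"
proof -
  note c = ring_idem_closed[OF assms(1)] ring_idem_closed[OF assms(2)]
  have "rmod_isomorphic R (rmod_dsum (idem_mod R e) (idem_mod R f)) (idem_mod R (e \<oplus> f))"
    using dsum_ideals_iso[OF _ _ pideal_sum_orth[OF assms]] c by (simp add: pideal_in)
  then have "iso_class R (rmod_dsum (idem_mod R e) (idem_mod R f)) = icls R (e \<oplus> f)"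
    by (rule iso_class_eq) (intro right_module_dsum right_module_idem c)
  then show ?thesis using assms by (simp add: V_mult fg_projective_idem)
qed

lemma icls_minus:
  assumes "ring_idem R e" "ring_idem R f" "idem_le R f e"
  shows "icls R e = icls R f \<oplus>\<^sub>V icls R (e \<ominus> f)"
  using icls_add[of f "e \<ominus> f"] idem_minus[OF assms] assms(2) by simp

text \<open>Every decomposition of [e] in the monoid is realised by orthogonal idempotents inside e.
  This is the bridge from equations in V(R) back to elements of R.\<close>

lemma icls_split:
  assumes e: "ring_idem R e" "c \<in> \<V>" "d \<in> \<V>"
    "icls R e = c \<oplus>\<^sub>V d"
  obtains e1 e2 where "ring_idem R e1" "ring_idem R e2" "ring_orth R e1 e2" "e = e1 \<oplus> e2"
    "icls R e1 = c" "icls R e2 = d"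
proof -
  obtain C D :: "('a, nat \<Rightarrow> 'a) rmodule" where CD: "fg_projective R C" "c = iso_class R C"
    "fg_projective R D" "d = iso_class R D" using assms by (metis V_monoidE)
  note rm = CD(1,3)[THEN fg_projectiveD]
  have "rmod_isomorphic R (rmod_dsum C D) (idem_mod R e)"
    using CD e iso_class_eq_iff[OF fg_projective_dsum[OF CD(1,3)] fg_projective_idem[OF e(1)]]
    by (simp add: V_mult)
  from idem_split_iso[OF e(1) rm this] obtain e1 e2 where
    "ring_idem R e1" "ring_idem R e2" "ring_orth R e1 e2" "e1 \<oplus> e2 = e"
    "rmod_isomorphic R C (idem_mod R e1)" "rmod_isomorphic R D (idem_mod R e2)" .
  then show thesis using that iso_class_eq rm CD by metis
qed

lemma icls_zero: "icls R \<zero> = \<one>\<^bsub>V_monoid R\<^esub>"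
proof -
  have "rmod_isomorphic R (idem_mod R \<zero>) (rmod_dsum (idem_mod R \<zero>) (rmod_free R 0))"
    by (rule dsum_trivial) (auto intro: right_module_free right_module_idem)
  also have "rmod_isomorphic R \<dots> (rmod_dsum (rmod_free R 0) (idem_mod R \<zero>))" by (rule dsum_comm)
  also have "rmod_isomorphic R \<dots> (rmod_free R 0)"
    using right_module_idem[OF zero_closed]
    by (intro rmod_iso_sym[OF dsum_trivial]) (auto simp: right_module_free pideal_zero_eq)
  finally show ?thesis using iso_class_eq right_module_idem by (metis V_one zero_closed)
qed

text \<open>A decomposition of the zero class is realised by orthogonal idempotents with sum 0, and
  then e1 = e1 (e1 + e2) = 0.\<close>

lemma V_conical:
  assumes "x \<in> \<V>" "y \<in> \<V>"
    "x \<oplus>\<^sub>V y = \<one>\<^bsub>V_monoid R\<^esub>"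
  shows "x = \<one>\<^bsub>V_monoid R\<^esub>"
proof -
  obtain e1 e2 where e: "ring_idem R e1" "ring_idem R e2" "ring_orth R e1 e2" "\<zero> = e1 \<oplus> e2"
    "icls R e1 = x" using icls_split[OF idem_zero assms(1,2)] assms(3) icls_zero by metis
  then have "e1 \<otimes> (e1 \<oplus> e2) = e1" by (simp add: ring_idem_def ring_orth_def r_distr)
  then have "e1 = \<zero>" using e ring_idem_closed by (metis r_null)
  then show ?thesis using e icls_zero by metis
qed

lemma icls_one_iff:
  assumes "ring_idem R e" "icls R e = \<one>\<^bsub>V_monoid R\<^esub>" shows "e = \<zero>"
proof -
  have "idem_equiv R e \<zero>" using icls_eq_iff[OF assms(1) idem_zero] assms icls_zero by simp
  then obtain x y where "x \<in> carrier R" "x \<otimes> \<zero> = x" "y \<in> carrier R" "x \<otimes> y = e"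
    using idem_equiv_normalize[OF _ assms(1) idem_zero] by metis
  then show ?thesis by (metis l_null r_null)
qed

end

section \<open>Refinement in V(R)\<close>

context regular
begin

text \<open>The exchange property read in V(R): an instance of refinement in which one entry is a
  generator [e], with the additional information that e itself splits into idempotents.\<close>

lemma V_exchange:
  assumes e: "ring_idem R e" and "n \<in> \<V>" "c \<in> \<V>"
    "d \<in> \<V>" "icls R e \<oplus>\<^sub>V n = c \<oplus>\<^sub>V d"
  obtains f h c' d' where "ring_idem R f" "ring_idem R h" "ring_orth R f h" "f \<oplus> h = e"
    "c' \<in> \<V>" "d' \<in> \<V>"
    "c = icls R f \<oplus>\<^sub>V c'" "d = icls R h \<oplus>\<^sub>V d'" "n = c' \<oplus>\<^sub>V d'"
proof -
  obtain C D N :: "('a, nat \<Rightarrow> 'a) rmodule" where M: "fg_projective R C" "c = iso_class R C"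
    "fg_projective R D" "d = iso_class R D" "fg_projective R N" "n = iso_class R N"
    using assms by (metis V_monoidE)
  note rm = M(1,3,5)[THEN fg_projectiveD]
  have "rmod_isomorphic R (rmod_dsum (idem_mod R e) N) (rmod_dsum C D)"
    using M assms(5) fg_projective_idem[OF e] by (simp add: V_mult fg_projective_dsum
      iso_class_eq_iff)
  from exchange[OF e rm(3,1,2) this] obtain f h and C' D' :: "('a, nat \<Rightarrow> 'a) rmodule" where
    *: "ring_idem R f" "ring_idem R h" "ring_orth R f h" "f \<oplus> h = e"
    and rm': "right_module R C'" "right_module R D'" and
    iso: "rmod_isomorphic R C (rmod_dsum (idem_mod R f) C')"
    "rmod_isomorphic R D (rmod_dsum (idem_mod R h) D')" "rmod_isomorphic R N (rmod_dsum C' D')" .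
  note fh = *(1,2)[THEN ring_idem_closed, THEN right_module_idem]
  have p: "fg_projective R C'" "fg_projective R D'"
    using fg_projective_summand(2)[OF M(1) iso(1) fh(1) rm'(1)]
      fg_projective_summand(2)[OF M(3) iso(2) fh(2) rm'(2)] by auto
  show thesis
  proof (rule that[OF * iso_class_in[OF p(1)] iso_class_in[OF p(2)]])
    show "c = icls R f \<oplus>\<^sub>V iso_class R C'"
      using iso_class_eq[OF iso(1) rm(1)] M p * by (simp add: V_mult fg_projective_idem)
    show "d = icls R h \<oplus>\<^sub>V iso_class R D'"
      using iso_class_eq[OF iso(2) rm(2)] M p * by (simp add: V_mult fg_projective_idem)
    show "n = iso_class R C' \<oplus>\<^sub>V iso_class R D'"
      using iso_class_eq[OF iso(3) rm(3)] M p by (simp add: V_mult)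
  qed
qed

text \<open>It rests on the fact that every class is a finite sum of classes [e].\<close>

lemma V_induct [consumes 1, case_names one mult]:
  assumes "v \<in> \<V>" and "P \<one>\<^bsub>V_monoid R\<^esub>"
    and step: "\<And>e w. ring_idem R e \<Longrightarrow> w \<in> \<V> \<Longrightarrow> P w \<Longrightarrow> P (icls R e \<oplus>\<^sub>V w)"
  shows "P v"
proof -
  \<comment> \<open>The statement is generalised to all summands m of R^n. Exchange against one copy
    of [1] writes m as [f] + c', where c' is a summand of the free module with one generator
    less.\<close>
  have *: "P m" if "m \<in> \<V>" "k \<in> \<V>"
    "iso_class R (rmod_free R n) = m \<oplus>\<^sub>V k" for n m k
    using that
  proof (induction n arbitrary: m k)
    case 0
    then have "m = \<one>\<^bsub>V_monoid R\<^esub>" using V_conical V_one by metis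
    then show ?case using assms(2) by simp
  next
    case (Suc n)
    have "iso_class R (rmod_dsum (idem_mod R \<one>) (rmod_free R n)) = iso_class R (rmod_free R (Suc
      n))"
      by (intro iso_class_eq[OF free_Suc] right_module_dsum right_module_idem right_module_free
        one_closed)
    then have "icls R \<one> \<oplus>\<^sub>V iso_class R (rmod_free R n) = m \<oplus>\<^sub>V k"
      using Suc by (simp add: V_mult fg_projective_idem fg_projective_free)
    from V_exchange[OF idem_one iso_class_in[OF fg_projective_free] Suc.prems(1,2) this]
    obtain f c' d' where "ring_idem R f" "c' \<in> \<V>" "d' \<in> \<V>"
      "m = icls R f \<oplus>\<^sub>V c'" "iso_class R (rmod_free R n) = c' \<oplus>\<^sub>V d'" by metis
    then show ?case using Suc.IH step by metis
  qed
  obtain M :: "('a, nat \<Rightarrow> 'a) rmodule" where M: "fg_projective R M" "v = iso_class R M"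
    using assms(1) by (metis V_monoidE)
  obtain n and N :: "('a, nat \<Rightarrow> 'a) rmodule" where N: "right_module R N"
    "rmod_isomorphic R (rmod_dsum M N) (rmod_free R n)"
    using M by (auto simp: fg_projective_def)
  have i: "rmod_isomorphic R (rmod_free R n) (rmod_dsum M N)"
    using rmod_iso_sym[OF N(2)] right_module_dsum M N fg_projectiveD by blast
  then have "fg_projective R N"
    using fg_projective_summand(2)[OF fg_projective_free i] M N fg_projectiveD by blast
  then show ?thesis
    using *[OF assms(1) iso_class_in, of N n] M iso_class_eq[OF i right_module_free] V_mult by metis
qed

text \<open>Exchange deals with one generator [e] of a and leaves a decomposition of the remaining
  sum, to which the induction hypothesis applies; the pieces f and h of e go to the first row of the
  refinement matrix.\<close>

lemma V_refinement: "refinement_monoid (V_monoid R)"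
proof -
  interpret V: comm_monoid "V_monoid R" by (rule V_comm_monoid)
  show ?thesis
  proof (intro refinement_monoid.intro refinement_monoid_axioms.intro)
    show "comm_monoid (V_monoid R)" ..
  next
    fix a b c d assume "a \<in> \<V>" "b \<in> \<V>" "c \<in> \<V>"
      "d \<in> \<V>" "a \<oplus>\<^sub>V b = c \<oplus>\<^sub>V d"
    then show "\<exists>p\<in>\<V>. \<exists>q\<in>\<V>. \<exists>r\<in>\<V>.
      \<exists>s\<in>\<V>. a = p \<oplus>\<^sub>V q \<and> b = r \<oplus>\<^sub>V s \<and>
        c = p \<oplus>\<^sub>V r \<and> d = q \<oplus>\<^sub>V s"
    proof (induction a arbitrary: c d rule: V_induct)
      case one
      then have "b = c \<oplus>\<^sub>V d" by simp
      then show ?case using one by (intro bexI[of _ "\<one>\<^bsub>V_monoid R\<^esub>"] bexI[of _ c] bexI[of _ d]) auto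
    next
      case (mult e a)
      have "icls R e \<oplus>\<^sub>V (a \<oplus>\<^sub>V b) = c \<oplus>\<^sub>V d"
        using mult icls_in by (simp add: V.m_assoc)
      from V_exchange[OF mult(1) V.m_closed[OF mult(2) mult.prems(1)] mult.prems(2,3) this]
      obtain f h c' d' where
        fh: "ring_idem R f" "ring_idem R h" "ring_orth R f h" "f \<oplus> h = e"
        and cd: "c' \<in> \<V>" "d' \<in> \<V>"
        "c = icls R f \<oplus>\<^sub>V c'" "d = icls R h \<oplus>\<^sub>V d'"
        "a \<oplus>\<^sub>V b = c' \<oplus>\<^sub>V d'" .
      obtain p q r s where pq: "p\<in>\<V>" "q\<in>\<V>"
        "r\<in>\<V>" "s\<in>\<V>" "a = p \<oplus>\<^sub>V q"
        "b = r \<oplus>\<^sub>V s" "c' = p \<oplus>\<^sub>V r" "d' = q \<oplus>\<^sub>V s"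
        using mult.IH[OF mult.prems(1) cd(1,2,5)] by blast
      note fh_in = fh(1,2)[THEN icls_in]
      have "icls R e \<oplus>\<^sub>V a =
        (icls R f \<oplus>\<^sub>V p) \<oplus>\<^sub>V (icls R h \<oplus>\<^sub>V q)"
        using icls_add[OF fh(1-3)] fh(4) fh_in pq(1-4) by (simp add: pq V.m_ac)
      moreover have "c = (icls R f \<oplus>\<^sub>V p) \<oplus>\<^sub>V r"
        "d = (icls R h \<oplus>\<^sub>V q) \<oplus>\<^sub>V s"
        using cd pq fh_in by (simp_all add: V.m_assoc)
      ultimately show ?case using pq(3,4,6) V.m_closed[OF fh_in(1) pq(1)] V.m_closed[OF fh_in(2)
        pq(2)]
        by blast
    qed
  qed
qed

end

sublocale regular \<subseteq> V: refinement_monoid "V_monoid R"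
  by (rule V_refinement)

section \<open>Separativity in terms of idempotents\<close>

text \<open>This expresses (a) for equations [a] + [t] = [b] + [t] below [1] by finitely many
  elements and ring equations alone. Both sides are realised by the same idempotent, so [t] needs
  two copies t and t', and d needs a copy d' inside t'. The splitting d = d1 + d2 into two copies of
  d encodes d = 2 d.\<close>

definition idem_separative :: "('a, 'b) ring_scheme \<Rightarrow> bool" where
  "idem_separative R \<longleftrightarrow> (\<forall>a t b t'.
     ring_idem R a \<and> ring_idem R t \<and> ring_idem R b \<and> ring_idem R t' \<and>
     ring_orth R a t \<and> ring_orth R b t' \<and> a \<oplus>\<^bsub>R\<^esub> t = b \<oplus>\<^bsub>R\<^esub> t' \<and> idem_equiv R t t' \<longrightarrow>
     (\<exists>d d1 d2 d'. ring_idem R d \<and> ring_idem R d1 \<and> ring_idem R d2 \<and> ring_idem R d' \<and>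
        idem_le R d t \<and> idem_le R d' t' \<and> idem_equiv R d d' \<and>
        ring_orth R d1 d2 \<and> d = d1 \<oplus>\<^bsub>R\<^esub> d2 \<and> idem_equiv R d1 d \<and> idem_equiv R d2 d \<and>
        idem_equiv R (a \<oplus>\<^bsub>R\<^esub> d) (b \<oplus>\<^bsub>R\<^esub> d')))"

section \<open>Translation between classes and idempotents\<close>

context regular
begin

text \<open>Stability under sums reduces c to a generator [e]. After \<open>separative_atI\<close>
  both sums equal [e], so they can be realised as two decompositions of the one idempotent
  e.\<close>

lemma separative_at_if_idem_separative:
  assumes "idem_separative R" "c \<in> \<V>"
  shows "V.separative_at c"
  using assms(2)
proof (induction c rule: V_induct)
  case (mult e w)
  have "V.separative_at (icls R e)"
  proof (rule V.separative_atI[OF icls_in[OF mult(1)]])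
    fix y z t assume yzt: "y \<in> \<V>" "z \<in> \<V>"
      "t \<in> \<V>" "y \<oplus>\<^sub>V t = icls R e" "z \<oplus>\<^sub>V t = icls R e"
    obtain a t0 where a: "ring_idem R a" "ring_idem R t0" "ring_orth R a t0" "e = a \<oplus> t0"
      "icls R a = y" "icls R t0 = t" using icls_split[OF mult(1) yzt(1,3)] yzt(4) by metis
    obtain b t1 where b: "ring_idem R b" "ring_idem R t1" "ring_orth R b t1" "e = b \<oplus> t1"
      "icls R b = z" "icls R t1 = t" using icls_split[OF mult(1) yzt(2,3)] yzt(5) by metis
    have "idem_equiv R t0 t1" using a b by (simp flip: icls_eq_iff)
    then obtain d d1 d2 d' where d: "ring_idem R d" "ring_idem R d1" "ring_idem R d2"
      "ring_idem R d'"
        "idem_le R d t0" "idem_le R d' t1" "idem_equiv R d d'"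
        "ring_orth R d1 d2" "d = d1 \<oplus> d2" "idem_equiv R d1 d" "idem_equiv R d2 d"
        "idem_equiv R (a \<oplus> d) (b \<oplus> d')"
      using assms(1) a b unfolding idem_separative_def by metis
    have o: "ring_orth R a d" "ring_orth R b d'"
      using orth_le[OF a(3) idem_le_refl[OF a(1)] d(5)] orth_le[OF b(3) idem_le_refl[OF b(1)] d(6)]
        a(1,2)[THEN ring_idem_closed] b(1,2)[THEN ring_idem_closed] d(1,4)[THEN ring_idem_closed]
      by simp_all
    have eq: "icls R d1 = icls R d" "icls R d2 = icls R d" "icls R d' = icls R d"
      "icls R (a \<oplus> d) = icls R (b \<oplus> d')"
      using d(1-4,7,10-12) idem_add_orth[OF a(1) d(1) o(1)] idem_add_orth[OF b(1) d(4) o(2)]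
      by (simp_all add: icls_eq_iff idem_equiv_sym)
    have "icls R d = icls R d \<oplus>\<^sub>V icls R d"
      using icls_add[OF d(2,3,8)] d(9) eq by simp
    moreover have "icls R d \<oplus>\<^sub>V icls R (t0 \<ominus> d) = t"
      using icls_minus[OF a(2) d(1,5)] a(6) by simp
    moreover have "y \<oplus>\<^sub>V icls R d = z \<oplus>\<^sub>V icls R d"
      using icls_add[OF a(1) d(1) o(1)] icls_add[OF b(1) d(4) o(2)] eq a(5) b(5) by simp
    ultimately show "V.separates y z t"
      unfolding V.separates_def using icls_in[OF d(1)] icls_in[OF idem_minus(1)[OF a(2) d(1,5)]]
        by blast
  qed
  then show ?case using V.separative_at_mult mult icls_in[OF mult(1)] by blast
qed (rule V.separative_at_one)

text \<open>The converse translation, for equations below [1]: w is the class of 1 - (a + t). The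
  idempotent class obtained in V(R) is realised twice, inside t and inside t'.\<close>

lemma idem_separativeI:
  assumes "\<And>a b t w. \<lbrakk>a \<in> \<V>; b \<in> \<V>; t \<in> \<V>;
     w \<in> \<V>; a \<oplus>\<^sub>V t = b \<oplus>\<^sub>V t;
     a \<oplus>\<^sub>V t \<oplus>\<^sub>V w = icls R \<one>\<rbrakk> \<Longrightarrow> V.separates a b t"
  shows "idem_separative R"
  unfolding idem_separative_def
proof (intro allI impI, elim conjE)
  fix a t b t' assume a: "ring_idem R a" "ring_idem R t" "ring_orth R a t"
    and b: "ring_idem R b" "ring_idem R t'" "ring_orth R b t'"
    and eq: "a \<oplus> t = b \<oplus> t'" "idem_equiv R t t'"
  have t: "icls R t' = icls R t" using eq a b by (simp add: icls_eq_iff idem_equiv_sym)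
  note at = idem_add_orth[OF a]
  note at_le = idem_le_one[OF ring_idem_closed[OF at]]
  have "icls R a \<oplus>\<^sub>V icls R t = icls R b \<oplus>\<^sub>V icls R t"
    using icls_add[OF a] icls_add[OF b] eq t by simp
  moreover have "icls R a \<oplus>\<^sub>V icls R t \<oplus>\<^sub>V icls R (\<one> \<ominus> (a \<oplus> t)) = icls R \<one>"
    using icls_add[OF a] icls_minus[OF idem_one at at_le] by simp
  ultimately have "V.separates (icls R a) (icls R b) (icls R t)"
    by (intro assms[of _ _ _ "icls R (\<one> \<ominus> (a \<oplus> t))"] icls_in a b idem_minus(1)[OF idem_one at
      at_le])
  then obtain \<delta> \<zeta> where \<delta>: "\<delta> \<in> \<V>" "\<delta> = \<delta> \<oplus>\<^sub>V \<delta>" "\<zeta> \<in> \<V>"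
    "\<delta> \<oplus>\<^sub>V \<zeta> = icls R t" "icls R a \<oplus>\<^sub>V \<delta> = icls R b \<oplus>\<^sub>V \<delta>"
    unfolding V.separates_def by blast
  obtain d u where d: "ring_idem R d" "ring_idem R u" "ring_orth R d u" "t = d \<oplus> u" "icls R d = \<delta>"
    using icls_split[OF a(2) \<delta>(1,3)] \<delta>(4) by metis
  obtain d' u' where d': "ring_idem R d'" "ring_idem R u'" "ring_orth R d' u'" "t' = d' \<oplus> u'"
    "icls R d' = \<delta>" using icls_split[OF b(2) \<delta>(1,3)] \<delta>(4) t by metis
  obtain d1 d2 where dd: "ring_idem R d1" "ring_idem R d2" "ring_orth R d1 d2" "d = d1 \<oplus> d2"
    "icls R d1 = \<delta>" "icls R d2 = \<delta>" using icls_split[OF d(1) \<delta>(1,1)] \<delta>(2) d(5) by metis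
  have le: "idem_le R d t" "idem_le R d' t'"
    using idem_add_le(1)[OF d(1-3)] idem_add_le(1)[OF d'(1-3)] d(4) d'(4) by auto
  have o: "ring_orth R a d" "ring_orth R b d'"
    using orth_le[OF a(3) idem_le_refl[OF a(1)] le(1)] orth_le[OF b(3) idem_le_refl[OF b(1)] le(2)]
      a(1,2)[THEN ring_idem_closed] b(1,2)[THEN ring_idem_closed] d(1)[THEN ring_idem_closed]
      d'(1)[THEN ring_idem_closed] by simp_all
  have "icls R (a \<oplus> d) = icls R (b \<oplus> d')"
    using icls_add[OF a(1) d(1) o(1)] icls_add[OF b(1) d'(1) o(2)] d(5) d'(5) \<delta>(5) by simp
  then have "idem_equiv R (a \<oplus> d) (b \<oplus> d')"
    using icls_eq_iff[OF idem_add_orth[OF a(1) d(1) o(1)] idem_add_orth[OF b(1) d'(1) o(2)]] by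
      blast
  moreover have "idem_equiv R d1 d" "idem_equiv R d2 d" "idem_equiv R d d'"
    using d(1,5) d'(1,5) dd(1,2,5,6) icls_eq_iff by metis+
  ultimately show "\<exists>d d1 d2 d'. ring_idem R d \<and> ring_idem R d1 \<and> ring_idem R d2 \<and> ring_idem R d' \<and>
        idem_le R d t \<and> idem_le R d' t' \<and> idem_equiv R d d' \<and>
        ring_orth R d1 d2 \<and> d = d1 \<oplus> d2 \<and> idem_equiv R d1 d \<and> idem_equiv R d2 d \<and>
        idem_equiv R (a \<oplus> d) (b \<oplus> d')"
    using d(1) d'(1) dd(1-4) le by blast
qed

end

subsection \<open>The opposite ring\<close>

definition op_ring :: "('a, 'b) ring_scheme \<Rightarrow> ('a, 'b) ring_scheme" where
  "op_ring R = R\<lparr>mult := \<lambda>x y. y \<otimes>\<^bsub>R\<^esub> x\<rparr>"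

lemma op_ring_simps [simp]:
  "carrier (op_ring R) = carrier R" "x \<otimes>\<^bsub>op_ring R\<^esub> y = y \<otimes>\<^bsub>R\<^esub> x" "add (op_ring R) = add R"
  "\<one>\<^bsub>op_ring R\<^esub> = \<one>\<^bsub>R\<^esub>" "\<zero>\<^bsub>op_ring R\<^esub> = \<zero>\<^bsub>R\<^esub>"
  by (simp_all add: op_ring_def)

lemma (in ring) ring_op: "ring (op_ring R)"
proof (intro ringI abelian_groupI monoidI)
  show "\<exists>y\<in>carrier (op_ring R). y \<oplus>\<^bsub>op_ring R\<^esub> x = \<zero>\<^bsub>op_ring R\<^esub>" if "x \<in> carrier (op_ring R)" for x
    using that l_neg by (intro bexI[of _ "\<ominus> x"]) auto
qed (auto simp: a_ac m_assoc l_distr r_distr)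

lemma (in regular) regular_op: "regular (op_ring R)"
proof -
  interpret op: ring "op_ring R" by (rule ring_op)
  show ?thesis
    by unfold_locales (use regular in \<open>auto simp: m_assoc\<close>)
qed

lemma idem_op [simp]:
  "ring_idem (op_ring R) e \<longleftrightarrow> ring_idem R e" "ring_orth (op_ring R) e f \<longleftrightarrow> ring_orth R e f"
  "idem_le (op_ring R) e f \<longleftrightarrow> idem_le R e f" "idem_equiv (op_ring R) e f \<longleftrightarrow> idem_equiv R e f"
  by (auto simp: ring_idem_def ring_orth_def idem_le_def idem_equiv_def)

lemma idem_separative_op: "idem_separative (op_ring R) \<longleftrightarrow> idem_separative R"
  by (simp add: idem_separative_def)

lemma left_ideal_lattice_eq: "left_ideal_lattice R = right_ideal_lattice (op_ring R)"
  by (simp add: left_ideal_lattice_def right_ideal_lattice_def)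

subsection \<open>Quotient rings\<close>

text \<open>The quotient map is treated as a surjective homomorphism, so that the lifting arguments
  deal with elements and not with cosets.\<close>

locale regular_surj = R?: regular R + S?: ring S for R (structure) and S (structure) +
  fixes h
  assumes h: "h \<in> ring_hom R S" and surj: "h ` carrier R = carrier S"
begin

lemma h_simps [simp]:
  "x \<in> carrier R \<Longrightarrow> h x \<in> carrier S"
  "x \<in> carrier R \<Longrightarrow> y \<in> carrier R \<Longrightarrow> h (x \<otimes>\<^bsub>R\<^esub> y) = h x \<otimes>\<^bsub>S\<^esub> h y"
  "x \<in> carrier R \<Longrightarrow> y \<in> carrier R \<Longrightarrow> h (x \<oplus>\<^bsub>R\<^esub> y) = h x \<oplus>\<^bsub>S\<^esub> h y"
  "h \<one>\<^bsub>R\<^esub> = \<one>\<^bsub>S\<^esub>"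
  using h by (auto simp: ring_hom_def)

lemma h_zero [simp]: "h \<zero>\<^bsub>R\<^esub> = \<zero>\<^bsub>S\<^esub>"
proof -
  have "h \<zero>\<^bsub>R\<^esub> \<oplus>\<^bsub>S\<^esub> h \<zero>\<^bsub>R\<^esub> = h \<zero>\<^bsub>R\<^esub>"
    by (metis h_simps(3) R.l_zero R.zero_closed)
  then show ?thesis by (metis h_simps(1) R.zero_closed S.add.r_cancel_one')
qed

lemma h_minus [simp]:
  assumes "x \<in> carrier R" "y \<in> carrier R" shows "h (x \<ominus>\<^bsub>R\<^esub> y) = h x \<ominus>\<^bsub>S\<^esub> h y"
proof -
  have "h (x \<ominus>\<^bsub>R\<^esub> y) \<oplus>\<^bsub>S\<^esub> h y = h x"
    using assms R.minus_add_cancel(1) by (metis h_simps(3) R.minus_closed)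
  then show ?thesis using assms S.add_minus_cancel(1) by (metis h_simps(1) R.minus_closed)
qed

lemma surjE:
  assumes "y \<in> carrier S" obtains x where "x \<in> carrier R" "h x = y"
  using assms surj by (metis imageE)

lemma regular_image: "regular S"
proof
  fix y assume "y \<in> carrier S"
  then obtain x where x: "x \<in> carrier R" "h x = y" by (rule surjE)
  then obtain s where "s \<in> carrier R" "x \<otimes>\<^bsub>R\<^esub> s \<otimes>\<^bsub>R\<^esub> x = x" using regular by blast
  then show "\<exists>z\<in>carrier S. y \<otimes>\<^bsub>S\<^esub> z \<otimes>\<^bsub>S\<^esub> y = y"
    using x by (intro bexI[of _ "h s"]) (metis R.m_closed h_simps(2), simp)
qed

lemma h_idem:
  "ring_idem R e \<Longrightarrow> ring_idem S (h e)"
  "e \<in> carrier R \<Longrightarrow> f \<in> carrier R \<Longrightarrow> ring_orth R e f \<Longrightarrow> ring_orth S (h e) (h f)"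
  "e \<in> carrier R \<Longrightarrow> f \<in> carrier R \<Longrightarrow> idem_le R e f \<Longrightarrow> idem_le S (h e) (h f)"
  "idem_equiv R e f \<Longrightarrow> idem_equiv S (h e) (h f)"
  unfolding ring_idem_def ring_orth_def idem_le_def idem_equiv_def
  by (metis h_simps h_zero)+

text \<open>If \<open>x = c x c\<close> lifts \<open>e\<close>, then exchange applied to \<open>x + (c - x) = c\<close> gives an idempotent
  \<open>f \<in> x R\<close> with \<open>c - f \<in> (c - x) R\<close>; it has the same image as \<open>x\<close>.\<close>

lemma lift_idem:
  assumes c: "ring_idem R c" and e: "ring_idem S e" "idem_le S e (h c)"
  obtains f where "ring_idem R f" "idem_le R f c" "h f = e"
proof -
  obtain x0 where x0: "x0 \<in> carrier R" "h x0 = e" using surjE e ring_idem_closed by metis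
  define x where "x = c \<otimes>\<^bsub>R\<^esub> x0 \<otimes>\<^bsub>R\<^esub> c"
  have cc: "c \<in> carrier R" "c \<otimes>\<^bsub>R\<^esub> c = c" using c by (auto simp: ring_idem_def)
  have ec: "e \<in> carrier S" "e \<otimes>\<^bsub>S\<^esub> e = e" "h c \<otimes>\<^bsub>S\<^esub> e = e" "e \<otimes>\<^bsub>S\<^esub> h c = e"
    using e by (auto simp: ring_idem_def idem_le_def)
  have x: "x \<in> carrier R" "c \<otimes>\<^bsub>R\<^esub> x = x" "x \<otimes>\<^bsub>R\<^esub> c = x" "h x = e"
    using x0 cc ec by (simp_all add: x_def R.m_assoc R.assoc_eq[OF cc(2)])
  define y where "y = c \<ominus>\<^bsub>R\<^esub> x"
  have y: "y \<in> carrier R" "c \<otimes>\<^bsub>R\<^esub> y = y" "y \<otimes>\<^bsub>R\<^esub> c = y" "x \<oplus>\<^bsub>R\<^esub> y = c" "h y = h c \<ominus>\<^bsub>S\<^esub> e"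
    using x cc by (simp_all add: y_def R.ring_expand R.minus_add_cancel)
  obtain f k a b where f: "ring_idem R f" "ring_idem R k" "ring_orth R f k" "f \<oplus>\<^bsub>R\<^esub> k = c"
    "a \<in> carrier R" "b \<in> carrier R" "x \<otimes>\<^bsub>R\<^esub> a = f" "y \<otimes>\<^bsub>R\<^esub> b = k"
    using exchange_idems[OF c x(1) y(1,4) x(2) y(2) x(3) y(3)] by metis
  note fc = ring_idem_closed[OF f(1)] ring_idem_closed[OF f(2)]
  have 1: "e \<otimes>\<^bsub>S\<^esub> h f = h f"
    unfolding f(7)[symmetric] using x(1,4) f(5) ec by (simp flip: S.m_assoc)
  have 2: "e \<otimes>\<^bsub>S\<^esub> h k = \<zero>\<^bsub>S\<^esub>"
    unfolding f(8)[symmetric] using y(1,5) f(6) ec cc by (simp add: S.ring_expand flip: S.m_assoc)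
  have "e = e \<otimes>\<^bsub>S\<^esub> (h f \<oplus>\<^bsub>S\<^esub> h k)" using ec fc f(4) by (metis h_simps(3))
  then have "h f = e" using 1 2 ec fc by (simp add: S.r_distr)
  moreover have "idem_le R f c" using R.idem_add_le(1)[OF f(1-3)] f(4) by simp
  ultimately show thesis using that f by blast
qed

text \<open>Lift u to x in t R t' and choose s in t' R t with x s x = x. Then p = x s and q = s x
  are equivalent. The image of p fixes u, hence fixes u v = h t, so p and t have the same image
  although p may be smaller than t; dually for q.\<close>

lemma lift_equiv:
  assumes t: "ring_idem R t" "ring_idem R t'" and eq: "idem_equiv S (h t) (h t')"
  obtains p q where "ring_idem R p" "ring_idem R q" "idem_le R p t" "idem_le R q t'"
    "idem_equiv R p q" "h p = h t" "h q = h t'"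
proof -
  have tc: "t \<in> carrier R" "t' \<in> carrier R" "t \<otimes>\<^bsub>R\<^esub> t = t" "t' \<otimes>\<^bsub>R\<^esub> t' = t'"
    using t by (auto simp: ring_idem_def)
  obtain u v where uv: "u \<in> carrier S" "v \<in> carrier S" "u \<otimes>\<^bsub>S\<^esub> v = h t" "v \<otimes>\<^bsub>S\<^esub> u = h t'"
    "h t \<otimes>\<^bsub>S\<^esub> u = u" "u \<otimes>\<^bsub>S\<^esub> h t' = u"
    using S.idem_equiv_normalize[OF eq h_idem(1)[OF t(1)] h_idem(1)[OF t(2)]] by metis
  obtain x0 where x0: "x0 \<in> carrier R" "h x0 = u" using surjE uv by metis
  define x where "x = t \<otimes>\<^bsub>R\<^esub> x0 \<otimes>\<^bsub>R\<^esub> t'"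
  have x: "x \<in> carrier R" "t \<otimes>\<^bsub>R\<^esub> x = x" "x \<otimes>\<^bsub>R\<^esub> t' = x" "h x = u"
    using x0 tc uv by (simp_all add: x_def R.m_assoc R.assoc_eq[OF tc(3)])
  obtain s0 where s0: "s0 \<in> carrier R" "x \<otimes>\<^bsub>R\<^esub> s0 \<otimes>\<^bsub>R\<^esub> x = x" using regular x by blast
  define s where "s = t' \<otimes>\<^bsub>R\<^esub> s0 \<otimes>\<^bsub>R\<^esub> t"
  have s: "s \<in> carrier R" "t' \<otimes>\<^bsub>R\<^esub> s = s" "s \<otimes>\<^bsub>R\<^esub> t = s" "x \<otimes>\<^bsub>R\<^esub> (s \<otimes>\<^bsub>R\<^esub> x) = x"
    using s0 x(1-3) tc
    by (simp_all add: s_def R.m_assoc R.assoc_eq[OF tc(4)] R.assoc_eq[OF x(3)])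
  define p where "p = x \<otimes>\<^bsub>R\<^esub> s"
  define q where "q = s \<otimes>\<^bsub>R\<^esub> x"
  have p: "p \<in> carrier R" "p \<otimes>\<^bsub>R\<^esub> p = p" "t \<otimes>\<^bsub>R\<^esub> p = p" "p \<otimes>\<^bsub>R\<^esub> t = p" "p \<otimes>\<^bsub>R\<^esub> x = x"
  proof -
    show pc: "p \<in> carrier R" using x s by (simp add: p_def)
    show px: "p \<otimes>\<^bsub>R\<^esub> x = x" using x(1) s by (simp add: p_def R.m_assoc)
    have "p \<otimes>\<^bsub>R\<^esub> p = p \<otimes>\<^bsub>R\<^esub> x \<otimes>\<^bsub>R\<^esub> s" using x(1) s(1) pc by (simp add: p_def R.m_assoc)
    then show "p \<otimes>\<^bsub>R\<^esub> p = p" using px by (simp add: p_def)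
    have "t \<otimes>\<^bsub>R\<^esub> p = t \<otimes>\<^bsub>R\<^esub> x \<otimes>\<^bsub>R\<^esub> s" "p \<otimes>\<^bsub>R\<^esub> t = x \<otimes>\<^bsub>R\<^esub> (s \<otimes>\<^bsub>R\<^esub> t)"
      using x(1) s(1) tc(1) by (simp_all add: p_def R.m_assoc)
    then show "t \<otimes>\<^bsub>R\<^esub> p = p" "p \<otimes>\<^bsub>R\<^esub> t = p" using x(2) s(3) by (simp_all add: p_def)
  qed
  have q: "q \<in> carrier R" "q \<otimes>\<^bsub>R\<^esub> q = q" "t' \<otimes>\<^bsub>R\<^esub> q = q" "q \<otimes>\<^bsub>R\<^esub> t' = q" "x \<otimes>\<^bsub>R\<^esub> q = x"
  proof -
    show qc: "q \<in> carrier R" using x s by (simp add: q_def)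
    show xq: "x \<otimes>\<^bsub>R\<^esub> q = x" using s(4) by (simp add: q_def)
    have "q \<otimes>\<^bsub>R\<^esub> q = s \<otimes>\<^bsub>R\<^esub> (x \<otimes>\<^bsub>R\<^esub> q)" using x(1) s(1) qc by (simp add: q_def R.m_assoc)
    then show "q \<otimes>\<^bsub>R\<^esub> q = q" using xq by (simp add: q_def)
    have "t' \<otimes>\<^bsub>R\<^esub> q = t' \<otimes>\<^bsub>R\<^esub> s \<otimes>\<^bsub>R\<^esub> x" "q \<otimes>\<^bsub>R\<^esub> t' = s \<otimes>\<^bsub>R\<^esub> (x \<otimes>\<^bsub>R\<^esub> t')"
      using x(1) s(1) tc(2) by (simp_all add: q_def R.m_assoc)
    then show "t' \<otimes>\<^bsub>R\<^esub> q = q" "q \<otimes>\<^bsub>R\<^esub> t' = q" using x(3) s(2) by (simp_all add: q_def)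
  qed
  have "h p = h p \<otimes>\<^bsub>S\<^esub> h t" using p tc by (metis h_simps(2))
  also have "\<dots> = (h p \<otimes>\<^bsub>S\<^esub> h x) \<otimes>\<^bsub>S\<^esub> v"
    unfolding uv(3)[symmetric] using uv(1,2) x(4) p(1) by (simp add: S.m_assoc)
  also have "\<dots> = h t" using p x uv tc by (metis h_simps(2))
  finally have hp: "h p = h t" .
  have "h q = h t' \<otimes>\<^bsub>S\<^esub> h q" using q tc by (metis h_simps(2))
  also have "\<dots> = v \<otimes>\<^bsub>S\<^esub> (h x \<otimes>\<^bsub>S\<^esub> h q)"
    unfolding uv(4)[symmetric] using uv(1,2) x(4) q(1) by (simp add: S.m_assoc)
  also have "\<dots> = h t'" using q x uv tc by (metis h_simps(2))
  finally have hq: "h q = h t'" .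
  have "idem_equiv R p q" unfolding idem_equiv_def p_def q_def using x s by blast
  then show thesis
    using that[of p q] p q hp hq by (simp add: ring_idem_def idem_le_def)
qed

text \<open>The whole configuration is lifted below one idempotent c of R with image a + t = b + t';
  the complements of a0 and b0 in c then lift t and t' automatically.\<close>

lemma idem_separative_image:
  assumes "idem_separative R" shows "idem_separative S"
  unfolding idem_separative_def
proof (intro allI impI, elim conjE)
  fix a t b t' assume a: "ring_idem S a" "ring_idem S t" "ring_orth S a t"
    and b: "ring_idem S b" "ring_idem S t'" "ring_orth S b t'"
    and eq: "a \<oplus>\<^bsub>S\<^esub> t = b \<oplus>\<^bsub>S\<^esub> t'" "idem_equiv S t t'"
  note ac = ring_idem_closed[OF a(1)] ring_idem_closed[OF a(2)]
    ring_idem_closed[OF b(1)] ring_idem_closed[OF b(2)]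
  obtain c where c: "ring_idem R c" "h c = a \<oplus>\<^bsub>S\<^esub> t"
    using lift_idem[OF R.idem_one S.idem_add_orth[OF a]] S.idem_le_one ac by (metis S.a_closed
      h_simps(4))
  have le: "idem_le S a (h c)" "idem_le S b (h c)"
    using S.idem_add_le(1)[OF a] S.idem_add_le(1)[OF b] c eq by auto
  obtain a0 where a0: "ring_idem R a0" "idem_le R a0 c" "h a0 = a" using lift_idem[OF c(1) a(1)
    le(1)] .
  obtain b0 where b0: "ring_idem R b0" "idem_le R b0 c" "h b0 = b" using lift_idem[OF c(1) b(1)
    le(2)] .
  note t0 = R.idem_minus[OF c(1) a0(1,2)] and t1 = R.idem_minus[OF c(1) b0(1,2)]
  note cl = ring_idem_closed[OF a0(1)] ring_idem_closed[OF b0(1)] ring_idem_closed[OF c(1)]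
  have "h (c \<ominus>\<^bsub>R\<^esub> a0) = t" "h (c \<ominus>\<^bsub>R\<^esub> b0) = t'"
    using cl c a0 b0 ac S.add_minus_cancel eq(1) by (metis h_minus)+
  note ht = this
  obtain p q where pq: "ring_idem R p" "ring_idem R q" "idem_le R p (c \<ominus>\<^bsub>R\<^esub> a0)"
    "idem_le R q (c \<ominus>\<^bsub>R\<^esub> b0)" "idem_equiv R p q" "h p = t" "h q = t'"
    using lift_equiv[OF t0(1) t1(1)] ht eq(2) by metis
  note p = R.idem_minus[OF t0(1) pq(1,3)] and q = R.idem_minus[OF t1(1) pq(2,4)]
  note cl2 = ring_idem_closed[OF p(1)] ring_idem_closed[OF q(1)] ring_idem_closed[OF pq(1)]
    ring_idem_closed[OF pq(2)] ring_idem_closed[OF t0(1)] ring_idem_closed[OF t1(1)]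
  \<comment> \<open>The parts of c - a0 and c - b0 lost in lifting the equivalence. They vanish in
    S, so adding them to a0 and b0 changes no image and restores A + p = c = B + q.\<close>
  let ?p = "c \<ominus>\<^bsub>R\<^esub> a0 \<ominus>\<^bsub>R\<^esub> p" and ?q = "c \<ominus>\<^bsub>R\<^esub> b0 \<ominus>\<^bsub>R\<^esub> q"
  have o1: "ring_orth R a0 ?p" "ring_orth R a0 p"
    using R.orth_le[OF t0(2) R.idem_le_refl[OF a0(1)] _ cl(1) _ cl(1)] p(4) pq(3) cl2 by auto
  have o2: "ring_orth R b0 ?q" "ring_orth R b0 q"
    using R.orth_le[OF t1(2) R.idem_le_refl[OF b0(1)] _ cl(2) _ cl(2)] q(4) pq(4) cl2 by auto
  define A where "A = a0 \<oplus>\<^bsub>R\<^esub> ?p"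
  define B where "B = b0 \<oplus>\<^bsub>R\<^esub> ?q"
  have hp: "h ?p = \<zero>\<^bsub>S\<^esub>" "h ?q = \<zero>\<^bsub>S\<^esub>"
    using h_minus[OF cl2(5) cl2(3)] h_minus[OF cl2(6) cl2(4)] ht pq(6,7) ac by simp_all
  have A: "ring_idem R A" "ring_orth R A p" "A \<oplus>\<^bsub>R\<^esub> p = c" "h A = a"
  proof -
    show "ring_idem R A" unfolding A_def by (rule R.idem_add_orth[OF a0(1) p(1) o1(1)])
    show "ring_orth R A p" unfolding A_def
      by (rule R.orth_add(1)[OF o1(2) ring_orth_sym[OF p(2)] cl(1) cl2(1) cl2(3)])
    have "A \<oplus>\<^bsub>R\<^esub> p = a0 \<oplus>\<^bsub>R\<^esub> (p \<oplus>\<^bsub>R\<^esub> ?p)"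
      unfolding A_def using cl(1) cl2(1,3) by (simp add: R.a_ac)
    then show "A \<oplus>\<^bsub>R\<^esub> p = c" unfolding p(3) t0(3) .
    show "h A = a" unfolding A_def using hp h_simps(3)[OF cl(1) cl2(1)] a0(3) ac by simp
  qed
  have B: "ring_idem R B" "ring_orth R B q" "B \<oplus>\<^bsub>R\<^esub> q = c" "h B = b"
  proof -
    show "ring_idem R B" unfolding B_def by (rule R.idem_add_orth[OF b0(1) q(1) o2(1)])
    show "ring_orth R B q" unfolding B_def
      by (rule R.orth_add(1)[OF o2(2) ring_orth_sym[OF q(2)] cl(2) cl2(2) cl2(4)])
    have "B \<oplus>\<^bsub>R\<^esub> q = b0 \<oplus>\<^bsub>R\<^esub> (q \<oplus>\<^bsub>R\<^esub> ?q)"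
      unfolding B_def using cl(2) cl2(2,4) by (simp add: R.a_ac)
    then show "B \<oplus>\<^bsub>R\<^esub> q = c" unfolding q(3) t1(3) .
    show "h B = b" unfolding B_def using hp h_simps(3)[OF cl(2) cl2(2)] b0(3) ac by simp
  qed
  obtain d d1 d2 d' where d: "ring_idem R d" "ring_idem R d1" "ring_idem R d2" "ring_idem R d'"
      "idem_le R d p" "idem_le R d' q" "idem_equiv R d d'"
      "ring_orth R d1 d2" "d = d1 \<oplus>\<^bsub>R\<^esub> d2" "idem_equiv R d1 d" "idem_equiv R d2 d"
      "idem_equiv R (A \<oplus>\<^bsub>R\<^esub> d) (B \<oplus>\<^bsub>R\<^esub> d')"
    using assms A(1-3) B(1-3) pq(1,2,5) unfolding idem_separative_def by metis
  note cl3 = d(1-4)[THEN ring_idem_closed] A(1)[THEN ring_idem_closed] B(1)[THEN ring_idem_closed]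
  have "idem_equiv S (a \<oplus>\<^bsub>S\<^esub> h d) (b \<oplus>\<^bsub>S\<^esub> h d')"
    using h_idem(4)[OF d(12)] cl3 A(4) B(4) by simp
  moreover have "h d = h d1 \<oplus>\<^bsub>S\<^esub> h d2" using d(9) cl3 by simp
  ultimately show "\<exists>d d1 d2 d'. ring_idem S d \<and> ring_idem S d1 \<and> ring_idem S d2 \<and> ring_idem S d' \<and>
        idem_le S d t \<and> idem_le S d' t' \<and> idem_equiv S d d' \<and>
        ring_orth S d1 d2 \<and> d = d1 \<oplus>\<^bsub>S\<^esub> d2 \<and> idem_equiv S d1 d \<and> idem_equiv S d2 d \<and>
        idem_equiv S (a \<oplus>\<^bsub>S\<^esub> d) (b \<oplus>\<^bsub>S\<^esub> d')"
    using d(1-4)[THEN h_idem(1)] h_idem(3)[OF cl3(1) cl2(3) d(5)] h_idem(3)[OF cl3(4) cl2(4) d(6)]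
      d(7,10,11)[THEN h_idem(4)] h_idem(2)[OF cl3(2,3) d(8)] pq(6,7)
    by (intro exI[of _ "h d"] exI[of _ "h d1"] exI[of _ "h d2"] exI[of _ "h d'"]) auto
qed

end

lemma (in regular) regular_surj_Quot:
  assumes "ideal I R" shows "regular_surj R (R Quot I) ((+>\<^bsub>R\<^esub>) I)"
proof -
  interpret I: ideal I R by fact
  interpret Q: ring "R Quot I" by (rule I.quotient_is_ring)
  have "(+>\<^bsub>R\<^esub>) I ` carrier R = carrier (R Quot I)"
    by (auto simp: FactRing_def A_RCOSETS_def')
  then show ?thesis
    by (intro regular_surj.intro regular_surj_axioms.intro regular_axioms Q.ring_axioms
      I.rcos_ring_hom)
qed

section \<open>Countable suprema of orthogonal idempotents\<close>

context regular
begin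

lemma meet_right_ideal_lattice:
  assumes "X \<in> pideals R" "Y \<in> pideals R"
  shows "X \<sqinter>\<^bsub>right_ideal_lattice R\<^esub> Y = X \<inter> Y"
proof -
  have "(SOME x. greatest (right_ideal_lattice R) x (Lower (right_ideal_lattice R) {X, Y})) = X \<inter> Y"
  proof (rule some_equality)
    show *: "greatest (right_ideal_lattice R) (X \<inter> Y) (Lower (right_ideal_lattice R) {X, Y})"
      unfolding greatest_def Lower_def using assms pideals_Int[OF assms] by simp
    show "x = X \<inter> Y" if "greatest (right_ideal_lattice R) x (Lower (right_ideal_lattice R) {X,
      Y})" for x
      using that * unfolding greatest_def le_right_ideal_lattice by (meson subset_antisym)
  qed
  then show ?thesis by (simp add: meet_def inf_def)
qed

lemma join_right_ideal_lattice:
  assumes "X \<in> pideals R" "Y \<in> pideals R"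
  shows "X \<squnion>\<^bsub>right_ideal_lattice R\<^esub> Y = X <+>\<^bsub>R\<^esub> Y"
proof -
  have "(SOME x. least (right_ideal_lattice R) x (Upper (right_ideal_lattice R) {X, Y})) = X <+>\<^bsub>R\<^esub> Y"
  proof (rule some_equality)
    have "X \<subseteq> X <+>\<^bsub>R\<^esub> Y" "Y \<subseteq> X <+>\<^bsub>R\<^esub> Y" by (rule pideal_sum_upper[OF assms])+
    then show *: "least (right_ideal_lattice R) (X <+>\<^bsub>R\<^esub> Y) (Upper (right_ideal_lattice R) {X, Y})"
      unfolding least_def Upper_def using assms pideals_sum[OF assms] pideal_sum_least by simp
    show "x = X <+>\<^bsub>R\<^esub> Y" if "least (right_ideal_lattice R) x (Upper (right_ideal_lattice R) {X,
      Y})" for x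
      using that * unfolding least_def le_right_ideal_lattice by (meson subset_antisym)
  qed
  then show ?thesis by (simp add: join_def sup_def)
qed

lemma bottom_right_ideal_lattice: "\<bottom>\<^bsub>right_ideal_lattice R\<^esub> = {\<zero>}"
proof -
  have "(SOME x. least (right_ideal_lattice R) x (pideals R)) = {\<zero>}"
  proof (rule some_equality)
    show *: "least (right_ideal_lattice R) {\<zero>} (pideals R)"
      using zero_in_pideals pideal_zero by (auto simp: least_def)
    show "x = {\<zero>}" if "least (right_ideal_lattice R) x (pideals R)" for x
      using that * unfolding least_def by auto
  qed
  then show ?thesis by (simp add: bottom_def)
qed

text \<open>Write the generator of Z as a + t = b + s with t R = s R = T. Then a s = a t s = 0 and b
  t = b s t = 0, hence a b = a and b a = b: the idempotents a and b witness their own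
  equivalence.\<close>

lemma idem_equiv_common_compl:
  assumes "X \<in> pideals R" "Y \<in> pideals R" "T \<in> pideals R" "Z \<in> pideals R"
    "ideal_dsum R Z X T" "ideal_dsum R Z Y T"
  obtains a b where "ring_idem R a" "ring_idem R b" "X = pideal R a" "Y = pideal R b"
    "idem_equiv R a b"
proof -
  obtain g where g: "ring_idem R g" "Z = pideal R g" using pideals_idem assms by blast
  obtain a t where a: "ring_idem R a" "ring_idem R t" "ring_orth R a t" "g = a \<oplus> t"
    "X = pideal R a" "T = pideal R t" using ideal_dsum_idems[OF g(1) assms(1,3)] assms(5) g(2) by
    metis
  obtain b s where b: "ring_idem R b" "ring_idem R s" "ring_orth R b s" "g = b \<oplus> s"
    "Y = pideal R b" "T = pideal R s" using ideal_dsum_idems[OF g(1) assms(2,3)] assms(6) g(2) by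
    metis
  note c = a(1,2)[THEN ring_idem_closed] b(1,2)[THEN ring_idem_closed]
  have ts: "t \<otimes> s = s" "s \<otimes> t = t"
    using a b c pideal_self[OF c(2)] pideal_self[OF c(4)] by (metis mem_pideal)+
  have z: "a \<otimes> a = a" "b \<otimes> b = b" "a \<otimes> t = \<zero>" "b \<otimes> s = \<zero>"
    using a b by (auto simp: ring_idem_def ring_orth_def)
  have "a \<otimes> s = \<zero>" "b \<otimes> t = \<zero>"
    using ts z c by (metis l_null m_assoc)+
  moreover have "a \<otimes> g = a" "b \<otimes> g = b" unfolding a(4)
    using z c a(4) b(4) by (simp_all add: r_distr) (metis r_distr r_zero)
  ultimately have "a \<otimes> b = a" "b \<otimes> a = b"
    using a(4) b(4) c by (metis r_distr r_zero m_closed)+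
  then have "idem_equiv R a b" unfolding idem_equiv_def using c z by metis
  then show thesis using that a b by blast
qed

end

abbreviation dcls :: "('a, 'b) ring_scheme \<Rightarrow> 'a set \<Rightarrow> ('a, nat \<Rightarrow> 'a) rmodule set" where
  "dcls R X \<equiv> iso_class R (right_ideal_module R X)"

context regular
begin

lemma dcls_in: "X \<in> pideals R \<Longrightarrow> dcls R X \<in> \<V>"
  using pideals_idem icls_in by metis

lemma dcls_dsum:
  assumes "X \<in> pideals R" "Y \<in> pideals R" "Z \<in> pideals R" "ideal_dsum R Z X Y"
  shows "dcls R Z = dcls R X \<oplus>\<^sub>V dcls R Y"
proof -
  obtain g where g: "ring_idem R g" "Z = pideal R g" using pideals_idem assms by blast
  obtain a b where "ring_idem R a" "ring_idem R b" "ring_orth R a b" "g = a \<oplus> b"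
    "X = pideal R a" "Y = pideal R b" using ideal_dsum_idems[OF g(1) assms(1,2)] assms(4) g(2) by
    metis
  then show ?thesis using icls_add g by simp
qed

lemma dcls_common_compl:
  assumes "X \<in> pideals R" "Y \<in> pideals R" "T \<in> pideals R" "Z \<in> pideals R"
    "ideal_dsum R Z X T" "ideal_dsum R Z Y T"
  shows "dcls R X = dcls R Y"
  using idem_equiv_common_compl[OF assms] icls_eq_iff by metis

text \<open>Left multiplication by f maps h R isomorphically onto f h R, which is generated by an
  idempotent p of f R f. Hence [h] = [p] is a summand of [f].\<close>

lemma icls_embed:
  assumes "ring_idem R h" "ring_idem R f" and inj: "\<And>r. r \<in> pideal R h \<Longrightarrow> f \<otimes> r = \<zero> \<Longrightarrow> r = \<zero>"
  obtains k where "k \<in> \<V>" "icls R h \<oplus>\<^sub>V k = icls R f"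
proof -
  note c = assms(1,2)[THEN ring_idem_closed]
  have i: "h \<otimes> h = h" "f \<otimes> f = f" using assms by (auto simp: ring_idem_def)
  define k where "k = f \<otimes> h"
  have k: "k \<in> carrier R" "k \<otimes> h = k" "f \<otimes> k = k"
    using c i by (simp_all add: k_def m_assoc assoc_eq[OF i(2)])
  obtain s where s: "s \<in> carrier R" "k \<otimes> s \<otimes> k = k" using regular k by blast
  have ksk: "k \<otimes> (s \<otimes> k) = k" using s k by (simp add: m_assoc)
  \<comment> \<open>f u = f h, and u - h lies in h R, so injectivity gives u = h. Thus h s is a left
    inverse of k = f h in the sense that (h s) k = h.\<close>
  define u where "u = h \<otimes> (s \<otimes> k)"
  have u: "u \<in> carrier R" "h \<otimes> u = u" using c s k by (simp_all add: u_def assoc_eq[OF i(1)])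
  have "f \<otimes> u = k" unfolding u_def using c s k ksk by (simp add: k_def[symmetric] flip: m_assoc)
  then have "f \<otimes> (u \<ominus> h) = \<zero>" using u c k by (simp add: minus_distr k_def)
  moreover have "u \<ominus> h \<in> pideal R h" using u c i assms by (simp add: mem_pideal minus_distr)
  ultimately have uh: "u = h" using inj eq_of_minus_zero u c by blast
  define p where "p = k \<otimes> (h \<otimes> (s \<otimes> f))"
  have "h \<otimes> (s \<otimes> f) \<otimes> k = u" using c s k by (simp add: u_def m_assoc)
  then have eq: "idem_equiv R p h" unfolding idem_equiv_def p_def using c s k uh by blast
  have p: "p \<in> carrier R" "f \<otimes> p = p" "p \<otimes> f = p"
    using c s k i by (simp_all add: p_def m_assoc assoc_eq[OF k(3)])
  have "p \<otimes> k = k" using \<open>h \<otimes> (s \<otimes> f) \<otimes> k = u\<close> uh k c s by (simp add: p_def m_assoc)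
  then have "p \<otimes> p = p" using c s k p(1)
    by (subst (2) p_def) (simp add: assoc_eq[OF \<open>p \<otimes> k = k\<close>], simp add: p_def)
  then have pi: "ring_idem R p" "idem_le R p f" using p by (auto simp: ring_idem_def idem_le_def)
  have "icls R h = icls R p" using eq pi assms by (simp add: icls_eq_iff idem_equiv_sym)
  then show thesis
    using that[of "icls R (f \<ominus> p)"] icls_minus[OF assms(2) pi] icls_in idem_minus(1)[OF assms(2)
      pi] by simp
qed

end

section \<open>Partial sums and suprema of orthogonal sequences\<close>

primrec psum :: "('a, 'b) ring_scheme \<Rightarrow> (nat \<Rightarrow> 'a) \<Rightarrow> nat \<Rightarrow> 'a" where
  "psum R e 0 = \<zero>\<^bsub>R\<^esub>"
| "psum R e (Suc n) = psum R e n \<oplus>\<^bsub>R\<^esub> e n"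

definition orth_seq :: "('a, 'b) ring_scheme \<Rightarrow> (nat \<Rightarrow> 'a) \<Rightarrow> bool" where
  "orth_seq R e \<longleftrightarrow> (\<forall>n. ring_idem R (e n)) \<and> (\<forall>m n. m \<noteq> n \<longrightarrow> ring_orth R (e m) (e n))"

text \<open>The supremum is formed in the lattice of principal right ideals but of a set of
  elements, that is, of the ideals they generate. It is in general larger than the sum of these
  ideals.\<close>

definition pideal_sup :: "('a, 'b) ring_scheme \<Rightarrow> 'a set \<Rightarrow> 'a set \<Rightarrow> bool" where
  "pideal_sup R A s \<longleftrightarrow> s \<in> pideals R \<and> A \<subseteq> s \<and> (\<forall>H\<in>pideals R. A \<subseteq> H \<longrightarrow> s \<subseteq> H)"

lemma pideal_sup_unique: "pideal_sup R A s \<Longrightarrow> pideal_sup R A s' \<Longrightarrow> s = s'"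
  by (auto simp: pideal_sup_def)

context ring
begin

lemma psum_closed [simp]: "(\<And>n. x n \<in> carrier R) \<Longrightarrow> psum R x n \<in> carrier R"
  by (induction n) auto

lemma psum_mult_single:
  assumes "\<And>n. x n \<in> carrier R" "\<And>n. z n \<in> carrier R" "y \<in> carrier R"
    "\<And>m. x m \<otimes> y = (if m = n then z n else \<zero>)"
  shows "psum R x k \<otimes> y = (if n < k then z n else \<zero>)"
  using assms by (induction k) (auto simp: l_distr less_Suc_eq)

lemma single_mult_psum:
  assumes "\<And>n. x n \<in> carrier R" "\<And>n. z n \<in> carrier R" "y \<in> carrier R"
    "\<And>m. y \<otimes> x m = (if m = n then z n else \<zero>)"
  shows "y \<otimes> psum R x k = (if n < k then z n else \<zero>)"
  using assms by (induction k) (auto simp: r_distr less_Suc_eq)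

lemma psum_mult:
  assumes "\<And>n. x n \<in> carrier R" "\<And>n. y n \<in> carrier R" "\<And>n. z n \<in> carrier R"
    "\<And>m n. x m \<otimes> y n = (if m = n then z n else \<zero>)"
  shows "psum R x k \<otimes> psum R y k = psum R z k"
proof (induction k)
  case (Suc k)
  have "psum R x k \<otimes> y k = \<zero>" using psum_mult_single[of x z "y k" k k] assms by simp
  moreover have "x k \<otimes> psum R y k = \<zero>" using single_mult_psum[of y z "x k" k k] assms by simp
  ultimately show ?case using Suc assms by (simp add: ring_expand)
qed simp

lemma psum_mult_zero:
  assumes "\<And>n. x n \<in> carrier R" "\<And>n. y n \<in> carrier R" "\<And>m n. x m \<otimes> y n = \<zero>"
  shows "psum R x k \<otimes> psum R y l = \<zero>"
proof -
  have "psum R x k \<otimes> y n = \<zero>" for n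
    using assms by (induction k) (auto simp: l_distr)
  then show ?thesis using assms(1,2) by (induction l) (auto simp: r_distr)
qed

lemma psum_minus:
  assumes "\<And>n. x n \<in> carrier R" "\<And>n. y n \<in> carrier R"
  shows "psum R (\<lambda>n. x n \<ominus> y n) k = psum R x k \<ominus> psum R y k"
  using assms by (induction k) (auto simp: minus_eq minus_add a_ac)

lemma orth_seqD:
  assumes "orth_seq R e"
  shows "ring_idem R (e n)" "e n \<in> carrier R" "e m \<otimes> e n = (if m = n then e n else \<zero>)"
    "m \<noteq> n \<Longrightarrow> ring_orth R (e m) (e n)"
  using assms by (auto simp: orth_seq_def ring_idem_def ring_orth_def)

lemma orth_seqI:
  assumes "\<And>n. e n \<in> carrier R" "\<And>m n. e m \<otimes> e n = (if m = n then e n else \<zero>)"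
  shows "orth_seq R e"
  using assms by (auto simp: orth_seq_def ring_idem_def ring_orth_def)

lemma psum_idem:
  assumes "orth_seq R e" shows "ring_idem R (psum R e n)"
  using psum_mult[of e e e] orth_seqD[OF assms] by (simp add: ring_idem_def)

lemma psum_mono:
  assumes "orth_seq R e" shows "pideal R (psum R e n) \<subseteq> pideal R (psum R e (Suc n))"
proof -
  have "ring_orth R (psum R e n) (e n)"
    using psum_mult_single[of e e "e n" n n] single_mult_psum[of e e "e n" n n] orth_seqD[OF assms]
    by (simp add: ring_orth_def)
  then have "idem_le R (psum R e n) (psum R e (Suc n))"
    using idem_add_le(1)[OF psum_idem[OF assms] orth_seqD(1)[OF assms]] by simp
  then show ?thesis using idem_le_pideal psum_idem[OF assms] by blast
qed

lemma psum_in_upper: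
  assumes "H \<in> pideals R" "range e \<subseteq> H" shows "psum R e n \<in> H"
  using assms(2) by (induction n) (auto simp: pideal_zero[OF assms(1)] intro!: pideal_add[OF
    assms(1)])

lemma mem_psum:
  assumes "orth_seq R e" shows "e n \<in> pideal R (psum R e (Suc n))"
  using psum_mult_single[of e e "e n" n "Suc n"] orth_seqD[OF assms] psum_idem[OF assms, of "Suc n"]
  by (simp add: mem_pideal del: psum.simps)

lemma orth_seq_comp: "orth_seq R e \<Longrightarrow> inj g \<Longrightarrow> orth_seq R (e \<circ> g)"
  by (auto simp: orth_seq_def inj_eq)

end

section \<open>Suprema under meet-continuity\<close>

locale right_continuous = regular +
  assumes meet_continuous: "aleph0_meet_continuous (right_ideal_lattice R)"
begin

text \<open>Meet-continuity is used in the form of disjointness: if a meets every member of the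
  chain in zero, then its meet with the supremum is a supremum of zeros.\<close>

lemma pideal_sup_seq:
  assumes b: "\<And>n. b n \<in> pideals R" "\<And>n :: nat. b n \<subseteq> b (Suc n)"
  obtains s where "s \<in> pideals R" "\<And>n. b n \<subseteq> s" "\<And>H. H \<in> pideals R \<Longrightarrow> (\<And>n. b n \<subseteq> H) \<Longrightarrow> s \<subseteq> H"
    "\<And>a. a \<in> pideals R \<Longrightarrow> (\<And>n. a \<inter> b n = {\<zero>}) \<Longrightarrow> a \<inter> s = {\<zero>}"
proof -
  let ?L = "right_ideal_lattice R"
  have *: "\<exists>s. least ?L s (Upper ?L (range b)) \<and>
       least ?L (a \<sqinter>\<^bsub>?L\<^esub> s) (Upper ?L (range (\<lambda>n. a \<sqinter>\<^bsub>?L\<^esub> b n)))" if "a \<in> pideals R" for a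
    using meet_continuous that b unfolding aleph0_meet_continuous_def by simp
  obtain s where s: "least ?L s (Upper ?L (range b))" using *[OF zero_in_pideals] by blast
  have sp: "s \<in> pideals R" using s by (auto simp: least_def Upper_def)
  show thesis
  proof (rule that[OF sp])
    show "b n \<subseteq> s" for n using s b by (auto simp: least_def Upper_def)
    show "s \<subseteq> H" if "H \<in> pideals R" "\<And>n. b n \<subseteq> H" for H
    proof -
      have "H \<in> Upper ?L (range b)" using that by (auto simp: Upper_def)
      then show ?thesis using s unfolding least_def by simp
    qed
    fix a assume a: "a \<in> pideals R" "\<And>n. a \<inter> b n = {\<zero>}"
    obtain s' where s': "least ?L s' (Upper ?L (range b))"
       "least ?L (a \<sqinter>\<^bsub>?L\<^esub> s') (Upper ?L (range (\<lambda>n. a \<sqinter>\<^bsub>?L\<^esub> b n)))" using *[OF a(1)] by blast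
    \<comment> \<open>The supremum supplied by meet-continuity depends on a, but suprema are unique,
      so one s serves all a.\<close>
    have "s' = s" using s s'(1) unfolding least_def by auto
    then have "least ?L (a \<inter> s) (Upper ?L (range (\<lambda>n. {\<zero>})))"
      using s'(2) a b(1) sp by (simp add: meet_right_ideal_lattice)
    then have "a \<inter> s \<subseteq> {\<zero>}" using zero_in_pideals unfolding least_def Upper_def by auto
    then show "a \<inter> s = {\<zero>}" using pideal_zero a(1) sp by blast
  qed
qed

text \<open>The ideals generated by the partial sums form an increasing chain and have the same
  upper bounds as the idempotents themselves.\<close>

lemma pideal_sup_orth:
  assumes "orth_seq R e"
  obtains s where "pideal_sup R (range e) s"
    "\<And>a. a \<in> pideals R \<Longrightarrow> (\<And>n. a \<inter> pideal R (psum R e n) = {\<zero>}) \<Longrightarrow> a \<inter> s = {\<zero>}"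
proof -
  note e = orth_seqD[OF assms]
  have p: "pideal R (psum R e n) \<in> pideals R" for n using e by (simp add: pideal_in)
  obtain s where s: "s \<in> pideals R" "\<And>n. pideal R (psum R e n) \<subseteq> s"
    "\<And>H. H \<in> pideals R \<Longrightarrow> (\<And>n. pideal R (psum R e n) \<subseteq> H) \<Longrightarrow> s \<subseteq> H"
    "\<And>a. a \<in> pideals R \<Longrightarrow> (\<And>n. a \<inter> pideal R (psum R e n) = {\<zero>}) \<Longrightarrow> a \<inter> s = {\<zero>}"
    using pideal_sup_seq[of "\<lambda>n. pideal R (psum R e n)", OF p psum_mono[OF assms]] by metis
  have "pideal_sup R (range e) s"
    unfolding pideal_sup_def
  proof (intro conjI ballI impI s(1))
    show "range e \<subseteq> s" using mem_psum[OF assms] s(2) by blast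
    show "s \<subseteq> H" if "H \<in> pideals R" "range e \<subseteq> H" for H
      using s(3)[OF that(1)] pideal_le[OF that(1)] psum_in_upper[OF that] by blast
  qed
  then show thesis using that s by blast
qed

lemma pideal_sup_disjoint:
  assumes "orth_seq R e" "pideal_sup R (range e) s" "a \<in> pideals R"
    "\<And>n. a \<inter> pideal R (psum R e n) = {\<zero>}"
  shows "a \<inter> s = {\<zero>}"
  using pideal_sup_orth[OF assms(1)] pideal_sup_unique assms by metis

text \<open>The idempotent t n = e n - v n generates the graph of the map - v n from e n R to f n R.
  The supremum T of the graphs is disjoint from E and from F and has the same sum with both, so E
  and F are isomorphic.\<close>

lemma dcls_sup_eq:
  assumes e: "orth_seq R e" and f: "orth_seq R f" and ef: "\<And>m n. ring_orth R (e m) (f n)"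
    and eq: "\<And>n. idem_equiv R (e n) (f n)"
    and E: "pideal_sup R (range e) E" and F: "pideal_sup R (range f) F"
  shows "dcls R E = dcls R F"
proof -
  note e' = orth_seqD[OF e] and f' = orth_seqD[OF f]
  have ef': "e m \<otimes> f n = \<zero>" "f n \<otimes> e m = \<zero>" for m n using ef by (auto simp: ring_orth_def)
  have "\<exists>x y. x \<in> carrier R \<and> y \<in> carrier R \<and> x \<otimes> y = e n \<and> y \<otimes> x = f n \<and>
    e n \<otimes> x = x \<and> x \<otimes> f n = x \<and> f n \<otimes> y = y \<and> y \<otimes> e n = y" for n
    using idem_equiv_normalize[OF eq e'(1) f'(1)] by metis
  then obtain w v where wv: "\<And>n. w n \<in> carrier R" "\<And>n. v n \<in> carrier R" "\<And>n. w n \<otimes> v n = e n"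
    "\<And>n. v n \<otimes> w n = f n" "\<And>n. e n \<otimes> w n = w n" "\<And>n. w n \<otimes> f n = w n"
    "\<And>n. f n \<otimes> v n = v n" "\<And>n. v n \<otimes> e n = v n" by metis
  note c [simp] = e'(2) f'(2) wv(1,2)
  have fv: "f m \<otimes> v n = (if m = n then v n else \<zero>)" for m n
    using assoc_eq[OF f'(3), of m n "v n"] wv by (auto split: if_splits)
  have ve: "v m \<otimes> e n = (if m = n then v n else \<zero>)" for m n
    using m_assoc[of "v m" "e m" "e n"] wv e'(3) by (auto split: if_splits)
  have ev: "e m \<otimes> v n = \<zero>" for m n
    using assoc_eq[OF ef'(1), of m n "v n"] wv by auto
  have wv': "w m \<otimes> v n = (if m = n then e n else \<zero>)" for m n
    using m_assoc[of "w m" "f m" "v n"] wv fv by (auto split: if_splits)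
  have vv: "v m \<otimes> v n = \<zero>" for m n
    using m_assoc[of "v m" "e m" "v n"] wv ev by auto
  define t where "t n = e n \<ominus> v n" for n
  have tc [simp]: "t n \<in> carrier R" for n by (simp add: t_def)
  have t: "orth_seq R t"
    by (rule orth_seqI) (auto simp: t_def ring_expand e'(3) ve ev vv minus_zero_right)
  have psum_t: "psum R t n = psum R e n \<ominus> psum R v n" for n
    unfolding t_def by (rule psum_minus) auto
  have prods: "psum R f n \<otimes> psum R v n = psum R v n" "psum R v n \<otimes> psum R e n = psum R v n"
    "psum R w n \<otimes> psum R v n = psum R e n" for n
    by (rule psum_mult; simp add: fv ve wv')+
  have zeros: "psum R e n \<otimes> psum R v m = \<zero>" "psum R e n \<otimes> psum R f m = \<zero>"
    "psum R f n \<otimes> psum R e m = \<zero>" for m n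
    by (rule psum_mult_zero; simp add: ev ef')+
  have ee: "psum R e n \<otimes> psum R e n = psum R e n" for n
    by (rule psum_mult; simp add: e'(3))
  obtain T where T: "pideal_sup R (range t) T" using pideal_sup_orth[OF t] by blast
  note P = psum_idem[OF e] psum_idem[OF f] psum_idem[OF t]
  have Pin: "pideal R (psum R e n) \<in> pideals R" "pideal R (psum R f n) \<in> pideals R"
    "pideal R (psum R t n) \<in> pideals R" for n by (simp_all add: pideal_in)
  have EFT: "E \<in> pideals R" "F \<in> pideals R" "T \<in> pideals R"
    using E F T by (auto simp: pideal_sup_def)
  \<comment> \<open>An element r of the n-th graph sum is e r - v r, with e and v denoting partial
    sums. If r lies in the e part, its f component - v r vanishes, and w v = e gives e r =
    0.\<close>
  have te: "pideal R (psum R t n) \<inter> pideal R (psum R e m) = {\<zero>}" for m n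
  proof -
    have "r = \<zero>" if r: "r \<in> carrier R" "psum R t n \<otimes> r = r" "psum R e m \<otimes> r = r" for r
    proof -
      have tr: "r = psum R e n \<otimes> r \<ominus> psum R v n \<otimes> r" using r by (simp add: psum_t minus_distl)
      have "psum R f n \<otimes> r = \<zero>" using assoc_eq[OF zeros(3)[of n m], of r] r by simp
      moreover have "psum R f n \<otimes> r = \<zero> \<ominus> psum R v n \<otimes> r"
        by (subst tr) (use r in \<open>simp add: minus_distr assoc_eq[OF zeros(3)] assoc_eq[OF prods(1)]\<close>)
      ultimately have vr: "psum R v n \<otimes> r = \<zero>" using r(1) by (metis c(4) eq_of_minus_zero m_closed
        psum_closed zero_closed)
      then have "psum R e n \<otimes> r = \<zero>" using assoc_eq[OF prods(3)[of n], of r] r by simp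
      then show ?thesis using tr vr by simp
    qed
    then show ?thesis using P pideal_zero[OF Pin(1)] pideal_zero[OF Pin(3)] by (auto simp:
      mem_pideal)
  qed
  have tf: "pideal R (psum R t n) \<inter> pideal R (psum R f m) = {\<zero>}" for m n
  proof -
    have "r = \<zero>" if r: "r \<in> carrier R" "psum R t n \<otimes> r = r" "psum R f m \<otimes> r = r" for r
    proof -
      have tr: "r = psum R e n \<otimes> r \<ominus> psum R v n \<otimes> r" using r by (simp add: psum_t minus_distl)
      have er: "psum R e n \<otimes> r = \<zero>" using assoc_eq[OF zeros(2)[of n m], of r] r by simp
      then have "psum R v n \<otimes> r = \<zero>" using assoc_eq[OF prods(2)[of n], of r] r by simp
      then show ?thesis using tr er by simp
    qed
    then show ?thesis using P pideal_zero[OF Pin(2)] pideal_zero[OF Pin(3)] by (auto simp: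
      mem_pideal)
  qed
  \<comment> \<open>Disjointness of partial sums is passed to E with the index of the graphs fixed,
    and after that to T. This is why the two indices above are independent.\<close>
  have "E \<inter> pideal R (psum R t n) = {\<zero>}" for n
    using pideal_sup_disjoint[OF e E Pin(3) te] by blast
  then have ET: "E \<inter> T = {\<zero>}" using pideal_sup_disjoint[OF t T EFT(1)] by blast
  have "F \<inter> pideal R (psum R t n) = {\<zero>}" for n
    using pideal_sup_disjoint[OF f F Pin(3) tf] by blast
  then have FT: "F \<inter> T = {\<zero>}" using pideal_sup_disjoint[OF t T EFT(2)] by blast
  note sET = pideals_sum[OF EFT(1,3)] and sFT = pideals_sum[OF EFT(2,3)]
  note up = pideal_sum_upper[OF EFT(1,3)] pideal_sum_upper[OF EFT(2,3)]
  have tT: "t n \<in> T" and eE: "e n \<in> E" and fF: "f n \<in> F" for n using T E F by (auto simp: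
    pideal_sup_def)
  \<comment> \<open>v n = e n - t n belongs to E + T, hence so does f n = v n w n.\<close>
  have "f n \<in> E <+>\<^bsub>R\<^esub> T" for n
  proof -
    have "v n = e n \<ominus> t n" by (simp add: t_def minus_eq minus_add r_neg2)
    then have "v n \<in> E <+>\<^bsub>R\<^esub> T" using eE tT up pideal_diff[OF sET] by (metis subsetD)
    then show ?thesis using wv(4) pideal_mult[OF sET] c(3) by metis
  qed
  then have "F \<subseteq> E <+>\<^bsub>R\<^esub> T" using F sET by (auto simp: pideal_sup_def)
  then have 1: "F <+>\<^bsub>R\<^esub> T \<subseteq> E <+>\<^bsub>R\<^esub> T" using pideal_sum_least[OF sET] up by blast
  have "e n \<in> F <+>\<^bsub>R\<^esub> T" for n
  proof -
    have "v n \<in> F" using pideal_mult[OF EFT(2) fF[of n], of "v n"] wv by simp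
    moreover have "e n = v n \<oplus> t n" by (simp add: t_def minus_add_cancel)
    ultimately show ?thesis using tT mem_set_add by metis
  qed
  then have "E \<subseteq> F <+>\<^bsub>R\<^esub> T" using E sFT by (auto simp: pideal_sup_def)
  then have 2: "E <+>\<^bsub>R\<^esub> T \<subseteq> F <+>\<^bsub>R\<^esub> T" using pideal_sum_least[OF sFT] up by blast
  show ?thesis
    using dcls_common_compl[OF EFT sET] ET FT 1 2 by (simp add: ideal_dsum_def)
qed

lemma dcls_sup_union:
  assumes e: "orth_seq R e" and f: "orth_seq R f" and ef: "\<And>m n. ring_orth R (e m) (f n)"
    and E: "pideal_sup R (range e) E" and F: "pideal_sup R (range f) F"
  shows "pideal_sup R (range e \<union> range f) (E <+>\<^bsub>R\<^esub> F)"
    "dcls R (E <+>\<^bsub>R\<^esub> F) = dcls R E \<oplus>\<^sub>V dcls R F"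
proof -
  note e' = orth_seqD[OF e] and f' = orth_seqD[OF f]
  have ef': "e m \<otimes> f n = \<zero>" for m n using ef by (auto simp: ring_orth_def)
  have EF: "E \<in> pideals R" "F \<in> pideals R" using E F by (auto simp: pideal_sup_def)
  note s = pideals_sum[OF EF] and up = pideal_sum_upper[OF EF]
  show "pideal_sup R (range e \<union> range f) (E <+>\<^bsub>R\<^esub> F)"
    unfolding pideal_sup_def
  proof (intro conjI ballI impI s)
    show "range e \<union> range f \<subseteq> E <+>\<^bsub>R\<^esub> F" using up E F by (auto simp: pideal_sup_def)
    show "E <+>\<^bsub>R\<^esub> F \<subseteq> H" if "H \<in> pideals R" "range e \<union> range f \<subseteq> H" for H
      using that E F by (intro pideal_sum_least) (simp_all add: pideal_sup_def)
  qed
  have Pin: "pideal R (psum R e n) \<in> pideals R" "pideal R (psum R f n) \<in> pideals R" for n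
    using e' f' by (simp_all add: pideal_in)
  have z: "psum R e n \<otimes> psum R f m = \<zero>" for m n
    by (rule psum_mult_zero) (auto simp: e' f' ef')
  have "pideal R (psum R e n) \<inter> pideal R (psum R f m) = {\<zero>}" for m n
  proof -
    have "r = \<zero>" if "r \<in> carrier R" "psum R e n \<otimes> r = r" "psum R f m \<otimes> r = r" for r
      using assoc_eq[OF z[of n m], of r] that e' f' by simp
    then show ?thesis using psum_idem[OF e] psum_idem[OF f] pideal_zero[OF Pin(1)] pideal_zero[OF
      Pin(2)]
      by (auto simp: mem_pideal)
  qed
  then have "pideal R (psum R e n) \<inter> F = {\<zero>}" for n
    using pideal_sup_disjoint[OF f F Pin(1)] by blast
  then have "F \<inter> E = {\<zero>}" using pideal_sup_disjoint[OF e E EF(2)] by (metis Int_commute)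
  then have "ideal_dsum R (E <+>\<^bsub>R\<^esub> F) E F" by (auto simp: ideal_dsum_def)
  then show "dcls R (E <+>\<^bsub>R\<^esub> F) = dcls R E \<oplus>\<^sub>V dcls R F" by (rule dcls_dsum[OF EF s])
qed

end

section \<open>Separativity of right continuous rings\<close>

text \<open>The idempotent A n is what remains of e after B 0, ..., B (n - 1) have been split
  off.\<close>

definition idem_chain :: "('a, 'b) ring_scheme \<Rightarrow> 'a \<Rightarrow> (nat \<Rightarrow> 'a) \<Rightarrow> (nat \<Rightarrow> 'a) \<Rightarrow> bool" where
  "idem_chain R e A B \<longleftrightarrow> A 0 = e \<and> (\<forall>n. ring_idem R (A n) \<and> ring_idem R (B n) \<and>
     ring_orth R (B n) (A (Suc n)) \<and> A n = B n \<oplus>\<^bsub>R\<^esub> A (Suc n))"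

context ring
begin

text \<open>An infinite system a n = b n + a (n + 1) in V(R) is realised inside e by iterating
  \<open>icls_split\<close>. Each splitting starts from the remainder chosen before, so the choices
  are dependent.\<close>

lemma idem_chain_ex:
  assumes "ring_idem R e" "icls R e = a 0" "\<And>n. a n \<in> \<V>"
    "\<And>n. b n \<in> \<V>" "\<And>n. a n = b n \<oplus>\<^sub>V a (Suc n)"
  obtains A B where "idem_chain R e A B" "\<And>n. icls R (A n) = a n" "\<And>n. icls R (B n) = b n"
proof -
  have "\<exists>A. \<forall>n. (ring_idem R (A n) \<and> icls R (A n) = a n \<and> (n = 0 \<longrightarrow> A n = e)) \<and>
    (\<exists>z. ring_idem R z \<and> icls R z = b n \<and> ring_orth R z (A (Suc n)) \<and> A n = z \<oplus> A (Suc n))"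
  proof (rule dependent_nat_choice)
    show "\<exists>x. ring_idem R x \<and> icls R x = a 0 \<and> (0 = 0 \<longrightarrow> x = e)" using assms(1,2) by blast
    fix x n assume x: "ring_idem R x \<and> icls R x = a n \<and> (n = 0 \<longrightarrow> x = e)"
    then obtain z y where "ring_idem R z" "ring_idem R y" "ring_orth R z y" "x = z \<oplus> y"
      "icls R z = b n" "icls R y = a (Suc n)"
      using icls_split[of x "b n" "a (Suc n)"] assms by metis
    then show "\<exists>y. (ring_idem R y \<and> icls R y = a (Suc n) \<and> (Suc n = 0 \<longrightarrow> y = e)) \<and>
      (\<exists>z. ring_idem R z \<and> icls R z = b n \<and> ring_orth R z y \<and> x = z \<oplus> y)" by blast
  qed
  then obtain A where A: "\<And>n. ring_idem R (A n)" "\<And>n. icls R (A n) = a n" "A 0 = e"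
    "\<And>n. \<exists>z. ring_idem R z \<and> icls R z = b n \<and> ring_orth R z (A (Suc n)) \<and> A n = z \<oplus> A (Suc n)"
    by blast
  from A(4) obtain B where "\<And>n. ring_idem R (B n) \<and> icls R (B n) = b n \<and>
    ring_orth R (B n) (A (Suc n)) \<and> A n = B n \<oplus> A (Suc n)" by metis
  then show thesis using that[of A B] A(1-3) unfolding idem_chain_def by blast
qed

context
  fixes e A B
  assumes chain: "idem_chain R e A B"
begin

lemma idem_chainD:
  "A 0 = e" "ring_idem R (A n)" "ring_idem R (B n)" "ring_orth R (B n) (A (Suc n))"
  "B n \<oplus> A (Suc n) = A n" "A n \<in> carrier R" "B n \<in> carrier R"
proof -
  have c: "A 0 = e" "\<And>n. ring_idem R (A n)" "\<And>n. ring_idem R (B n)"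
    "\<And>n. ring_orth R (B n) (A (Suc n))" "\<And>n. A n = B n \<oplus> A (Suc n)"
    using chain unfolding idem_chain_def by blast+
  show "A 0 = e" "ring_idem R (A n)" "ring_idem R (B n)" "ring_orth R (B n) (A (Suc n))"
    by (rule c)+
  show "B n \<oplus> A (Suc n) = A n" by (rule c(5)[symmetric])
  show "A n \<in> carrier R" "B n \<in> carrier R" by (rule c(2,3)[THEN ring_idem_closed])+
qed

lemma idem_chain_le:
  "idem_le R (A (m + k)) (A m)"
proof (induction k)
  case 0 then show ?case using idem_le_refl idem_chainD(2) by simp
next
  case (Suc k)
  have "idem_le R (A (Suc (m + k))) (A (m + k))"
    using idem_add_le(2)[OF idem_chainD(3,2,4)] idem_chainD(5) by metis
  then show ?case using Suc idem_le_trans idem_chainD(6) by (metis add_Suc_right)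
qed

lemma idem_chain_part_le: "idem_le R (B n) (A n)"
  using idem_add_le(1)[OF idem_chainD(3,2,4)] unfolding idem_chainD(5) .

lemma idem_chain_part_le_top: "idem_le R (B n) e"
proof -
  have "e \<in> carrier R" using idem_chainD(6)[of 0] unfolding idem_chainD(1) .
  moreover have "idem_le R (A n) e" using idem_chain_le[of 0 n] unfolding idem_chainD(1) add_0 .
  ultimately show ?thesis using idem_le_trans[OF idem_chain_part_le] idem_chainD(6,7) by blast
qed

lemma idem_chain_orth_seq: "orth_seq R B"
proof -
  have 1: "ring_orth R (B m) (B n)" if "m < n" for m n
  proof -
    have "idem_le R (B n) (A (Suc m))"
      using idem_le_trans[OF idem_chain_part_le idem_chain_le[of "Suc m" "n - Suc m"]] that
        idem_chainD(6,7)
      by simp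
    then show ?thesis
      using orth_le[OF idem_chainD(4) idem_le_refl[OF idem_chainD(3)]] idem_chainD(6,7) by blast
  qed
  have "ring_orth R (B m) (B n)" if "m \<noteq> n" for m n
    using that 1 ring_orth_sym by (metis linorder_neqE_nat)
  then show ?thesis using idem_chainD(3) by (simp add: orth_seq_def)
qed

lemma idem_chain_psum: "psum R B n \<oplus> A n = e"
proof (induction n)
  case 0 then show ?case using idem_chainD(1,6) by (metis psum.simps(1) l_zero)
next
  case (Suc n)
  have "psum R B (Suc n) \<oplus> A (Suc n) = psum R B n \<oplus> (B n \<oplus> A (Suc n))"
    using idem_chainD(6,7) by (simp add: a_assoc)
  then show ?case using Suc idem_chainD(5) by simp
qed

end

end

section \<open>Countable sums as classes of suprema\<close>

context right_continuous
begin

text \<open>It plays the role of the infinite sum of the classes [e n]. It is attached to the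
  sequence and not to the classes, because termwise equal classes are compared only for mutually
  orthogonal sequences, in \<open>dl_cong\<close>.\<close>

definition dl :: "(nat \<Rightarrow> 'a) \<Rightarrow> ('a, nat \<Rightarrow> 'a) rmodule set" where
  "dl e = dcls R (SOME s. pideal_sup R (range e) s)"

lemma dl_eq:
  assumes "pideal_sup R (range e) s" shows "dl e = dcls R s"
proof -
  have "pideal_sup R (range e) (SOME s. pideal_sup R (range e) s)" using assms by (rule someI)
  then show ?thesis unfolding dl_def using pideal_sup_unique[OF _ assms] by simp
qed

lemma dl_in:
  assumes "orth_seq R e" shows "dl e \<in> \<V>"
proof -
  obtain s where s: "pideal_sup R (range e) s" using pideal_sup_orth[OF assms] by metis
  then show ?thesis using dl_eq[OF s] dcls_in by (simp add: pideal_sup_def)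
qed

lemma dl_cong:
  assumes "orth_seq R e" "orth_seq R f" "\<And>m n. ring_orth R (e m) (f n)"
    "\<And>n. icls R (e n) = icls R (f n)"
  shows "dl e = dl f"
proof -
  obtain E where E: "pideal_sup R (range e) E" using pideal_sup_orth[OF assms(1)] by metis
  obtain F where F: "pideal_sup R (range f) F" using pideal_sup_orth[OF assms(2)] by metis
  have "idem_equiv R (e n) (f n)" for n
    using assms(4) icls_eq_iff[OF orth_seqD(1)[OF assms(1)] orth_seqD(1)[OF assms(2)]] by blast
  then show ?thesis using dcls_sup_eq[OF assms(1-3) _ E F] dl_eq[OF E] dl_eq[OF F] by simp
qed

text \<open>Zero terms do not affect a supremum. Comparing the ranges up to zero admits finite
  families padded by zeros, which \<open>dl_absorb\<close> needs.\<close>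

lemma dl_union:
  assumes "orth_seq R e" "orth_seq R f" "\<And>m n. ring_orth R (e m) (f n)"
    "range g \<union> {\<zero>} = range e \<union> range f \<union> {\<zero>}"
  shows "dl g = dl e \<oplus>\<^sub>V dl f"
proof -
  obtain E where E: "pideal_sup R (range e) E" using pideal_sup_orth[OF assms(1)] by metis
  obtain F where F: "pideal_sup R (range f) F" using pideal_sup_orth[OF assms(2)] by metis
  note u = dcls_sup_union[OF assms(1-3) E F]
  have iff: "range g \<subseteq> H \<longleftrightarrow> range e \<union> range f \<subseteq> H" if "H \<in> pideals R" for H
  proof -
    have "A \<subseteq> H \<longleftrightarrow> A \<union> {\<zero>} \<subseteq> H" for A using pideal_zero[OF that] by blast
    then show ?thesis using assms(4) by metis
  qed
  then have "pideal_sup R (range g) (E <+>\<^bsub>R\<^esub> F)" using u(1) by (simp add: pideal_sup_def)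
  then show ?thesis using u(2) dl_eq E F by metis
qed

lemma dl_split:
  assumes e: "orth_seq R e" and gh: "inj g" "inj h" "range g \<inter> range h = {}"
    "range g \<union> range h = UNIV"
  shows "dl e = dl (e \<circ> g) \<oplus>\<^sub>V dl (e \<circ> h)"
proof (rule dl_union)
  show "orth_seq R (e \<circ> g)" "orth_seq R (e \<circ> h)" using orth_seq_comp e gh by blast+
  show "ring_orth R ((e \<circ> g) m) ((e \<circ> h) n)" for m n
    using orth_seqD(4)[OF e, of "g m" "h n"] gh(3) by auto
  show "range e \<union> {\<zero>} = range (e \<circ> g) \<union> range (e \<circ> h) \<union> {\<zero>}"
    unfolding image_comp[symmetric] image_Un[symmetric] gh(4) ..
qed

lemma dl_reindex:
  assumes e: "orth_seq R e" and p: "\<And>n. icls R (e n) = p" and gh: "inj g" "inj h"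
    "range g \<inter> range h = {}"
  shows "dl (e \<circ> g) = dl (e \<circ> h)"
proof (rule dl_cong)
  show "orth_seq R (e \<circ> g)" "orth_seq R (e \<circ> h)" using orth_seq_comp e gh by blast+
  show "ring_orth R ((e \<circ> g) m) ((e \<circ> h) n)" for m n
    using orth_seqD(4)[OF e, of "g m" "h n"] gh(3) by auto
qed (simp add: p)

text \<open>The sequence e cannot be compared with its even half, since they overlap. The even and
  odd halves have equal classes, and the odd half is the union of two quarters, each disjoint from
  the even half and so equal to it in class. Hence the class of a half equals its own double, which
  is the class of e.\<close>

lemma dl_even:
  assumes e: "orth_seq R e" and p: "\<And>n. icls R (e n) = p"
  shows "dl e \<oplus>\<^sub>V dl e = dl e" "dl e = dl (e \<circ> (\<lambda>n. 2 * n))" "dl e = dl (e \<circ> (\<lambda>n. 2 * n + 1))"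
proof -
  define g h :: "nat \<Rightarrow> nat" where "g = (\<lambda>n. 2 * n)" and "h = (\<lambda>n. 2 * n + 1)"
  have gh: "inj g" "inj h" by (auto simp: g_def h_def inj_def)
  have disj: "range g \<inter> range h = {}" by (auto simp: g_def h_def) presburger
  have un: "range g \<union> range h = UNIV"
  proof -
    have "n \<in> range g \<union> range h" for n
      by (cases "even n") (auto simp: g_def h_def elim!: evenE oddE)
    then show ?thesis by blast
  qed
  have gh2: "inj (h \<circ> g)" "inj (h \<circ> h)" using gh inj_compose by blast+
  have disj2: "range g \<inter> range (h \<circ> g) = {}" "range g \<inter> range (h \<circ> h) = {}" using disj by auto
  have 1: "dl e = dl (e \<circ> g) \<oplus>\<^sub>V dl (e \<circ> h)" by (rule dl_split[OF e gh disj un])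
  have 2: "dl (e \<circ> g) = dl (e \<circ> h)" by (rule dl_reindex[OF e p gh disj])
  have "dl (e \<circ> h) = dl (e \<circ> h \<circ> g) \<oplus>\<^sub>V dl (e \<circ> h \<circ> h)"
    by (rule dl_split[OF orth_seq_comp[OF e gh(2)] gh disj un])
  moreover have "dl (e \<circ> g) = dl (e \<circ> h \<circ> g)" "dl (e \<circ> g) = dl (e \<circ> h \<circ> h)"
    using dl_reindex[OF e p gh(1) gh2(1) disj2(1)] dl_reindex[OF e p gh(1) gh2(2) disj2(2)]
    by (simp_all add: comp_assoc)
  ultimately have 3: "dl (e \<circ> h) = dl (e \<circ> h) \<oplus>\<^sub>V dl (e \<circ> h)" using 2 by simp
  show "dl e \<oplus>\<^sub>V dl e = dl e" "dl e = dl (e \<circ> (\<lambda>n. 2 * n))"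
    "dl e = dl (e \<circ> (\<lambda>n. 2 * n + 1))"
    using 1 2 3 by (simp_all add: g_def h_def)
qed

text \<open>Split off e 0. The tail has the class of its own even half, which is the odd half of e
  and has the class of all of e.\<close>

lemma dl_absorb:
  assumes e: "orth_seq R e" and p: "\<And>n. icls R (e n) = p"
  shows "p \<oplus>\<^sub>V dl e = dl e"
proof -
  \<comment> \<open>The single idempotent e 0 as a sequence padded by zeros; its supremum is e 0
    R.\<close>
  define f where "f n = (if n = 0 then e 0 else \<zero>)" for n :: nat
  note e' = orth_seqD[OF e]
  have f: "orth_seq R f" by (rule orth_seqI) (auto simp: f_def e')
  have s: "orth_seq R (e \<circ> Suc)" by (rule orth_seq_comp[OF e]) simp
  have "pideal_sup R (range f) (pideal R (e 0))"
    unfolding pideal_sup_def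
  proof (intro conjI ballI impI)
    show "pideal R (e 0) \<in> pideals R" using e' by (simp add: pideal_in)
    then show "range f \<subseteq> pideal R (e 0)" using pideal_self[of "e 0"] pideal_zero e' by (auto simp:
      f_def)
    fix H assume "H \<in> pideals R" "range f \<subseteq> H"
    then show "pideal R (e 0) \<subseteq> H" using pideal_le[of H "e 0"] by (force simp: f_def)
  qed
  then have "dl f = p" using dl_eq p by simp
  have o: "ring_orth R (f m) ((e \<circ> Suc) n)" for m n
    using e' by (auto simp: f_def ring_orth_def)
  have "e n \<in> insert (e 0) (range (e \<circ> Suc))" for n by (cases n) auto
  then have "range e = insert (e 0) (range (e \<circ> Suc))" by auto
  moreover have "range f \<union> {\<zero>} = {e 0, \<zero>}" by (auto simp: f_def)
  ultimately have "range e \<union> {\<zero>} = range f \<union> range (e \<circ> Suc) \<union> {\<zero>}" by blast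
  then have "dl e = p \<oplus>\<^sub>V dl (e \<circ> Suc)"
    using dl_union[OF f s o] \<open>dl f = p\<close> by metis
  moreover have "dl (e \<circ> Suc) = dl (e \<circ> Suc \<circ> (\<lambda>n. 2 * n))"
    using dl_even(2)[OF s] p by simp
  moreover have "e \<circ> Suc \<circ> (\<lambda>n. 2 * n) = e \<circ> (\<lambda>n. 2 * n + 1)" by auto
  ultimately show ?thesis using dl_even(3)[OF e p] by metis
qed

text \<open>Let h be a complement in e of the supremum s of the B n. An element of h R killed by A n
  is fixed by the n-th partial sum of B, hence lies in s and is zero. So A n acts injectively on h
  R, and [h] lies below every [A n].\<close>

lemma idem_chain_residue:
  assumes chain: "idem_chain R e A B"
  obtains h where "ring_idem R h" "icls R e = dl B \<oplus>\<^sub>V icls R h"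
    "\<And>n. \<exists>k\<in>\<V>. icls R h \<oplus>\<^sub>V k = icls R (A n)"
proof -
  note ch = idem_chainD[OF chain]
  note orth = idem_chain_orth_seq[OF chain]
  note B = orth_seqD[OF orth]
  have e: "ring_idem R e" using ch(1,2) by metis
  obtain s where s: "pideal_sup R (range B) s" using pideal_sup_orth[OF orth] by metis
  have sp: "s \<in> pideals R" "range B \<subseteq> s" using s by (auto simp: pideal_sup_def)
  note ep = pideal_in[OF ring_idem_closed[OF e]]
  have "range B \<subseteq> pideal R e"
    using idem_chain_part_le_top[OF chain] B e by (auto simp: mem_pideal idem_le_def)
  then have "s \<subseteq> pideal R e" using s ep by (auto simp: pideal_sup_def)
  then obtain Z where Z: "Z \<in> pideals R" "ideal_dsum R (pideal R e) s Z"
    using pideals_compl[OF sp(1) ep] by metis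
  obtain g h where gh: "ring_idem R g" "ring_idem R h" "ring_orth R g h" "e = g \<oplus> h"
    "s = pideal R g" "Z = pideal R h"
    using ideal_dsum_idems[OF e sp(1) Z] by metis
  show thesis
  proof (rule that[OF gh(2)])
    show "icls R e = dl B \<oplus>\<^sub>V icls R h"
      using icls_add[OF gh(1-3)] gh dl_eq[OF s] by simp
    fix n
    have "r = \<zero>" if r: "r \<in> pideal R h" "A n \<otimes> r = \<zero>" for r
    proof -
      have rc: "r \<in> carrier R" using r gh by (simp add: mem_pideal)
      have "r \<in> pideal R e"
        using r(1) idem_le_pideal[OF e gh(2)] idem_add_le(2)[OF gh(1-3)] gh(4) by auto
      then have "(psum R B n \<oplus> A n) \<otimes> r = r" using idem_chain_psum[OF chain] e by (simp add:
        mem_pideal)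
      then have "psum R B n \<otimes> r = r" using r(2) rc B ch by (simp add: l_distr)
      moreover have "psum R B n \<in> s" by (rule psum_in_upper[OF sp])
      ultimately have "r \<in> s" using pideal_mult[OF sp(1)] rc by metis
      moreover have "s \<inter> Z = {\<zero>}" using Z(2) by (simp add: ideal_dsum_def)
      ultimately show ?thesis using r(1) gh(6) by auto
    qed
    then show "\<exists>k\<in>\<V>. icls R h \<oplus>\<^sub>V k = icls R (A n)"
      using icls_embed[OF gh(2) ch(2)] by metis
  qed
qed

lemma separates_independent:
  assumes in_V: "y0 \<in> \<V>" "z0 \<in> \<V>" "s0 \<in> \<V>"
    "w \<in> \<V>"
    and eq: "y0 \<oplus>\<^sub>V s0 = z0 \<oplus>\<^sub>V s0"
    and one: "(y0 \<oplus>\<^sub>V z0) \<oplus>\<^sub>V (s0 \<oplus>\<^sub>V w) = icls R \<one>"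
  shows "V.separates y0 z0 s0"
proof -
  \<comment> \<open>Stages of the iteration. The clause for n = 0 pins the starting triple, which
    the choice principle would leave open.\<close>
  let ?P = "\<lambda>n :: nat. \<lambda>(y, z, s). y \<in> \<V> \<and> z \<in> \<V> \<and> s \<in> \<V> \<and> y \<oplus>\<^sub>V s = z \<oplus>\<^sub>V s \<and>
    (n = 0 \<longrightarrow> (y, z, s) = (y0, z0, s0))"
  \<comment> \<open>One refinement of y + s = z + s: x is the part common to y and z, and the
    remainders y' and z' both reappear inside s next to the same s'.\<close>
  let ?Q = "\<lambda>n :: nat. \<lambda>(y, z, s) (y', z', s'). \<exists>x\<in>\<V>. y = x \<oplus>\<^sub>V y' \<and> z = x \<oplus>\<^sub>V z' \<and>
    s = y' \<oplus>\<^sub>V s' \<and> s = z' \<oplus>\<^sub>V s'"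
  have "\<exists>f. \<forall>n. ?P n (f n) \<and> ?Q n (f n) (f (Suc n))"
  proof (rule dependent_nat_choice)
    show "\<exists>x. ?P 0 x" using in_V eq by auto
    fix c n assume "?P n c"
    then obtain y z s where c: "c = (y, z, s)" "y \<in> \<V>" "z \<in> \<V>" "s \<in> \<V>"
      "y \<oplus>\<^sub>V s = z \<oplus>\<^sub>V s" by auto
    obtain p q r t where "p \<in> \<V>" "q \<in> \<V>" "r \<in> \<V>" "t \<in> \<V>" "y = p \<oplus>\<^sub>V q"
      "s = r \<oplus>\<^sub>V t" "z = p \<oplus>\<^sub>V r" "s = q \<oplus>\<^sub>V t"
      using V.refineE[OF c(2,4,3,4,5)] .
    moreover from this have "q \<oplus>\<^sub>V t = r \<oplus>\<^sub>V t" by metis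
    ultimately have "?P (Suc n) (q, r, t) \<and> ?Q n c (q, r, t)"
      unfolding c(1) prod.case by blast
    then show "\<exists>c'. ?P (Suc n) c' \<and> ?Q n c c'" by blast
  qed
  then obtain f where "\<forall>n. ?P n (f n) \<and> ?Q n (f n) (f (Suc n))" by (rule exE)
  then have f: "?P n (f n)" "?Q n (f n) (f (Suc n))" for n by simp_all
  define y where "y n = fst (f n)" for n
  define z where "z n = fst (snd (f n))" for n
  define s where "s n = snd (snd (f n))" for n
  have fn: "f n = (y n, z n, s n)" for n by (simp add: y_def z_def s_def)
  have V: "y n \<in> \<V>" "z n \<in> \<V>" "s n \<in> \<V>" for n using f(1)[of n] by (auto simp: fn)
  have init: "y 0 = y0" "z 0 = z0" "s 0 = s0" using f(1)[of 0] by (auto simp: fn)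
  have "\<exists>x\<in>\<V>. y n = x \<oplus>\<^sub>V y (Suc n) \<and> z n = x \<oplus>\<^sub>V z (Suc n) \<and>
    s n = y (Suc n) \<oplus>\<^sub>V s (Suc n) \<and> s n = z (Suc n) \<oplus>\<^sub>V s (Suc n)" for n
    using f(2)[of n] by (simp add: fn)
  then obtain x where x: "\<And>n. x n \<in> \<V>" "\<And>n. y n = x n \<oplus>\<^sub>V y (Suc n)"
    "\<And>n. z n = x n \<oplus>\<^sub>V z (Suc n)"
    and s: "\<And>n. s n = y (Suc n) \<oplus>\<^sub>V s (Suc n)" "\<And>n. s n = z (Suc n) \<oplus>\<^sub>V s (Suc n)"
    by metis
  \<comment> \<open>Both y (n + 1) and z (n + 1) are summands of s n, but not simultaneously. Even
    stages remove the former and odd stages the latter.\<close>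
  define u where "u n = (if even n then y (Suc n) else z (Suc n))" for n
  have u: "u n \<in> \<V>" "s n = u n \<oplus>\<^sub>V s (Suc n)" for n
    using V s unfolding u_def by metis+
  obtain c1 c2 where c: "ring_idem R c1" "ring_idem R c2" "ring_orth R c1 c2"
    "icls R c1 = y0 \<oplus>\<^sub>V z0" "icls R c2 = s0 \<oplus>\<^sub>V w"
    using icls_split[OF idem_one _ _ one[symmetric]] in_V by (metis V.m_closed)
  obtain yi zi where yz: "ring_idem R yi" "ring_idem R zi" "ring_orth R yi zi" "icls R yi = y 0"
    "icls R zi = z 0"
    using icls_split[OF c(1) in_V(1,2) c(4)] init by metis
  obtain si wi where si: "ring_idem R si" "icls R si = s 0"
    using icls_split[OF c(2) in_V(3,4) c(5)] init by metis
  obtain Y X where Y: "idem_chain R yi Y X" "\<And>n. icls R (Y n) = y n" "\<And>n. icls R (X n) = x n"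
    using idem_chain_ex[of yi y x] yz V x by metis
  obtain Z X' where Z: "idem_chain R zi Z X'" "\<And>n. icls R (Z n) = z n" "\<And>n. icls R (X' n) = x n"
    using idem_chain_ex[of zi z x] yz V x by metis
  obtain S U where S: "idem_chain R si S U" "\<And>n. icls R (S n) = s n" "\<And>n. icls R (U n) = u n"
    using idem_chain_ex[of si s u] si V u by metis
  note oX = idem_chain_orth_seq[OF Y(1)] and oX' = idem_chain_orth_seq[OF Z(1)]
    and oU = idem_chain_orth_seq[OF S(1)]
  \<comment> \<open>The two copies of the sequence x are orthogonal because they lie below the
    orthogonal idempotents yi and zi.\<close>
  have xi: "dl X = dl X'"
  proof (rule dl_cong[OF oX oX'])
    show "ring_orth R (X m) (X' n)" for m n
      by (rule orth_le[OF yz(3) idem_chain_part_le_top[OF Y(1)] idem_chain_part_le_top[OF Z(1)]])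
        (use yz orth_seqD[OF oX] orth_seqD[OF oX'] in \<open>auto simp: ring_idem_def\<close>)
  qed (simp add: Y Z)
  obtain hy where hy: "ring_idem R hy" "icls R yi = dl X \<oplus>\<^sub>V icls R hy"
    "\<And>n. \<exists>k\<in>\<V>. icls R hy \<oplus>\<^sub>V k = y n" using idem_chain_residue[OF Y(1)] Y(2) by metis
  obtain hz where hz: "ring_idem R hz" "icls R zi = dl X' \<oplus>\<^sub>V icls R hz"
    "\<And>n. \<exists>k\<in>\<V>. icls R hz \<oplus>\<^sub>V k = z n" using idem_chain_residue[OF Z(1)] Z(2) by metis
  have sub: "\<exists>p. ring_idem R p \<and> idem_le R p e \<and> icls R p = icls R h"
    if "ring_idem R e" "ring_idem R h" "icls R h \<oplus>\<^sub>V k = icls R e" "k \<in> \<V>" for e h k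
    using icls_split[OF that(1) icls_in[OF that(2)] that(4)] that(3) idem_add_le(1) by metis
  \<comment> \<open>U (2 n) is a copy of y (2 n + 1), and hy lies below every y; so each even part
    of s0 contains a copy of hy. The odd parts contain copies of hz in the same way.\<close>
  have "\<exists>p. ring_idem R p \<and> idem_le R p (U (2 * n)) \<and> icls R p = icls R hy" for n
    using sub[OF orth_seqD(1)[OF oU] hy(1)] hy(3)[of "Suc (2 * n)"] S(3)[of "2 * n"] by (auto
      simp: u_def)
  then obtain p where p: "\<And>n. ring_idem R (p n)" "\<And>n. idem_le R (p n) (U (2 * n))"
    "\<And>n. icls R (p n) = icls R hy" by metis
  have "\<exists>p. ring_idem R p \<and> idem_le R p (U (2 * n + 1)) \<and> icls R p = icls R hz" for n
    using sub[OF orth_seqD(1)[OF oU] hz(1)] hz(3)[of "Suc (2 * n + 1)"] S(3)[of "2 * n + 1"] by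
      (auto simp: u_def)
  then obtain q where q: "\<And>n. ring_idem R (q n)" "\<And>n. idem_le R (q n) (U (2 * n + 1))"
    "\<And>n. icls R (q n) = icls R hz" by metis
  note cl = ring_idem_closed[OF p(1)] ring_idem_closed[OF q(1)] orth_seqD(2)[OF oU]
  have "ring_orth R (p m) (p n)" if "m \<noteq> n" for m n
    by (rule orth_le[OF _ p(2) p(2)]) (use that orth_seqD(4)[OF oU] cl in auto)
  then have op: "orth_seq R p" using p(1) by (simp add: orth_seq_def)
  have "ring_orth R (q m) (q n)" if "m \<noteq> n" for m n
    by (rule orth_le[OF _ q(2) q(2)]) (use that orth_seqD(4)[OF oU] cl in auto)
  then have oq: "orth_seq R q" using q(1) by (simp add: orth_seq_def)
  have opq: "ring_orth R (p m) (q n)" for m n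
  proof (rule orth_le[OF _ p(2) q(2)])
    have "2 * m \<noteq> 2 * n + 1" by presburger
    then show "ring_orth R (U (2 * m)) (U (2 * n + 1))" by (rule orth_seqD(4)[OF oU])
  qed (use cl in auto)
  obtain P where P: "pideal_sup R (range p) P" using pideal_sup_orth[OF op] by metis
  obtain Q where Q: "pideal_sup R (range q) Q" using pideal_sup_orth[OF oq] by metis
  note pq = dcls_sup_union[OF op oq opq P Q]
  define d where "d = dl p \<oplus>\<^sub>V dl q"
  have PQ: "P <+>\<^bsub>R\<^esub> Q \<in> pideals R" using pq(1) by (simp add: pideal_sup_def)
  have d_eq: "d = dcls R (P <+>\<^bsub>R\<^esub> Q)" using pq(2) dl_eq[OF P] dl_eq[OF Q] by (simp add: d_def)
  have in_si: "idem_le R a si \<Longrightarrow> a \<in> carrier R \<Longrightarrow> a \<in> pideal R si" for a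
    using si(1) by (simp add: mem_pideal idem_le_def)
  have "idem_le R (p n) si" "idem_le R (q n) si" for n
    using idem_le_trans[OF p(2) idem_chain_part_le_top[OF S(1)]]
      idem_le_trans[OF q(2) idem_chain_part_le_top[OF S(1)]] cl ring_idem_closed[OF si(1)] by auto
  then have "range p \<union> range q \<subseteq> pideal R si" using in_si cl by auto
  then have "P <+>\<^bsub>R\<^esub> Q \<subseteq> pideal R si"
    using pq(1) pideal_in[OF ring_idem_closed[OF si(1)]] by (simp add: pideal_sup_def)
  \<comment> \<open>The supremum of all these copies stays inside si, so d is a summand of
    s0.\<close>
  then obtain C where C: "C \<in> pideals R" "ideal_dsum R (pideal R si) (P <+>\<^bsub>R\<^esub> Q) C"
    using pideals_compl[OF PQ pideal_in[OF ring_idem_closed[OF si(1)]]] by metis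
  have dC: "d \<oplus>\<^sub>V dcls R C = s0"
    using dcls_dsum[OF PQ C(1) pideal_in[OF ring_idem_closed[OF si(1)]] C(2)] d_eq si(2) init by
      simp
  have ins: "dl p \<in> \<V>" "dl q \<in> \<V>" "dl X \<in> \<V>" "icls R hy \<in> \<V>" "icls R hz \<in> \<V>" "d \<in> \<V>"
    using dl_in op oq oX icls_in hy(1) hz(1) by (auto simp: d_def)
  note idem = dl_even(1)[OF op p(3)] dl_even(1)[OF oq q(3)]
    and absorb = dl_absorb[OF op p(3)] dl_absorb[OF oq q(3)]
  have "d \<oplus>\<^sub>V d = (dl p \<oplus>\<^sub>V dl p) \<oplus>\<^sub>V (dl q \<oplus>\<^sub>V dl q)"
    unfolding d_def using ins by (simp add: V.m_ac)
  then have dd: "d = d \<oplus>\<^sub>V d" using idem by (simp add: d_def)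
  \<comment> \<open>After the common class of X and X' is split off, only the residues differ, and
    each is absorbed by the infinitely many copies of itself in d.\<close>
  have "y0 \<oplus>\<^sub>V d = dl X \<oplus>\<^sub>V ((icls R hy \<oplus>\<^sub>V dl p) \<oplus>\<^sub>V dl q)"
    using hy(2) yz(4) init ins by (simp add: d_def V.m_assoc)
  also have "\<dots> = dl X \<oplus>\<^sub>V (dl p \<oplus>\<^sub>V (icls R hz \<oplus>\<^sub>V dl q))"
    using absorb by simp
  also have "\<dots> = z0 \<oplus>\<^sub>V d"
    using hz(2) yz(5) init ins xi by (simp add: d_def V.m_ac)
  finally have "y0 \<oplus>\<^sub>V d = z0 \<oplus>\<^sub>V d" .
  then show ?thesis unfolding V.separates_def using dd dC ins(6) dcls_in[OF C(1)] by blast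
qed

lemma idem_separative: "idem_separative R"
proof (rule idem_separativeI)
  fix a b t w assume in_V: "a \<in> \<V>" "b \<in> \<V>"
    "t \<in> \<V>" "w \<in> \<V>"
    and eq: "a \<oplus>\<^sub>V t = b \<oplus>\<^sub>V t" "a \<oplus>\<^sub>V t \<oplus>\<^sub>V w = icls R \<one>"
  obtain x y z s where r: "x \<in> \<V>" "y \<in> \<V>"
    "z \<in> \<V>" "s \<in> \<V>" "a = x \<oplus>\<^sub>V y"
    "t = z \<oplus>\<^sub>V s" "b = x \<oplus>\<^sub>V z" "t = y \<oplus>\<^sub>V s"
    using V.refineE[OF in_V(1,3,2,3) eq(1)] .
  \<comment> \<open>Refinement makes the parts independent: y, z, s, x and w together add up to a +
    t + w = [1].\<close>
  have "(y \<oplus>\<^sub>V z) \<oplus>\<^sub>V (s \<oplus>\<^sub>V (x \<oplus>\<^sub>V w)) =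
    (x \<oplus>\<^sub>V y) \<oplus>\<^sub>V (z \<oplus>\<^sub>V s) \<oplus>\<^sub>V w"
    using r(1-4) in_V(4) by (simp add: V.m_ac)
  also have "\<dots> = icls R \<one>" using eq(2) r(5,6) by simp
  finally have "V.separates y z s"
    using separates_independent[OF r(2,3,4), of "x \<oplus>\<^sub>V w"] r in_V by simp
  then have "V.separates (x \<oplus>\<^sub>V y) (x \<oplus>\<^sub>V z) (z \<oplus>\<^sub>V s)"
    using V.separates_weaken r by blast
  then show "V.separates a b t" using r(5-7) by simp
qed

end

theorem idem_separative_continuous:
  assumes "aleph0_left_continuous R \<or> aleph0_right_continuous R"
  shows "idem_separative R"
proof -
  have right: "idem_separative R" if "aleph0_right_continuous R" for R :: "('a, 'b) ring_scheme"
  proof -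
    interpret right_continuous R
      using that by (simp add: right_continuous_def right_continuous_axioms_def
        aleph0_right_continuous_def regular_iff)
    show ?thesis by (rule idem_separative)
  qed
  moreover have "aleph0_right_continuous (op_ring R)" if "aleph0_left_continuous R"
    using that regular.regular_op[of R]
    by (simp add: aleph0_right_continuous_def aleph0_left_continuous_def regular_iff
      left_ideal_lattice_eq)
  ultimately show ?thesis using assms idem_separative_op by blast
qed

section \<open>Perspectivity\<close>

context ring
begin

lemma set_add_comm:
  assumes "X \<subseteq> carrier R" "Y \<subseteq> carrier R" shows "X <+>\<^bsub>R\<^esub> Y = Y <+>\<^bsub>R\<^esub> X"
proof -
  have "A <+>\<^bsub>R\<^esub> B \<subseteq> B <+>\<^bsub>R\<^esub> A" if AB: "A \<subseteq> carrier R" "B \<subseteq> carrier R" for A B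
  proof
    fix x assume "x \<in> A <+>\<^bsub>R\<^esub> B"
    then obtain a b where "a \<in> A" "b \<in> B" "x = a \<oplus> b" by (auto simp: mem_set_add)
    moreover from this have "a \<oplus> b = b \<oplus> a" using AB by (auto intro: a_comm)
    ultimately show "x \<in> B <+>\<^bsub>R\<^esub> A" unfolding mem_set_add by blast
  qed
  then show ?thesis using assms by blast
qed

lemma ideal_dsum_comm:
  assumes "X \<in> pideals R" "Y \<in> pideals R"
  shows "ideal_dsum R Z X Y \<longleftrightarrow> ideal_dsum R Z Y X"
  unfolding ideal_dsum_def set_add_comm[OF assms[THEN pideal_subset]] by (simp add: Int_commute)

lemma ideal_dsumI:
  assumes "X \<in> pideals R" "Y \<in> pideals R" "Z \<in> pideals R" "X \<subseteq> Z" "Y \<subseteq> Z"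
    "\<And>x. x \<in> X \<Longrightarrow> x \<in> Y \<Longrightarrow> x = \<zero>" "Z \<subseteq> X <+>\<^bsub>R\<^esub> Y"
  shows "ideal_dsum R Z X Y"
  unfolding ideal_dsum_def
proof
  show "X \<inter> Y = {\<zero>}" using pideal_zero[OF assms(1)] pideal_zero[OF assms(2)] assms(6) by blast
  show "X <+>\<^bsub>R\<^esub> Y = Z" using pideal_sum_least[OF assms(3-5)] assms(7) by blast
qed

lemma ideal_dsumD:
  assumes "ideal_dsum R Z X Y" "X \<in> pideals R" "Y \<in> pideals R"
  shows "X \<subseteq> Z" "Y \<subseteq> Z" "x \<in> X \<Longrightarrow> x \<in> Y \<Longrightarrow> x = \<zero>"
    "Z = X <+>\<^bsub>R\<^esub> Y"
  using assms(1) pideal_sum_upper[OF assms(2,3)] unfolding ideal_dsum_def by blast+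

text \<open>With v implementing the equivalence from e R to f R, the graph idempotent g = e - v
  generates the required axis. The idempotent h is a common part carried along unchanged.\<close>

lemma perspective_idems:
  assumes i: "ring_idem R e" "ring_idem R f" "ring_idem R h"
    and o: "ring_orth R e f" "ring_orth R e h" "ring_orth R f h" and eq: "idem_equiv R e f"
  shows "ideal_perspective R (pideal R (e \<oplus> h)) (pideal R (f \<oplus> h))"
proof -
  note c = i[THEN ring_idem_closed]
  obtain w v where wv: "w \<in> carrier R" "v \<in> carrier R" "w \<otimes> v = e" "v \<otimes> w = f"
    "f \<otimes> v = v" "v \<otimes> e = v"
    using idem_equiv_normalize[OF eq i(1,2)] by metis
  have z: "e \<otimes> e = e" "f \<otimes> f = f" "h \<otimes> h = h" "e \<otimes> f = \<zero>" "f \<otimes> e = \<zero>" "e \<otimes> h = \<zero>"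
    "h \<otimes> e = \<zero>" "f \<otimes> h = \<zero>" "h \<otimes> f = \<zero>" using i o by (auto simp: ring_idem_def ring_orth_def)
  have ev: "e \<otimes> v = \<zero>" using assoc_eq[OF z(4) c(1,2) wv(2)] wv by simp
  have vv: "v \<otimes> v = \<zero>" using m_assoc[OF wv(2) c(1) wv(2)] wv ev by simp
  define g where "g = e \<ominus> v"
  have g: "g \<in> carrier R" "g \<otimes> g = g" "e \<otimes> g = e" "f \<otimes> g = \<ominus> v"
    using c wv(1,2,5,6) z ev vv by (simp_all add: g_def ring_expand minus_zero_right) (simp add:
      minus_eq)
  have gi: "ring_idem R g" using g by (simp add: ring_idem_def)
  note eh = idem_add_orth[OF i(1,3) o(2)] and fh = idem_add_orth[OF i(2,3) o(3)]
  note P = pideal_in[OF ring_idem_closed[OF eh]] pideal_in[OF ring_idem_closed[OF fh]]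
    pideal_in[OF g(1)]
  have 1: "r = \<zero>" if "r \<in> pideal R (e \<oplus> h)" "r \<in> pideal R g" for r
  proof -
    have r: "r \<in> carrier R" "(e \<oplus> h) \<otimes> r = r" "g \<otimes> r = r" using that eh gi by (auto simp:
      mem_pideal)
    have "f \<otimes> (e \<oplus> h) = \<zero>" using c z by (simp add: r_distr)
    then have "f \<otimes> r = \<zero>" using assoc_eq[of f "e \<oplus> h" \<zero> r] c r by simp
    moreover have "f \<otimes> r = \<ominus> v \<otimes> r" using assoc_eq[OF g(4) c(2) g(1) r(1)] r(3) by simp
    ultimately have "\<ominus> (v \<otimes> r) = \<zero>" using wv(2) r(1) by (simp add: l_minus)
    then have vr: "v \<otimes> r = \<zero>" using minus_minus[of "v \<otimes> r"] wv(2) r(1) by simp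
    then have "e \<otimes> r = \<zero>" using assoc_eq[OF wv(3,1,2) r(1)] wv(1) by simp
    then show ?thesis using r(3) vr c wv(2) r(1) by (simp add: g_def minus_distl)
  qed
  have 2: "r = \<zero>" if "r \<in> pideal R (f \<oplus> h)" "r \<in> pideal R g" for r
  proof -
    have r: "r \<in> carrier R" "(f \<oplus> h) \<otimes> r = r" "g \<otimes> r = r" using that fh gi by (auto simp:
      mem_pideal)
    have "e \<otimes> (f \<oplus> h) = \<zero>" using c z by (simp add: r_distr)
    then have er: "e \<otimes> r = \<zero>" using assoc_eq[of e "f \<oplus> h" \<zero> r] c r by simp
    then have "v \<otimes> r = \<zero>" using assoc_eq[OF wv(6) wv(2) c(1) r(1)] wv(2) by simp
    then show ?thesis using r(3) er c wv(2) r(1) by (simp add: g_def minus_distl)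
  qed
  have mem: "e \<in> pideal R (e \<oplus> h)" "h \<in> pideal R (e \<oplus> h)" "f \<in> pideal R (f \<oplus> h)"
    "h \<in> pideal R (f \<oplus> h)"
    using eh fh c z by (simp_all add: mem_pideal l_distr)
  \<comment> \<open>The sums with g R agree because e + h = (v + h) + g and f + h = (e w + h) - g
    w.\<close>
  have "v \<in> pideal R (f \<oplus> h)" using pideal_mult[OF P(2) mem(3) wv(2)] wv(5) by simp
  moreover have "e \<oplus> h = (v \<oplus> h) \<oplus> g"
    using c wv(2) by (simp add: g_def minus_eq a_ac) (simp add: a_assoc[symmetric] r_neg a_comm)
  ultimately have A: "\<exists>x\<in>pideal R (f \<oplus> h). e \<oplus> h = x \<oplus> g" using pideal_add[OF P(2)] mem(4) by blast
  have "f \<oplus> h = (e \<otimes> w \<oplus> h) \<oplus> g \<otimes> (\<ominus> w)"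
  proof -
    have "g \<otimes> (\<ominus> w) = \<ominus> (e \<otimes> w) \<oplus> f"
      using c wv by (simp add: g_def minus_eq r_minus l_distr l_minus minus_add)
    then show ?thesis using c wv(1,2)
      by (simp add: a_ac) (simp add: a_assoc[symmetric] r_neg a_comm)
  qed
  moreover have "e \<otimes> w \<oplus> h \<in> pideal R (e \<oplus> h)"
    using pideal_add[OF P(1) pideal_mult[OF P(1) mem(1) wv(1)] mem(2)] .
  moreover have "g \<otimes> (\<ominus> w) \<in> pideal R g" using pideal_mult[OF P(3) pideal_self[OF g(1)]] wv(1) by
    simp
  ultimately have B: "\<exists>x\<in>pideal R (e \<oplus> h). \<exists>y\<in>pideal R g. f \<oplus> h = x \<oplus> y" by blast
  show ?thesis
    unfolding ideal_perspective_def
  proof (rule bexI[OF _ P(3)], rule conjI)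
    show "pideal R (e \<oplus> h) \<inter> pideal R g = pideal R (f \<oplus> h) \<inter> pideal R g"
      using 1 2 pideal_zero[OF P(1)] pideal_zero[OF P(2)] by blast
    show "pideal R (e \<oplus> h) <+>\<^bsub>R\<^esub> pideal R g = pideal R (f \<oplus> h) <+>\<^bsub>R\<^esub> pideal R g"
    proof (rule equalityI; rule subsetI)
      fix x assume "x \<in> pideal R (e \<oplus> h) <+>\<^bsub>R\<^esub> pideal R g"
      then obtain r s where rs: "r \<in> carrier R" "s \<in> carrier R" "x = (e \<oplus> h) \<otimes> r \<oplus> g \<otimes> s"
        by (auto simp: mem_set_add pideal_def)
      obtain y where y: "y \<in> pideal R (f \<oplus> h)" "e \<oplus> h = y \<oplus> g" using A by blast
      have yc: "y \<in> carrier R" using y(1) pideal_subset[OF P(2)] by blast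
      have "x = y \<otimes> r \<oplus> g \<otimes> (r \<oplus> s)" unfolding rs(3) y(2) using rs(1,2) yc g(1)
        by (simp add: ring_expand a_assoc)
      then show "x \<in> pideal R (f \<oplus> h) <+>\<^bsub>R\<^esub> pideal R g"
        unfolding mem_set_add using pideal_mult[OF P(2) y(1) rs(1)]
          pideal_mult[OF P(3) pideal_self[OF g(1)], of "r \<oplus> s"] rs(1,2) by blast
    next
      fix x assume "x \<in> pideal R (f \<oplus> h) <+>\<^bsub>R\<^esub> pideal R g"
      then obtain r s where rs: "r \<in> carrier R" "s \<in> pideal R g" "x = (f \<oplus> h) \<otimes> r \<oplus> s"
        by (auto simp: mem_set_add pideal_def[of R "f \<oplus> h"])
      obtain y t where y: "y \<in> pideal R (e \<oplus> h)" "t \<in> pideal R g" "f \<oplus> h = y \<oplus> t" using B by blast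
      have yc: "y \<in> carrier R" "t \<in> carrier R" "s \<in> carrier R"
        using y(1,2) rs(2) pideal_subset[OF P(1)] pideal_subset[OF P(3)] by blast+
      have "x = y \<otimes> r \<oplus> (t \<otimes> r \<oplus> s)" unfolding rs(3) y(3) using rs(1) yc
        by (simp add: ring_expand a_assoc)
      then show "x \<in> pideal R (e \<oplus> h) <+>\<^bsub>R\<^esub> pideal R g"
        unfolding mem_set_add using pideal_mult[OF P(1) y(1) rs(1)]
          pideal_add[OF P(3) pideal_mult[OF P(3) y(2) rs(1)] rs(2)] by blast
    qed
  qed
qed

end

section \<open>Perspectivity and isomorphism in regular rings\<close>

context regular
begin

lemma dcls_eq_iff:
  assumes "X \<in> pideals R" "Y \<in> pideals R"
  shows "dcls R X = dcls R Y \<longleftrightarrow> rmod_isomorphic R (right_ideal_module R X) (right_ideal_module R Y)"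
proof -
  have "fg_projective R (right_ideal_module R X)" "fg_projective R (right_ideal_module R Y)"
    using pideals_idem assms fg_projective_idem by metis+
  then show ?thesis by (rule iso_class_eq_iff)
qed

text \<open>The axis T may meet J and K. A complement T' of J \<inter> T = K \<inter> T in T is
  disjoint from both and is a common complement in J + T = K + T.\<close>

lemma dcls_perspective:
  assumes J: "J \<in> pideals R" and K: "K \<in> pideals R" and "ideal_perspective R J K"
  shows "dcls R J = dcls R K"
proof -
  obtain T where T: "T \<in> pideals R" "J \<inter> T = K \<inter> T" "J <+>\<^bsub>R\<^esub> T = K <+>\<^bsub>R\<^esub> T"
    using assms by (auto simp: ideal_perspective_def)
  note JT = pideals_Int[OF J T(1)]
  obtain T' where T': "T' \<in> pideals R" "ideal_dsum R T (J \<inter> T) T'"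
    using pideals_compl[OF JT T(1)] by auto
  note d = ideal_dsumD[OF T'(2) JT T'(1)]
  have main: "ideal_dsum R (X <+>\<^bsub>R\<^esub> T) X T'" if X: "X \<in> pideals R" "X \<inter> T = J \<inter> T" for X
  proof (rule ideal_dsumI[OF X(1) T'(1) pideals_sum[OF X(1) T(1)]])
    note u = pideal_sum_upper[OF X(1) T(1)] and u' = pideal_sum_upper[OF X(1) T'(1)]
    show "X \<subseteq> X <+>\<^bsub>R\<^esub> T" "T' \<subseteq> X <+>\<^bsub>R\<^esub> T" using u d(2) by auto
    show "x = \<zero>" if "x \<in> X" "x \<in> T'" for x using that d X(2) by blast
    note s' = pideals_sum[OF X(1) T'(1)]
    have "J \<inter> T <+>\<^bsub>R\<^esub> T' \<subseteq> X <+>\<^bsub>R\<^esub> T'"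
      using u' X(2) by (intro pideal_sum_least[OF s']) auto
    then have "T \<subseteq> X <+>\<^bsub>R\<^esub> T'" using d(4) by (rule ord_eq_le_trans[rotated])
    then show "X <+>\<^bsub>R\<^esub> T \<subseteq> X <+>\<^bsub>R\<^esub> T'" by (rule pideal_sum_least[OF s' u'(1)])
  qed
  show ?thesis
    using dcls_common_compl[OF J K T'(1) pideals_sum[OF J T(1)]] main[OF J] main[OF K] T(2,3) by
      simp
qed

end

locale separative_regular = regular +
  assumes separative: "idem_separative R"
begin

lemma separates_V:
  assumes "a \<in> \<V>" "b \<in> \<V>" "c \<in> \<V>"
    "a \<oplus>\<^sub>V c = b \<oplus>\<^sub>V c"
  obtains d z where "d \<in> \<V>" "z \<in> \<V>"
    "d = d \<oplus>\<^sub>V d" "d \<oplus>\<^sub>V z = c" "a \<oplus>\<^sub>V d = b \<oplus>\<^sub>V d"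
proof -
  have "V.separates a b c"
    using separative_at_if_idem_separative[OF separative assms(3)] assms
    unfolding V.separative_at_def by blast
  then show thesis using that unfolding V.separates_def by blast
qed

lemma perspective_decomposition:
  assumes J: "J \<in> pideals R" and K: "K \<in> pideals R" and eq: "dcls R J = dcls R K"
  obtains J0 J1 K0 K1 where "J0 \<in> pideals R" "J1 \<in> pideals R" "K0 \<in> pideals R" "K1 \<in> pideals R"
    "ideal_dsum R J J0 J1" "ideal_dsum R K K0 K1"
    "ideal_perspective R J0 K0" "ideal_perspective R J1 K1"
proof -
  note M = pideals_Int[OF J K]
  obtain K' where K': "K' \<in> pideals R" "ideal_dsum R K (J \<inter> K) K'"
    using pideals_compl[OF M K] by auto
  obtain J' where J': "J' \<in> pideals R" "ideal_dsum R J (J \<inter> K) J'"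
    using pideals_compl[OF M J] by auto
  note dK = ideal_dsumD[OF K'(2) M K'(1)]
  note JK = pideals_sum[OF J K] and u = pideal_sum_upper[OF J K] and u' = pideal_sum_upper[OF J
    K'(1)]
  \<comment> \<open>K' is also a complement of J in J + K. Hence the idempotents m, j, k belonging
    to J \<inter> K, J', K' can be chosen pairwise orthogonal, as \<open>perspective_idems\<close>
    requires.\<close>
  have "ideal_dsum R (J <+>\<^bsub>R\<^esub> K) J K'"
  proof (rule ideal_dsumI[OF J K'(1) JK])
    show "J \<subseteq> J <+>\<^bsub>R\<^esub> K" "K' \<subseteq> J <+>\<^bsub>R\<^esub> K" using u dK(2) by auto
    show "x = \<zero>" if "x \<in> J" "x \<in> K'" for x using that dK by blast
    note s' = pideals_sum[OF J K'(1)]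
    have "J \<inter> K <+>\<^bsub>R\<^esub> K' \<subseteq> J <+>\<^bsub>R\<^esub> K'"
      using u' by (intro pideal_sum_least[OF s']) auto
    then have "K \<subseteq> J <+>\<^bsub>R\<^esub> K'" using dK(4) by (rule ord_eq_le_trans[rotated])
    then show "J <+>\<^bsub>R\<^esub> K \<subseteq> J <+>\<^bsub>R\<^esub> K'" by (rule pideal_sum_least[OF s' u'(1)])
  qed
  moreover obtain g where g: "ring_idem R g" "J <+>\<^bsub>R\<^esub> K = pideal R g" using pideals_idem[OF JK] by
    metis
  ultimately obtain a k where ak: "ring_idem R a" "ring_idem R k" "ring_orth R a k" "g = a \<oplus> k"
    "J = pideal R a" "K' = pideal R k" using ideal_dsum_idems[OF g(1) J K'(1)] by metis
  obtain m j where mj: "ring_idem R m" "ring_idem R j" "ring_orth R m j" "a = m \<oplus> j"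
    "J \<inter> K = pideal R m" "J' = pideal R j"
    using ideal_dsum_idems[OF ak(1) M J'(1)] J'(2) ak(5) by metis
  have le: "idem_le R m a" "idem_le R j a" using idem_add_le[OF mj(1-3)] mj(4) by auto
  note c = mj(1,2)[THEN ring_idem_closed] ak(1,2)[THEN ring_idem_closed]
  have mk: "ring_orth R m k" and jk: "ring_orth R j k"
    using orth_le_left[OF ak(3)] le c by auto
  have Kmk: "K = pideal R (m \<oplus> k)"
    using pideal_sum_orth[OF mj(1) ak(2) mk] dK(4) mj(5) ak(6) by (simp add: ideal_dsum_def)
  have "icls R j \<oplus>\<^sub>V icls R m = icls R k \<oplus>\<^sub>V icls R m"
  proof -
    have "icls R m \<oplus>\<^sub>V icls R j = icls R m \<oplus>\<^sub>V icls R k"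
      using icls_add[OF mj(1-3)] icls_add[OF mj(1) ak(2) mk] eq[unfolded ak(5) Kmk mj(4)] by simp
    then show ?thesis using V.m_comm icls_in[OF mj(1)] icls_in[OF mj(2)] icls_in[OF ak(2)] by metis
  qed
  then obtain d z where d: "d \<in> \<V>" "z \<in> \<V>"
    "d = d \<oplus>\<^sub>V d" "d \<oplus>\<^sub>V z = icls R m"
    "icls R j \<oplus>\<^sub>V d = icls R k \<oplus>\<^sub>V d"
    by (rule separates_V[OF icls_in[OF mj(2)] icls_in[OF ak(2)] icls_in[OF mj(1)]])
  \<comment> \<open>Doubling d inside [m] makes room for two orthogonal copies of d in the
    intersection, one for each side.\<close>
  have "icls R m = d \<oplus>\<^sub>V (d \<oplus>\<^sub>V z)"
    using d(4) V.m_assoc[OF d(1,1,2)] d(3) by simp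
  then obtain d1 m0 where d1: "ring_idem R d1" "ring_idem R m0" "ring_orth R d1 m0" "m = d1 \<oplus> m0"
    "icls R d1 = d" "icls R m0 = d \<oplus>\<^sub>V z"
    using icls_split[OF mj(1) d(1) V.m_closed[OF d(1,2)]] by metis
  obtain d2 z2 where d2: "ring_idem R d2" "ring_idem R z2" "ring_orth R d2 z2" "m0 = d2 \<oplus> z2"
    "icls R d2 = d" using icls_split[OF d1(2) d(1,2) d1(6)] by metis
  note cc = d1(1,2)[THEN ring_idem_closed] d2(1,2)[THEN ring_idem_closed]
  have le1: "idem_le R d1 m" "idem_le R m0 m" using idem_add_le[OF d1(1-3)] d1(4) by auto
  have le2: "idem_le R d2 m0" "idem_le R z2 m0" using idem_add_le[OF d2(1-3)] d2(4) by auto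
  have le3: "idem_le R d2 m" "idem_le R z2 m" using idem_le_trans[OF _ le1(2)] le2 cc c by auto
  have o: "ring_orth R d1 d2" "ring_orth R d1 z2" "ring_orth R d1 j" "ring_orth R d2 j"
    "ring_orth R z2 j" "ring_orth R d1 k" "ring_orth R d2 k" "ring_orth R z2 k"
    using orth_le[OF d1(3) idem_le_refl[OF d1(1)]] orth_le_left[OF mj(3)] orth_le_left[OF mk] le1
      le2 le3 cc c
    by auto
  note o' = o[THEN ring_orth_sym]
  have oj: "ring_orth R j d1" and ok: "ring_orth R k d2" using o' by auto
  have o1: "ring_orth R (j \<oplus> d1) (d2 \<oplus> z2)"
    using orth_add(1)[OF orth_add(2)[OF o(4,5)]
      orth_add(2)[OF o'(1,2)]] cc c by auto
  have o2: "ring_orth R (k \<oplus> d2) (d1 \<oplus> z2)"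
    using orth_add(1)[OF orth_add(2)[OF o(6,8)] orth_add(2)[OF o(1) ring_orth_sym[OF d2(3)]]] cc c
      by auto
  have o3: "ring_orth R (j \<oplus> d1) (k \<oplus> d2)"
    using orth_add(1)[OF orth_add(2)[OF ring_orth_sym[OF jk] o(4)] orth_add(2)[OF o'(6) o'(1)]] cc
      c by auto
  note i = idem_add_orth[OF mj(2) d1(1) oj] idem_add_orth[OF d2(1-3)]
    idem_add_orth[OF ak(2) d2(1) ok] idem_add_orth[OF d1(1) d2(2) o(2)]
  note ic = i[THEN ring_idem_closed]
  show thesis
  proof (rule that[OF ic[THEN pideal_in]])
    have "(j \<oplus> d1) \<oplus> (d2 \<oplus> z2) = a" unfolding mj(4) d1(4) d2(4) using cc c by (simp add: a_ac)
    then show "ideal_dsum R J (pideal R (j \<oplus> d1)) (pideal R (d2 \<oplus> z2))"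
      using pideal_sum_orth[OF i(1,2) o1] ak(5) by simp
    have "(k \<oplus> d2) \<oplus> (d1 \<oplus> z2) = m \<oplus> k" unfolding d1(4) d2(4) using cc c by (simp add: a_ac)
    then show "ideal_dsum R K (pideal R (k \<oplus> d2)) (pideal R (d1 \<oplus> z2))"
      using pideal_sum_orth[OF i(3,4) o2] Kmk by simp
    have "icls R (j \<oplus> d1) = icls R (k \<oplus> d2)"
      using icls_add[OF mj(2) d1(1) oj] icls_add[OF ak(2) d2(1) ok] d(5) d1(5) d2(5) by simp
    then have "idem_equiv R (j \<oplus> d1) (k \<oplus> d2)" using icls_eq_iff i by blast
    \<comment> \<open>These two ideals are generated by orthogonal idempotents, so the common part
      is zero; for the second pair, where d2 and d1 are exchanged, it is z2.\<close>
    then show "ideal_perspective R (pideal R (j \<oplus> d1)) (pideal R (k \<oplus> d2))"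
      using perspective_idems[OF i(1,3) idem_zero o3] ic by (simp add: ring_orth_def)
    have "idem_equiv R d2 d1" using icls_eq_iff[OF d2(1) d1(1)] d1(5) d2(5) by simp
    then show "ideal_perspective R (pideal R (d2 \<oplus> z2)) (pideal R (d1 \<oplus> z2))"
      using perspective_idems[OF d2(1) d1(1) d2(2) o'(1) d2(3) o(2)] by blast
  qed
qed

text \<open>For e = x y and f = y x, separativity makes [1 - e] and [1 - f] agree up to some d = 2 d
  \<le> [e]. Direct finiteness forces d = 0, and an equivalence r, s of 1 - e and 1 - f completes x
  and y to the mutually inverse units x + r and y + s.\<close>

lemma unit_regular:
  assumes "directly_finite R" shows "unit_regular_ring R"
  unfolding unit_regular_ring_def
proof (intro conjI ballI)
  show "ring R" ..
  fix x assume x: "x \<in> carrier R"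
  obtain y0 where y0: "y0 \<in> carrier R" "x \<otimes> y0 \<otimes> x = x" using regular x by blast
  \<comment> \<open>This choice also satisfies y x y = y, which puts y into f R e.\<close>
  define y where "y = y0 \<otimes> x \<otimes> y0"
  have xyx: "x \<otimes> (y0 \<otimes> x) = x" using y0 x by (simp add: m_assoc)
  have xy0: "x \<otimes> (y0 \<otimes> (x \<otimes> z)) = x \<otimes> z" if "z \<in> carrier R" for z
    using assoc_eq[OF xyx x _ that] y0(1) x that by (simp add: m_assoc)
  have y: "y \<in> carrier R" "x \<otimes> y \<otimes> x = x" "y \<otimes> x \<otimes> y = y"
    using x y0(1) xy0 xyx by (simp_all add: y_def m_assoc)
  define e where "e = x \<otimes> y"
  define f where "f = y \<otimes> x"
  have e: "ring_idem R e" and f: "ring_idem R f"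
    using x y by (simp_all add: ring_idem_def e_def f_def) (simp_all flip: m_assoc)
  note c = e[THEN ring_idem_closed] f[THEN ring_idem_closed]
  have xf: "x \<otimes> f = x" "f \<otimes> y = y" using x y by (simp_all add: f_def m_assoc)
  have "idem_equiv R e f" unfolding idem_equiv_def e_def f_def using x y by blast
  then have ef: "icls R e = icls R f" using icls_eq_iff[OF e f] by simp
  note e1 = idem_minus[OF idem_one e idem_le_one[OF c(1)]]
  note f1 = idem_minus[OF idem_one f idem_le_one[OF c(2)]]
  let ?a = "icls R (\<one> \<ominus> e)" and ?b = "icls R (\<one> \<ominus> f)"
  have sum: "icls R \<one> = icls R e \<oplus>\<^sub>V ?a" "icls R \<one> = icls R e \<oplus>\<^sub>V ?b"
    using icls_minus[OF idem_one e idem_le_one[OF c(1)]] icls_minus[OF idem_one f idem_le_one[OF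
      c(2)]] ef
    by auto
  have "?a \<oplus>\<^sub>V icls R e = ?b \<oplus>\<^sub>V icls R e"
    using sum icls_in[OF e1(1)] icls_in[OF f1(1)] icls_in[OF e] by (metis V.m_comm)
  then obtain d z where d: "d \<in> \<V>" "z \<in> \<V>"
    "d = d \<oplus>\<^sub>V d" "d \<oplus>\<^sub>V z = icls R e" "?a \<oplus>\<^sub>V d = ?b \<oplus>\<^sub>V d"
    by (rule separates_V[OF icls_in[OF e1(1)] icls_in[OF f1(1)] icls_in[OF e]])
  \<comment> \<open>From d = 2 d and d \<le> [1] the unit class absorbs d. So 1 = p + q with p ~ 1
    and [q] = d, and direct finiteness applied to p ~ 1 gives p = 1.\<close>
  have "icls R \<one> = d \<oplus>\<^sub>V d \<oplus>\<^sub>V z \<oplus>\<^sub>V ?a"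
    using sum(1) d(4) d(3) by metis
  also have "\<dots> = d \<oplus>\<^sub>V (d \<oplus>\<^sub>V z \<oplus>\<^sub>V ?a)"
    using d(1,2) icls_in[OF e1(1)] by (simp add: V.m_assoc)
  also have "\<dots> = d \<oplus>\<^sub>V icls R \<one>" using sum(1) d(4) by simp
  finally have "icls R \<one> = icls R \<one> \<oplus>\<^sub>V d"
    using d(1) icls_in[OF idem_one] by (simp add: V.m_comm)
  then obtain p q where pq: "ring_idem R p" "ring_idem R q" "ring_orth R p q" "\<one> = p \<oplus> q"
    "icls R p = icls R \<one>" "icls R q = d"
    using icls_split[OF idem_one icls_in[OF idem_one] d(1)] by metis
  note cpq = pq(1,2)[THEN ring_idem_closed]
  have "idem_equiv R \<one> p" using icls_eq_iff[OF idem_one pq(1)] pq(5) by simp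
  then obtain u v where "u \<in> carrier R" "v \<in> carrier R" "u \<otimes> v = \<one>" "v \<otimes> u = p"
    by (auto simp: idem_equiv_def)
  then have "p = \<one>" using assms unfolding directly_finite_def by metis
  then have "q = \<zero>" using pq(3) cpq by (simp add: ring_orth_def)
  then have d1: "d = \<one>\<^bsub>V_monoid R\<^esub>" using pq(6) icls_zero by simp
  then have "?a = ?b" using d(5) icls_in[OF e1(1)] icls_in[OF f1(1)] by simp
  then have "idem_equiv R (\<one> \<ominus> e) (\<one> \<ominus> f)" using icls_eq_iff[OF e1(1) f1(1)] by simp
  then obtain r s where rs: "r \<in> carrier R" "s \<in> carrier R" "r \<otimes> s = \<one> \<ominus> e" "s \<otimes> r = \<one> \<ominus> f"
    "(\<one> \<ominus> e) \<otimes> r = r" "r \<otimes> (\<one> \<ominus> f) = r" "(\<one> \<ominus> f) \<otimes> s = s" "s \<otimes> (\<one> \<ominus> e) = s"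
    using idem_equiv_normalize[OF _ e1(1) f1(1)] by metis
  have z: "e \<otimes> (\<one> \<ominus> e) = \<zero>" "(\<one> \<ominus> e) \<otimes> e = \<zero>" "f \<otimes> (\<one> \<ominus> f) = \<zero>" "(\<one> \<ominus> f) \<otimes> f = \<zero>"
    using e1(2) f1(2) by (simp_all add: ring_orth_def)
  have ex: "e \<otimes> x = x" "y \<otimes> e = y" using x y by (simp_all add: e_def flip: m_assoc)
  \<comment> \<open>x and y live in the corners e R f and f R e, r and s in the complementary
    corners, so the mixed products vanish.\<close>
  have zero: "x \<otimes> s = \<zero>" "r \<otimes> y = \<zero>" "y \<otimes> r = \<zero>" "s \<otimes> x = \<zero>"
  proof -
    have "x \<otimes> s = x \<otimes> f \<otimes> ((\<one> \<ominus> f) \<otimes> s)" using xf rs by simp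
    also have "\<dots> = x \<otimes> (f \<otimes> (\<one> \<ominus> f)) \<otimes> s" using x c rs(1,2) by (simp add: m_assoc del: z)
    finally show "x \<otimes> s = \<zero>" using z x rs by simp
    have "r \<otimes> y = r \<otimes> (\<one> \<ominus> f) \<otimes> (f \<otimes> y)" using xf rs by simp
    also have "\<dots> = r \<otimes> ((\<one> \<ominus> f) \<otimes> f) \<otimes> y" using y c rs(1,2) by (simp add: m_assoc del: z)
    finally show "r \<otimes> y = \<zero>" using z y rs by simp
    have "y \<otimes> r = y \<otimes> e \<otimes> ((\<one> \<ominus> e) \<otimes> r)" using ex rs by simp
    also have "\<dots> = y \<otimes> (e \<otimes> (\<one> \<ominus> e)) \<otimes> r" using y c rs(1,2) by (simp add: m_assoc del: z)
    finally show "y \<otimes> r = \<zero>" using z y rs by simp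
    have "s \<otimes> x = s \<otimes> (\<one> \<ominus> e) \<otimes> (e \<otimes> x)" using ex rs by simp
    also have "\<dots> = s \<otimes> ((\<one> \<ominus> e) \<otimes> e) \<otimes> x" using x c rs(1,2) by (simp add: m_assoc del: z)
    finally show "s \<otimes> x = \<zero>" using z x rs by simp
  qed
  have "(x \<oplus> r) \<otimes> (y \<oplus> s) = e \<oplus> (\<one> \<ominus> e)"
    using x y(1) rs(1-3) zero c(1) by (simp add: ring_expand e_def[symmetric])
  then have 1: "(x \<oplus> r) \<otimes> (y \<oplus> s) = \<one>" using c by (simp add: minus_add_cancel)
  have "(y \<oplus> s) \<otimes> (x \<oplus> r) = f \<oplus> (\<one> \<ominus> f)"
    using x y(1) rs(1,2,4) zero c(2) by (simp add: ring_expand f_def[symmetric])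
  then have 2: "(y \<oplus> s) \<otimes> (x \<oplus> r) = \<one>" using c by (simp add: minus_add_cancel)
  have "y \<oplus> s \<in> Units R" unfolding Units_def using 1 2 x y(1) rs(1,2) by blast
  moreover have "x \<otimes> (y \<oplus> s) \<otimes> x = x" using x y zero rs(1,2) by (simp add: ring_expand)
  ultimately show "\<exists>u\<in>Units R. x \<otimes> u \<otimes> x = x" by blast
qed

end

section \<open>The dimension monoid\<close>

context regular
begin

abbreviation L where "L \<equiv> right_ideal_lattice R"

text \<open>Relative complements compose: a complement of A in B together with one of B in C forms a
  complement of A in C. This is relation (D1) for the classes of relative complements.\<close>

lemma ideal_dsum_assoc:
  assumes "A \<in> pideals R" "C1 \<in> pideals R" "C2 \<in> pideals R" "B \<in> pideals R" "C \<in> pideals R"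
    "ideal_dsum R B A C1" "ideal_dsum R C B C2"
  shows "ideal_dsum R (C1 <+>\<^bsub>R\<^esub> C2) C1 C2" "ideal_dsum R C A (C1 <+>\<^bsub>R\<^esub> C2)"
proof -
  note d1 = ideal_dsumD[OF assms(6,1,2)] and d2 = ideal_dsumD[OF assms(7,4,3)]
  note S = pideals_sum[OF assms(2,3)] and u = pideal_sum_upper[OF assms(2,3)]
  show "ideal_dsum R (C1 <+>\<^bsub>R\<^esub> C2) C1 C2"
    by (rule ideal_dsumI[OF assms(2,3) S u]) (use d1 d2 in blast)+
  show "ideal_dsum R C A (C1 <+>\<^bsub>R\<^esub> C2)"
  proof (rule ideal_dsumI[OF assms(1) S assms(5)])
    show "A \<subseteq> C" using d1 d2 by blast
    show "C1 <+>\<^bsub>R\<^esub> C2 \<subseteq> C" using d1 d2 by (intro pideal_sum_least[OF assms(5)]) blast+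
    show "x = \<zero>" if x: "x \<in> A" "x \<in> C1 <+>\<^bsub>R\<^esub> C2" for x
    proof -
      obtain y z where yz: "y \<in> C1" "z \<in> C2" "x = y \<oplus> z" using x by (auto simp: mem_set_add)
      have c: "y \<in> carrier R" "z \<in> carrier R" using yz pideal_subset assms by blast+
      have "x \<in> B" "y \<in> B" using x d1 yz by auto
      then have "x \<ominus> y \<in> B" using pideal_diff[OF assms(4)] by blast
      then have "z \<in> B" using yz c by (simp add: add_minus_cancel)
      then have "z = \<zero>" using d2 yz by blast
      then have "x = y" using yz c by simp
      then show ?thesis using d1(3) x yz by blast
    qed
    note AC = pideals_sum[OF assms(1) S] and v = pideal_sum_upper[OF assms(1) S]
    have "A <+>\<^bsub>R\<^esub> C1 \<subseteq> A <+>\<^bsub>R\<^esub> (C1 <+>\<^bsub>R\<^esub> C2)"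
      using u v by (intro pideal_sum_least[OF AC]) blast+
    then have "B \<subseteq> A <+>\<^bsub>R\<^esub> (C1 <+>\<^bsub>R\<^esub> C2)" using d1(4) by simp
    then have "B <+>\<^bsub>R\<^esub> C2 \<subseteq> A <+>\<^bsub>R\<^esub> (C1 <+>\<^bsub>R\<^esub> C2)"
      using u v by (intro pideal_sum_least[OF AC]) blast+
    then show "C \<subseteq> A <+>\<^bsub>R\<^esub> (C1 <+>\<^bsub>R\<^esub> C2)" using d2(4) by simp
  qed
qed

text \<open>The second isomorphism theorem on the level of complements; it is what relation (D2)
  becomes in V(R).\<close>

lemma ideal_dsum_join:
  assumes "A \<in> pideals R" "B \<in> pideals R" "C \<in> pideals R" "ideal_dsum R B (A \<inter> B) C"
  shows "ideal_dsum R (A <+>\<^bsub>R\<^esub> B) A C"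
proof -
  note d = ideal_dsumD[OF assms(4) pideals_Int[OF assms(1,2)] assms(3)]
  note S = pideals_sum[OF assms(1,2)] and u = pideal_sum_upper[OF assms(1,2)]
  note S' = pideals_sum[OF assms(1,3)] and u' = pideal_sum_upper[OF assms(1,3)]
  show ?thesis
  proof (rule ideal_dsumI[OF assms(1,3) S u(1)])
    show "C \<subseteq> A <+>\<^bsub>R\<^esub> B" using u d by blast
    show "x = \<zero>" if "x \<in> A" "x \<in> C" for x using that d by blast
    have "A \<inter> B <+>\<^bsub>R\<^esub> C \<subseteq> A <+>\<^bsub>R\<^esub> C" using u' by (intro pideal_sum_least[OF S']) auto
    then have "B \<subseteq> A <+>\<^bsub>R\<^esub> C" using d(4) by (rule ord_eq_le_trans[rotated])
    then show "A <+>\<^bsub>R\<^esub> B \<subseteq> A <+>\<^bsub>R\<^esub> C" by (rule pideal_sum_least[OF S' u'(1)])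
  qed
qed

lemma dcls_zero: "dcls R {\<zero>} = \<one>\<^bsub>V_monoid R\<^esub>"
  using icls_zero by (simp add: pideal_zero_eq)

lemma dcls_one_iff:
  assumes "X \<in> pideals R" "dcls R X = \<one>\<^bsub>V_monoid R\<^esub>" shows "X = {\<zero>}"
proof -
  obtain e where "ring_idem R e" "X = pideal R e" using pideals_idem assms by metis
  then show ?thesis using icls_one_iff assms(2) pideal_zero_eq by metis
qed

text \<open>The class of a relative complement, that is, of the module \<open>b/a\<close>.\<close>

definition delta :: "'a set \<times> 'a set \<Rightarrow> ('a, nat \<Rightarrow> 'a) rmodule set" where
  "delta p = (case p of (a, b) \<Rightarrow> if a \<in> pideals R \<and> b \<in> pideals R \<and> a \<subseteq> b
     then dcls R (SOME c. c \<in> pideals R \<and> ideal_dsum R b a c) else \<one>\<^bsub>V_monoid R\<^esub>)"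

lemma delta_eq:
  assumes "a \<in> pideals R" "b \<in> pideals R" "c \<in> pideals R" "ideal_dsum R b a c"
  shows "delta (a, b) = dcls R c"
proof -
  have ab: "a \<subseteq> b" using ideal_dsumD[OF assms(4,1,3)] by simp
  define c' where "c' = (SOME c. c \<in> pideals R \<and> ideal_dsum R b a c)"
  have c': "c' \<in> pideals R \<and> ideal_dsum R b a c'"
    unfolding c'_def by (rule someI[of _ c]) (use assms in blast)
  have "dcls R c' = dcls R c"
    using dcls_common_compl[of c' c a b] c' assms ideal_dsum_comm by blast
  then show ?thesis using ab assms(1,2) by (simp add: delta_def c'_def)
qed

lemma delta_in: "delta p \<in> \<V>"
proof (cases "fst p \<in> pideals R \<and> snd p \<in> pideals R \<and> fst p \<subseteq> snd p")
  case True
  then obtain c where c: "c \<in> pideals R" "ideal_dsum R (snd p) (fst p) c" using pideals_compl by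
    metis
  then have "delta (fst p, snd p) = dcls R c" using delta_eq True by blast
  then show ?thesis using dcls_in[OF c(1)] by simp
next
  case False then show ?thesis by (auto simp: delta_def split: prod.splits)
qed

text \<open>Outside the carrier the summation step is made trivial, so that it is left commutative
  everywhere, as \<open>fold_mset\<close> requires.\<close>

definition delta_add :: "'a set \<times> 'a set \<Rightarrow> ('a, nat \<Rightarrow> 'a) rmodule set \<Rightarrow> ('a, nat \<Rightarrow> 'a) rmodule
  set" where
  "delta_add p v = (if v \<in> \<V> then delta p \<oplus>\<^sub>V v else v)"

definition dim_eval :: "('a set \<times> 'a set) multiset \<Rightarrow> ('a, nat \<Rightarrow> 'a) rmodule set" where
  "dim_eval A = fold_mset delta_add \<one>\<^bsub>V_monoid R\<^esub> A"

lemma delta_add_commute: "comp_fun_commute delta_add"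
proof
  fix p q show "delta_add q \<circ> delta_add p = delta_add p \<circ> delta_add q"
  proof
    fix v show "(delta_add q \<circ> delta_add p) v = (delta_add p \<circ> delta_add q) v"
      using delta_in[of p] delta_in[of q]
      by (cases "v \<in> \<V>") (simp_all add: delta_add_def V.m_lcomm)
  qed
qed

lemma dim_eval_empty [simp]: "dim_eval {#} = \<one>\<^bsub>V_monoid R\<^esub>"
  by (simp add: dim_eval_def)

lemma dim_eval_in [simp]: "dim_eval A \<in> \<V>"
proof (induction A)
  case (add p A)
  then show ?case using delta_in[of p]
    by (simp add: dim_eval_def comp_fun_commute.fold_mset_add_mset[OF delta_add_commute])
      (simp add: delta_add_def)
qed simp

lemma dim_eval_add_mset [simp]: "dim_eval (add_mset p A) = delta p \<oplus>\<^sub>V dim_eval A"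
  using dim_eval_in[of A]
  by (simp add: dim_eval_def comp_fun_commute.fold_mset_add_mset[OF delta_add_commute])
    (simp add: delta_add_def)

lemma dim_eval_plus: "dim_eval (A + B) = dim_eval A \<oplus>\<^sub>V dim_eval B"
  by (induction A) (simp_all add: delta_in V.m_assoc)

text \<open>The defining relations hold for the classes of relative complements, so the evaluation
  descends to Dim.\<close>

lemma dim_eval_cong: "dim_cong L A B \<Longrightarrow> dim_eval A = dim_eval B"
proof (induction rule: dim_cong.induct)
  case (D0 a)
  have "ideal_dsum R a a {\<zero>}"
    using D0 pideal_zero[OF D0] pideal_sum_upper[OF D0 zero_in_pideals]
    by (intro ideal_dsumI[OF D0 zero_in_pideals D0]) auto
  then show ?case using delta_eq[OF D0 D0 zero_in_pideals] dcls_zero by simp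
next
  case (D1 a b c)
  obtain c1 where c1: "c1 \<in> pideals R" "ideal_dsum R b a c1" using pideals_compl D1 by auto
  obtain c2 where c2: "c2 \<in> pideals R" "ideal_dsum R c b c2" using pideals_compl D1 by auto
  note as = ideal_dsum_assoc[OF D1(1) c1(1) c2(1) D1(2,3) c1(2) c2(2)]
  note S = pideals_sum[OF c1(1) c2(1)]
  have "delta (a, c) = dcls R c1 \<oplus>\<^sub>V dcls R c2"
    using delta_eq[OF D1(1,3) S as(2)] dcls_dsum[OF c1(1) c2(1) S as(1)] by simp
  then show ?case
    using delta_eq[OF D1(1,2) c1] delta_eq[OF D1(2,3) c2] delta_in[of "(a, c)"] dcls_in[OF c1(1)]
      dcls_in[OF c2(1)]
    by simp
next
  case (D2 a b)
  note ab = pideals_Int[OF D2]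
  obtain c where c: "c \<in> pideals R" "ideal_dsum R b (a \<inter> b) c" using pideals_compl[OF ab D2(2)] by
    auto
  show ?case
    using delta_eq[OF ab D2(2) c] delta_eq[OF D2(1) pideals_sum[OF D2] c(1) ideal_dsum_join[OF D2
      c]]
    by (simp add: join_right_ideal_lattice[OF D2] meet_right_ideal_lattice[OF D2])
qed (simp_all add: dim_eval_plus)

section \<open>Calculating in the dimension monoid\<close>

lemma dim_free_simps [simp]:
  "{#} \<in> dim_free L" "add_mset (a, b) A \<in> dim_free L \<longleftrightarrow> a \<in> pideals R \<and> b \<in> pideals R \<and> a \<subseteq> b \<and> A \<in>
  dim_free L"
  "A + B \<in> dim_free L \<longleftrightarrow> A \<in> dim_free L \<and> B \<in> dim_free L"
  by (auto simp: dim_free_def)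

lemma dim_class_eq_iff:
  assumes "A \<in> dim_free L" shows "dim_class L A = dim_class L B \<longleftrightarrow> dim_cong L A B"
  unfolding dim_class_def using assms dim_cong.refl dim_cong.sym dim_cong.trans by blast

lemma dim_class_mult:
  assumes "A \<in> dim_free L" "B \<in> dim_free L"
  shows "dim_class L A \<otimes>\<^bsub>Dim L\<^esub> dim_class L B = dim_class L (A + B)"
proof -
  have "dim_class L (A' + B') = dim_class L (A + B)" if "dim_cong L A A'" "dim_cong L B B'" for A'
    B'
    using dim_cong.add[OF that] dim_class_eq_iff[of "A + B" "A' + B'"] assms by simp
  moreover have "dim_cong L A A" "dim_cong L B B" using assms dim_cong.refl by auto
  ultimately show ?thesis unfolding Dim_def monoid.simps dim_class_def mem_Collect_eq by blast
qed

lemma dim_classE: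
  assumes "X \<in> carrier (Dim L)" obtains A where "A \<in> dim_free L" "X = dim_class L A"
  using assms by (auto simp: Dim_def)

lemma dim_class_in: "A \<in> dim_free L \<Longrightarrow> dim_class L A \<in> carrier (Dim L)"
  by (auto simp: Dim_def)

lemma dim_one: "\<one>\<^bsub>Dim L\<^esub> = dim_class L {#}"
  by (simp add: Dim_def)

abbreviation from_zero :: "'a set multiset \<Rightarrow> ('a set \<times> 'a set) multiset" where
  "from_zero F \<equiv> image_mset (Pair {\<zero>}) F"

lemma from_zero_free: "from_zero F \<in> dim_free L \<longleftrightarrow> set_mset F \<subseteq> pideals R"
  using zero_in_pideals pideal_zero by (induction F) auto

text \<open>This is (D2) for a and c, whose join is b and whose meet is zero.\<close>

lemma dim_cong_compl:
  assumes "a \<in> pideals R" "b \<in> pideals R" "c \<in> pideals R" "ideal_dsum R b a c"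
  shows "dim_cong L {#(a, b)#} {#({\<zero>}, c)#}"
  using dim_cong.D2[OF assms(1,3)] assms(4)
  by (simp add: join_right_ideal_lattice[OF assms(1,3)] meet_right_ideal_lattice[OF assms(1,3)]
    ideal_dsum_def)

lemma dim_cong_dsum:
  assumes "X \<in> pideals R" "Y \<in> pideals R" "Z \<in> pideals R" "ideal_dsum R X Y Z"
  shows "dim_cong L {#({\<zero>}, X)#} {#({\<zero>}, Y), ({\<zero>}, Z)#}"
proof -
  have "dim_cong L {#({\<zero>}, X)#} {#({\<zero>}, Y), (Y, X)#}"
    using ideal_dsumD[OF assms(4,2,3)] pideal_zero assms zero_in_pideals by (intro dim_cong.D1) auto
  moreover have "dim_cong L {#({\<zero>}, Y), (Y, X)#} {#({\<zero>}, Y), ({\<zero>}, Z)#}"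
    using dim_cong.add[OF dim_cong.refl[of "{#({\<zero>}, Y)#}" L] dim_cong_compl[OF assms(2,1,3,4)]]
      pideal_zero[OF assms(2)] assms(2) zero_in_pideals by (simp add: add_mset_commute)
  ultimately show ?thesis by (rule dim_cong.trans)
qed

text \<open>By (D2) the intervals from T \<inter> J to J and from T \<inter> K to K both have the
  dimension of the interval from T to T + J = T + K. The common interval from zero to T \<inter> J
  is then added by (D1).\<close>

lemma dim_cong_perspective:
  assumes J: "J \<in> pideals R" and K: "K \<in> pideals R" and "ideal_perspective R J K"
  shows "dim_cong L {#({\<zero>}, J)#} {#({\<zero>}, K)#}"
proof -
  obtain T where T: "T \<in> pideals R" "J \<inter> T = K \<inter> T" "J <+>\<^bsub>R\<^esub> T = K <+>\<^bsub>R\<^esub> T"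
    using assms by (auto simp: ideal_perspective_def)
  have "T <+>\<^bsub>R\<^esub> J = T <+>\<^bsub>R\<^esub> K"
    using T(3) set_add_comm[OF T(1)[THEN pideal_subset]] J K pideal_subset by metis
  moreover have "T \<inter> J = T \<inter> K" using T(2) by auto
  ultimately have 1: "dim_cong L {#(T \<inter> J, J)#} {#(T \<inter> J, K)#}"
    using dim_cong.D2[OF T(1) J] dim_cong.D2[OF T(1) K] dim_cong.sym dim_cong.trans
    by (metis join_right_ideal_lattice[OF T(1) J] meet_right_ideal_lattice[OF T(1) J]
      join_right_ideal_lattice[OF T(1) K] meet_right_ideal_lattice[OF T(1) K])
  note TJ = pideals_Int[OF T(1) J]
  have z: "{\<zero>} \<subseteq> T \<inter> J" using pideal_zero[OF TJ] by simp
  have KT: "T \<inter> J \<subseteq> K" using T(2) by blast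
  have "dim_cong L {#({\<zero>}, J)#} {#({\<zero>}, T \<inter> J), (T \<inter> J, J)#}"
    using z TJ J zero_in_pideals by (intro dim_cong.D1) auto
  moreover have "dim_cong L {#({\<zero>}, K)#} {#({\<zero>}, T \<inter> J), (T \<inter> J, K)#}"
    using z TJ K KT zero_in_pideals by (intro dim_cong.D1) auto
  moreover have "dim_cong L {#({\<zero>}, T \<inter> J), (T \<inter> J, J)#} {#({\<zero>}, T \<inter> J), (T \<inter> J, K)#}"
    using dim_cong.add[OF dim_cong.refl[of "{#({\<zero>}, T \<inter> J)#}" L] 1] z TJ zero_in_pideals
    by (simp add: add_mset_commute)
  ultimately show ?thesis
    by (blast intro: dim_cong.trans[OF dim_cong.trans dim_cong.sym])
qed

text \<open>Relative complements turn every interval into one starting at zero. Consequently the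
  elements Delta(X) generate Dim, which serves both uniqueness and injectivity.\<close>

lemma dim_cong_from_zero:
  assumes "A \<in> dim_free L"
  shows "\<exists>F. set_mset F \<subseteq> pideals R \<and> dim_cong L A (from_zero F)"
  using assms
proof (induction A)
  case empty
  then show ?case using dim_cong.refl[of "{#}" L] by (intro exI[of _ "{#}"]) simp
next
  case (add p A)
  obtain a b where p: "p = (a, b)" by fastforce
  then have ab: "a \<in> pideals R" "b \<in> pideals R" "a \<subseteq> b" "A \<in> dim_free L" using add.prems by auto
  obtain F where F: "set_mset F \<subseteq> pideals R" "dim_cong L A (from_zero F)" using add.IH ab(4) by
    blast
  obtain c where c: "c \<in> pideals R" "ideal_dsum R b a c" using pideals_compl ab by metis
  have "dim_cong L (add_mset p A) (from_zero (add_mset c F))"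
    using dim_cong.add[OF dim_cong_compl[OF ab(1,2) c] F(2)] p by simp
  then show ?case using F(1) c(1) by (intro exI[of _ "add_mset c F"]) simp
qed

lemma delta_from_zero:
  assumes "X \<in> pideals R" shows "delta ({\<zero>}, X) = dcls R X"
proof (rule delta_eq[OF zero_in_pideals assms assms])
  show "ideal_dsum R X {\<zero>} X"
    using pideal_zero[OF assms] pideal_sum_upper[OF zero_in_pideals assms]
    by (intro ideal_dsumI[OF zero_in_pideals assms assms]) auto
qed

lemma dim_cong_zero: "dim_cong L {#({\<zero>}, {\<zero>})#} {#}"
  by (rule dim_cong.D0[OF zero_in_pideals])

text \<open>V(R) is conical, so a sum that vanishes has only zero terms, and each of these is
  removed by (D0).\<close>

lemma from_zero_trivial:
  assumes "set_mset F \<subseteq> pideals R" "dim_eval (from_zero F) = \<one>\<^bsub>V_monoid R\<^esub>"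
  shows "dim_cong L {#} (from_zero F)"
  using assms
proof (induction F)
  case empty then show ?case using dim_cong.refl[of "{#}" L] by simp
next
  case (add X F)
  have X: "X \<in> pideals R" using add.prems by simp
  have eq: "dcls R X \<oplus>\<^sub>V dim_eval (from_zero F) = \<one>\<^bsub>V_monoid R\<^esub>"
    using add.prems delta_from_zero[OF X] by simp
  then have "dcls R X = \<one>\<^bsub>V_monoid R\<^esub>" using V_conical[OF dcls_in[OF X] dim_eval_in] by blast
  then have "X = {\<zero>}" "dim_eval (from_zero F) = \<one>\<^bsub>V_monoid R\<^esub>" using dcls_one_iff[OF X] eq by simp_all
  then show ?case
    using dim_cong.add[OF dim_cong.sym[OF dim_cong_zero] add.IH] add.prems by simp
qed

text \<open>A homomorphism is determined by its values on the generators Delta(X), which the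
  definition of a natural homomorphism prescribes.\<close>

lemma natural_dim_hom_eval:
  assumes "natural_dim_hom R \<pi>" "A \<in> dim_free L"
  shows "\<pi> (dim_class L A) = dim_eval A"
proof -
  have \<pi>: "\<pi> \<in> hom (Dim L) (V_monoid R)" "\<pi> \<one>\<^bsub>Dim L\<^esub> = \<one>\<^bsub>V_monoid R\<^esub>"
    "\<And>X. X \<in> pideals R \<Longrightarrow> \<pi> (dim_class L {#({\<zero>}, X)#}) = dcls R X"
    using assms(1) by (auto simp: natural_dim_hom_def Delta0_def Delta_def
      bottom_right_ideal_lattice)
  obtain F where F: "set_mset F \<subseteq> pideals R" "dim_cong L A (from_zero F)"
    using dim_cong_from_zero[OF assms(2)] by blast
  have "\<pi> (dim_class L (from_zero F)) = dim_eval (from_zero F)"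
    using F(1)
  proof (induction F)
    case empty then show ?case using \<pi>(2) by (simp add: dim_one)
  next
    case (add X F)
    have X: "X \<in> pideals R" "from_zero F \<in> dim_free L" "{#({\<zero>}, X)#} \<in> dim_free L"
      using add.prems pideal_zero zero_in_pideals by (auto simp: from_zero_free)
    have "\<pi> (dim_class L {#({\<zero>}, X)#} \<otimes>\<^bsub>Dim L\<^esub> dim_class L (from_zero F)) =
      dcls R X \<oplus>\<^sub>V dim_eval (from_zero F)"
      using hom_mult[OF \<pi>(1) dim_class_in[OF X(3)] dim_class_in[OF X(2)]] \<pi>(3)[OF X(1)] add by simp
    then show ?case using dim_class_mult[OF X(3,2)] delta_from_zero[OF X(1)] by simp
  qed
  then show ?thesis
    using dim_class_eq_iff[OF assms(2)] F(2) dim_eval_cong[OF F(2)] by metis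
qed

section \<open>The natural homomorphism\<close>

definition dim_iso :: "('a set \<times> 'a set) multiset set \<Rightarrow> ('a, nat \<Rightarrow> 'a) rmodule set" where
  "dim_iso = (\<lambda>X\<in>carrier (Dim L). dim_eval (SOME A. A \<in> X))"

lemma dim_iso_class:
  assumes "A \<in> dim_free L" shows "dim_iso (dim_class L A) = dim_eval A"
proof -
  have "A \<in> dim_class L A" using assms dim_cong.refl by (simp add: dim_class_def)
  then have "(SOME B. B \<in> dim_class L A) \<in> dim_class L A" by (rule someI)
  then have "dim_eval A = dim_eval (SOME B. B \<in> dim_class L A)"
    by (intro dim_eval_cong) (simp add: dim_class_def)
  then show ?thesis using dim_class_in[OF assms] by (simp add: dim_iso_def)
qed

lemma natural_dim_iso: "natural_dim_hom R dim_iso"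
  unfolding natural_dim_hom_def
proof (intro conjI ballI)
  show "dim_iso \<in> hom (Dim L) (V_monoid R)"
  proof (rule homI)
    fix X Y assume "X \<in> carrier (Dim L)" "Y \<in> carrier (Dim L)"
    then obtain A B where "A \<in> dim_free L" "X = dim_class L A" "B \<in> dim_free L" "Y = dim_class L B"
      by (metis dim_classE)
    then show "dim_iso (X \<otimes>\<^bsub>Dim L\<^esub> Y) = dim_iso X \<oplus>\<^sub>V dim_iso Y"
      by (simp add: dim_class_mult dim_iso_class dim_eval_plus)
  next
    fix X assume "X \<in> carrier (Dim L)"
    then obtain A where "A \<in> dim_free L" "X = dim_class L A" by (metis dim_classE)
    then show "dim_iso X \<in> \<V>" by (simp add: dim_iso_class)
  qed
  show "dim_iso \<in> extensional (carrier (Dim L))" by (simp add: dim_iso_def)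
  show "dim_iso \<one>\<^bsub>Dim L\<^esub> = \<one>\<^bsub>V_monoid R\<^esub>" by (simp add: dim_one dim_iso_class)
  fix X assume X: "X \<in> pideals R"
  then have "{#({\<zero>}, X)#} \<in> dim_free L" using pideal_zero zero_in_pideals by simp
  then show "dim_iso (Delta0 L X) = dcls R X"
    using delta_from_zero[OF X] dcls_in[OF X]
    by (simp add: Delta0_def Delta_def bottom_right_ideal_lattice dim_iso_class)
qed

lemma natural_dim_hom_unique:
  assumes "natural_dim_hom R \<pi>" shows "\<pi> = dim_iso"
proof (rule extensionalityI)
  show "\<pi> \<in> extensional (carrier (Dim L))" "dim_iso \<in> extensional (carrier (Dim L))"
    using assms natural_dim_iso by (simp_all add: natural_dim_hom_def)
  fix X assume "X \<in> carrier (Dim L)"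
  then obtain A where "A \<in> dim_free L" "X = dim_class L A" by (metis dim_classE)
  then show "\<pi> X = dim_iso X" using natural_dim_hom_eval[OF assms] dim_iso_class by simp
qed

lemma dim_iso_surj:
  assumes "v \<in> \<V>"
  shows "\<exists>A\<in>dim_free L. dim_eval A = v"
  using assms
proof (induction v rule: V_induct)
  case one then show ?case by (intro bexI[of _ "{#}"]) simp_all
next
  case (mult e w)
  then obtain A where A: "A \<in> dim_free L" "dim_eval A = w" by blast
  have "pideal R e \<in> pideals R" using mult(1) pideal_in ring_idem_closed by metis
  then show ?case
    using A pideal_zero zero_in_pideals by (intro bexI[of _ "add_mset ({\<zero>}, pideal R e) A"])
      (simp_all add: delta_from_zero)
qed

end

section \<open>Injectivity of the natural homomorphism\<close>

context separative_regular
begin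

lemma dim_cong_dcls:
  assumes "X \<in> pideals R" "Y \<in> pideals R" "dcls R X = dcls R Y"
  shows "dim_cong L {#({\<zero>}, X)#} {#({\<zero>}, Y)#}"
proof -
  obtain X0 X1 Y0 Y1 where *: "X0 \<in> pideals R" "X1 \<in> pideals R" "Y0 \<in> pideals R" "Y1 \<in> pideals R"
    "ideal_dsum R X X0 X1" "ideal_dsum R Y Y0 Y1"
    "ideal_perspective R X0 Y0" "ideal_perspective R X1 Y1" using perspective_decomposition[OF
    assms] .
  have "dim_cong L {#({\<zero>}, X0), ({\<zero>}, X1)#} {#({\<zero>}, Y0), ({\<zero>}, Y1)#}"
    using dim_cong.add[OF dim_cong_perspective[OF *(1,3,7)] dim_cong_perspective[OF *(2,4,8)]]
    by (simp add: add_mset_commute)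
  with dim_cong_dsum[OF assms(1) *(1,2,5)]
  have "dim_cong L {#({\<zero>}, X)#} {#({\<zero>}, Y0), ({\<zero>}, Y1)#}" by (rule dim_cong.trans)
  then show ?thesis
    using dim_cong.sym[OF dim_cong_dsum[OF assms(2) *(3,4,6)]] by (rule dim_cong.trans)
qed

text \<open>Equations in V(R) need not be cancellable, so it would not help to know only that G is
  congruent to X plus something. The remainder G' is produced with the prescribed value n; exchange
  supplies it while running through the terms of G.\<close>

lemma from_zero_extract:
  assumes "set_mset G \<subseteq> pideals R" "X \<in> pideals R" "n \<in> \<V>"
    "dcls R X \<oplus>\<^sub>V n = dim_eval (from_zero G)"
  shows "\<exists>G'. set_mset G' \<subseteq> pideals R \<and> dim_eval (from_zero G') = n \<and>
    dim_cong L (from_zero G) (from_zero (add_mset X G'))"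
  using assms
proof (induction G arbitrary: X n)
  case empty
  then have eq: "dcls R X \<oplus>\<^sub>V n = \<one>\<^bsub>V_monoid R\<^esub>" by simp
  have "dcls R X = \<one>\<^bsub>V_monoid R\<^esub>" by (rule V_conical[OF dcls_in[OF empty(2)] empty(3) eq])
  then have "X = {\<zero>}" "n = \<one>\<^bsub>V_monoid R\<^esub>" using dcls_one_iff[OF empty(2)] eq empty(3) by simp_all
  then show ?case using dim_cong.sym[OF dim_cong_zero] by (intro exI[of _ "{#}"]) simp
next
  case (add g G)
  have g: "g \<in> pideals R" "set_mset G \<subseteq> pideals R" using add.prems by auto
  obtain e where e: "ring_idem R e" "X = pideal R e" using pideals_idem add.prems(2) by metis
  obtain g0 where g0: "ring_idem R g0" "g = pideal R g0" using pideals_idem g by metis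
  have "icls R e \<oplus>\<^sub>V n = dcls R g \<oplus>\<^sub>V dim_eval (from_zero G)"
    using add.prems(4) e delta_from_zero[OF g(1)] by simp
  from V_exchange[OF e(1) add.prems(3) dcls_in[OF g(1)] dim_eval_in this]
  obtain f h c' d' where fh: "ring_idem R f" "ring_idem R h" "ring_orth R f h" "f \<oplus> h = e"
    and cd: "c' \<in> \<V>" "d' \<in> \<V>"
    "dcls R g = icls R f \<oplus>\<^sub>V c'" "dim_eval (from_zero G) = icls R h \<oplus>\<^sub>V d'"
    "n = c' \<oplus>\<^sub>V d'" .
  note P = fh(1,2)[THEN ring_idem_closed, THEN pideal_in]
  obtain G' where G': "set_mset G' \<subseteq> pideals R" "dim_eval (from_zero G') = d'"
    "dim_cong L (from_zero G) (from_zero (add_mset (pideal R h) G'))"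
    using add.IH[OF g(2) P(2) cd(2) cd(4)[symmetric]] by blast
  \<comment> \<open>The share f of X in g is realised inside g only up to equivalence, by g1. The
    idempotent f itself is needed to reassemble X from f and h.\<close>
  obtain g1 g2 where gg: "ring_idem R g1" "ring_idem R g2" "ring_orth R g1 g2" "g0 = g1 \<oplus> g2"
    "icls R g1 = icls R f" "icls R g2 = c'"
    using icls_split[OF g0(1) icls_in[OF fh(1)] cd(1)] cd(3) g0(2) by metis
  note Q = gg(1,2)[THEN ring_idem_closed, THEN pideal_in]
  let ?p = "\<lambda>a. ({\<zero>}, pideal R a)"
  have free: "{#?p a#} \<in> dim_free L" if "pideal R a \<in> pideals R" for a
    using that pideal_zero[OF that] zero_in_pideals by simp
  have "dim_cong L {#({\<zero>}, g)#} {#?p g1, ?p g2#}"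
    using dim_cong_dsum[OF g(1) Q] pideal_sum_orth[OF gg(1-3)] gg(4) g0(2) by simp
  \<comment> \<open>Replacing g1 by f is legitimate because the dimension depends only on the
    isomorphism class; this is where (b) enters.\<close>
  moreover have "dim_cong L {#?p g1, ?p g2#} {#?p f, ?p g2#}"
    using dim_cong.add[OF dim_cong_dcls[OF Q(1) P(1) gg(5)] dim_cong.refl[OF free[OF Q(2)]]]
    by (simp add: add_mset_commute)
  ultimately have "dim_cong L {#({\<zero>}, g)#} {#?p f, ?p g2#}" by (rule dim_cong.trans)
  from dim_cong.add[OF this G'(3)]
  have 1: "dim_cong L (from_zero (add_mset g G)) ({#?p f, ?p h#} + from_zero (add_mset (pideal R
    g2) G'))"
    by (simp add: add_mset_commute)
  have "dim_cong L {#({\<zero>}, X)#} {#?p f, ?p h#}"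
    using dim_cong_dsum[OF add.prems(2) P] pideal_sum_orth[OF fh(1-3)] fh(4) e(2) by simp
  moreover have "from_zero (add_mset (pideal R g2) G') \<in> dim_free L"
    using G'(1) Q(2) unfolding from_zero_free by simp
  ultimately have "dim_cong L ({#({\<zero>}, X)#} + from_zero (add_mset (pideal R g2) G'))
    ({#?p f, ?p h#} + from_zero (add_mset (pideal R g2) G'))"
    by (intro dim_cong.add dim_cong.refl)
  from dim_cong.sym[OF this]
  have "dim_cong L ({#?p f, ?p h#} + from_zero (add_mset (pideal R g2) G'))
    (from_zero (add_mset X (add_mset (pideal R g2) G')))" by (simp add: add_mset_commute)
  then have "dim_cong L (from_zero (add_mset g G)) (from_zero (add_mset X (add_mset (pideal R g2)
    G')))"
    using 1 dim_cong.trans by blast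
  moreover have "dim_eval (from_zero (add_mset (pideal R g2) G')) = n"
    using G'(2) cd(5) gg(6) delta_from_zero[OF Q(2)] by simp
  ultimately show ?case using G'(1) Q(2) by (intro exI[of _ "add_mset (pideal R g2) G'"]) simp
qed

text \<open>Extract each term of F from G in turn. The remainder of G has exactly the value of the
  remaining part of F, so the induction continues.\<close>

lemma from_zero_inj:
  assumes "set_mset F \<subseteq> pideals R" "set_mset G \<subseteq> pideals R"
    "dim_eval (from_zero F) = dim_eval (from_zero G)"
  shows "dim_cong L (from_zero F) (from_zero G)"
  using assms
proof (induction F arbitrary: G)
  case empty
  then show ?case using from_zero_trivial[of G] by simp
next
  case (add X F)
  have X: "X \<in> pideals R" "set_mset F \<subseteq> pideals R" using add.prems by auto
  obtain G' where G': "set_mset G' \<subseteq> pideals R" "dim_eval (from_zero G') = dim_eval (from_zero F)"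
    "dim_cong L (from_zero G) (from_zero (add_mset X G'))"
    using from_zero_extract[OF add.prems(2) X(1) dim_eval_in[of "from_zero F"]] add.prems(3)
      delta_from_zero[OF X(1)] by auto
  have "dim_cong L (from_zero F) (from_zero G')" using add.IH[OF X(2) G'(1)] G'(2) by simp
  moreover have "{#({\<zero>}, X)#} \<in> dim_free L" using X(1) pideal_zero[OF X(1)] zero_in_pideals by simp
  ultimately have "dim_cong L (from_zero (add_mset X F)) (from_zero (add_mset X G'))"
    using dim_cong.add[OF dim_cong.refl[of "{#({\<zero>}, X)#}" L]] by fastforce
  then show ?case using G'(3) dim_cong.sym dim_cong.trans by blast
qed

lemma dim_eval_inj:
  assumes "A \<in> dim_free L" "B \<in> dim_free L" "dim_eval A = dim_eval B" shows "dim_cong L A B"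
proof -
  obtain F where F: "set_mset F \<subseteq> pideals R" "dim_cong L A (from_zero F)"
    using dim_cong_from_zero[OF assms(1)] by blast
  obtain G where G: "set_mset G \<subseteq> pideals R" "dim_cong L B (from_zero G)"
    using dim_cong_from_zero[OF assms(2)] by blast
  have "dim_cong L (from_zero F) (from_zero G)"
    using from_zero_inj[OF F(1) G(1)] dim_eval_cong[OF F(2)] dim_eval_cong[OF G(2)] assms(3) by simp
  then show ?thesis using F(2) G(2) dim_cong.sym dim_cong.trans by metis
qed

lemma dim_iso_iso: "dim_iso \<in> iso (Dim L) (V_monoid R)"
  unfolding iso_def
proof (intro CollectI conjI)
  show "dim_iso \<in> hom (Dim L) (V_monoid R)" using natural_dim_iso by (simp add: natural_dim_hom_def)
  show "bij_betw dim_iso (carrier (Dim L)) (\<V>)"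
    unfolding bij_betw_def
  proof
    show "inj_on dim_iso (carrier (Dim L))"
    proof (rule inj_onI)
      fix X Y assume "X \<in> carrier (Dim L)" "Y \<in> carrier (Dim L)" and eq: "dim_iso X = dim_iso Y"
      then obtain A B where AB: "A \<in> dim_free L" "X = dim_class L A" "B \<in> dim_free L"
        "Y = dim_class L B"
        by (metis dim_classE)
      then have "dim_cong L A B" using eq by (intro dim_eval_inj) (simp_all add: dim_iso_class)
      then show "X = Y" using AB dim_class_eq_iff by simp
    qed
    show "dim_iso ` carrier (Dim L) = \<V>"
    proof (intro equalityI subsetI)
      fix v assume "v \<in> dim_iso ` carrier (Dim L)"
      then obtain A where "A \<in> dim_free L" "v = dim_iso (dim_class L A)" by (metis dim_classE
        imageE)
      then show "v \<in> \<V>" by (simp add: dim_iso_class)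
    next
      fix v assume "v \<in> \<V>"
      then obtain A where "A \<in> dim_free L" "dim_eval A = v" using dim_iso_surj by blast
      then show "v \<in> dim_iso ` carrier (Dim L)" using dim_iso_class dim_class_in by (metis imageI)
    qed
  qed
qed

lemma V_iso_Dim: "V_monoid R \<cong> Dim L"
proof -
  let ?g = "inv_into (carrier (Dim L)) dim_iso"
  have h: "dim_iso \<in> hom (Dim L) (V_monoid R)" and b: "bij_betw dim_iso (carrier (Dim L)) (\<V>)"
    using dim_iso_iso by (auto simp: iso_def)
  have g: "bij_betw ?g (\<V>) (carrier (Dim L))" by (rule bij_betw_inv_into[OF b])
  then have gc: "?g v \<in> carrier (Dim L)" if "v \<in> \<V>" for v using that bij_betwE by blast
  have fg: "dim_iso (?g v) = v" if "v \<in> \<V>" for v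
    by (rule bij_betw_inv_into_right[OF b that])
  have "?g \<in> hom (V_monoid R) (Dim L)"
  proof (rule homI)
    fix v w assume v: "v \<in> \<V>" and w: "w \<in> \<V>"
    have "?g v \<otimes>\<^bsub>Dim L\<^esub> ?g w \<in> carrier (Dim L)"
      using gc[OF v] gc[OF w] dim_class_mult dim_class_in dim_free_simps(3) by (metis dim_classE)
    then have "?g (dim_iso (?g v \<otimes>\<^bsub>Dim L\<^esub> ?g w)) = ?g v \<otimes>\<^bsub>Dim L\<^esub> ?g w"
      using b by (simp add: bij_betw_inv_into_left)
    then show "?g (v \<oplus>\<^sub>V w) = ?g v \<otimes>\<^bsub>Dim L\<^esub> ?g w"
      using hom_mult[OF h gc[OF v] gc[OF w]] fg[OF v] fg[OF w] by simp
  qed (rule gc)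
  then have "?g \<in> iso (V_monoid R) (Dim L)" using g by (simp add: iso_def)
  then show ?thesis unfolding is_iso_def by blast
qed

end

theorem corollary13p14:
  fixes R :: "('a, 'b) ring_scheme" and I :: "'a set" and S :: "'a set ring"
  assumes "regular_ring R"
    and "aleph0_left_continuous R \<or> aleph0_right_continuous R"
    and "ideal I R"
    and "S = R Quot I"
  shows
    "(\<forall>a\<in>carrier (V_monoid S). \<forall>b\<in>carrier (V_monoid S). \<forall>c\<in>carrier (V_monoid S).
        a \<otimes>\<^bsub>V_monoid S\<^esub> c = b \<otimes>\<^bsub>V_monoid S\<^esub> c \<longrightarrow>
        (\<exists>d\<in>carrier (V_monoid S).
           d = d \<otimes>\<^bsub>V_monoid S\<^esub> d \<and>
           (\<exists>z\<in>carrier (V_monoid S). d \<otimes>\<^bsub>V_monoid S\<^esub> z = c) \<and>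
           a \<otimes>\<^bsub>V_monoid S\<^esub> d = b \<otimes>\<^bsub>V_monoid S\<^esub> d)) \<and>
     (\<forall>J\<in>carrier (right_ideal_lattice S). \<forall>K\<in>carrier (right_ideal_lattice S).
        rmod_isomorphic S (right_ideal_module S J) (right_ideal_module S K) \<longleftrightarrow>
        (\<exists>J0\<in>carrier (right_ideal_lattice S). \<exists>J1\<in>carrier (right_ideal_lattice S).
         \<exists>K0\<in>carrier (right_ideal_lattice S). \<exists>K1\<in>carrier (right_ideal_lattice S).
           ideal_dsum S J J0 J1 \<and> ideal_dsum S K K0 K1 \<and>
           ideal_perspective S J0 K0 \<and> ideal_perspective S J1 K1)) \<and>
     ((\<exists>!\<pi>. natural_dim_hom S \<pi>) \<and>
      (\<forall>\<pi>. natural_dim_hom S \<pi> \<longrightarrow> \<pi> \<in> iso (Dim (right_ideal_lattice S)) (V_monoid S)) \<and>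
      V_monoid S \<cong> Dim (right_ideal_lattice S)) \<and>
     (directly_finite S \<longrightarrow> unit_regular_ring S)"
proof -
  interpret R: regular R using assms(1) by (simp add: regular_iff)
  interpret RS: regular_surj R S "(+>\<^bsub>R\<^esub>) I"
    using R.regular_surj_Quot[OF assms(3)] assms(4) by simp
  \<comment> \<open>What S inherits from R is not continuity but the idempotent form of
    separativity.\<close>
  interpret S: separative_regular S
    using RS.regular_image RS.idem_separative_image[OF idem_separative_continuous[OF assms(2)]]
    by (simp add: separative_regular_def separative_regular_axioms_def)
  show ?thesis
  proof (intro conjI ballI allI impI)
    fix a b c assume "a \<in> carrier (V_monoid S)" "b \<in> carrier (V_monoid S)" "c \<in> carrier (V_monoid S)"
      "a \<otimes>\<^bsub>V_monoid S\<^esub> c = b \<otimes>\<^bsub>V_monoid S\<^esub> c"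
    from S.separates_V[OF this] show "\<exists>d\<in>carrier (V_monoid S).
           d = d \<otimes>\<^bsub>V_monoid S\<^esub> d \<and>
           (\<exists>z\<in>carrier (V_monoid S). d \<otimes>\<^bsub>V_monoid S\<^esub> z = c) \<and>
           a \<otimes>\<^bsub>V_monoid S\<^esub> d = b \<otimes>\<^bsub>V_monoid S\<^esub> d" by metis
  next
    fix J K assume JK: "J \<in> pideals S" "K \<in> pideals S"
    show "rmod_isomorphic S (right_ideal_module S J) (right_ideal_module S K) \<longleftrightarrow>
        (\<exists>J0\<in>pideals S. \<exists>J1\<in>pideals S. \<exists>K0\<in>pideals S. \<exists>K1\<in>pideals S.
           ideal_dsum S J J0 J1 \<and> ideal_dsum S K K0 K1 \<and>
           ideal_perspective S J0 K0 \<and> ideal_perspective S J1 K1)" (is "?l \<longleftrightarrow> ?r")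
    proof
      assume ?l
      then have "dcls S J = dcls S K" using S.dcls_eq_iff[OF JK] by simp
      from S.perspective_decomposition[OF JK this] show ?r by metis
    next
      assume ?r
      then obtain J0 J1 K0 K1 where *: "J0 \<in> pideals S" "J1 \<in> pideals S" "K0 \<in> pideals S" "K1 \<in> pideals S"
        "ideal_dsum S J J0 J1" "ideal_dsum S K K0 K1"
        "ideal_perspective S J0 K0" "ideal_perspective S J1 K1" by blast
      \<comment> \<open>Perspective summands have equal classes, and classes add along the two
        decompositions.\<close>
      have "dcls S J = dcls S K"
        using S.dcls_dsum[OF *(1,2) JK(1) *(5)] S.dcls_dsum[OF *(3,4) JK(2) *(6)]
          S.dcls_perspective[OF *(1,3,7)] S.dcls_perspective[OF *(2,4,8)] by simp
      then show ?l using S.dcls_eq_iff[OF JK] by simp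
    qed
  next
    show "\<exists>!\<pi>. natural_dim_hom S \<pi>"
      using S.natural_dim_iso S.natural_dim_hom_unique by blast
    show "\<pi> \<in> iso (Dim (right_ideal_lattice S)) (V_monoid S)" if "natural_dim_hom S \<pi>" for \<pi>
      using S.dim_iso_iso S.natural_dim_hom_unique[OF that] by simp
    show "V_monoid S \<cong> Dim (right_ideal_lattice S)" by (rule S.V_iso_Dim)
  next
    assume "directly_finite S"
    then show "unit_regular_ring S" by (rule S.unit_regular)
  qed
qed

end
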